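(* Let $H$ be a Tonelli Hamiltonian on $\mathbb T^d$ with associated Lagrangian $L$. Let $(h_n)$ be mesh sizes and $(\tau_n)$ positive time steps such that $\tau_n\to0$ and $h_n\le C_*\tau_n^2$ for some constant $C_*>0$. Then $$\limsup_{n\to\infty}\widetilde{\mathcal M}_{h_n,\tau_n}\subset\widetilde{\mathcal N}_L,$$ where $\limsup$ is the Kuratowski upper limit, $\widetilde{\mathcal M}_{h,\tau}$ is the fully-discrete Mather set and $\widetilde{\mathcal N}_L$ is the continuous Mañé set.
   Context: $\mathbb T^d=\mathbb R^d/\mathbb Z^d$. $H\in C^2(\mathbb T^d\times\mathbb R^d)$ is a Tonelli Hamiltonian: $D^2_{pp}H(x,p)>0$ everywhere and $H$ is superlinear in $p$. The Tonelli Lagrangian is $L(x,v)=\sup_{p\in\mathbb R^d}\{p\cdot v-H(x,p)\}$; it is of class $C^2$, strictly convex in $v$, and superlinear: for every $K>0$ there is $C(K)\in\mathbb R$ with $L(x,v)\ge K|v|-C(K)$ for all $(x,v)$. The critical value $\alpha(H)$ is the unique constant for which $H(x,Du(x))=\alpha(H)$, $x\in\mathbb T^d$, admits a viscosity solution; $\mathcal S^-$ is the set of its viscosity solutions. A curve $\gamma:\mathbb R\to\mathbb T^d$ (absolutely continuous; such curves are then automatically $C^1$) is $(u,L,\alpha(H))$-calibrated if $u(\gamma(b))-u(\gamma(a))=\int_a^bL(\gamma(s),\dot\gamma(s))\,ds+\alpha(H)(b-a)$ for all $a\le b$. Set $\widetilde{\mathcal I}(u)=\{(\gamma(t),\dot\gamma(t)):\gamma\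 (u,L,\alpha(H))\text{-calibrated},\ t\in\mathbb R\}$ and define the Mañé set $\widetilde{\mathcal N}_L=\bigcup_{u\in\mathcal S^-}\widetilde{\mathcal I}(u)\subset\mathbb T^d\times\mathbb R^d$. Mesh sizes are always of the form $h=1/N$ with $N\ge1$ an integer. The grid is $\mathcal G_h=\{x_i=ih \bmod \mathbb Z^d: i\in\{0,\dots,N-1\}^d\}$, and each grid point is identified with its representative in $[0,1)^d$. For $x_i,x_j\in\mathcal G_h$, $\ell\in\mathbb Z^d$ put $v_{ij}^\ell=(x_j+\ell-x_i)/\tau$. $\mathcal H_{h,\tau}$ is the set of fully-discrete holonomic probability measures: families $\mu=(\mu_{ij}^\ell)$ indexed by $x_i,x_j\in\mathcal G_h$, $\ell\in\mathbb Z^d$, with $\mu_{ij}^\ell\ge0$, $\sum_{i,j,\ell}\mu_{ij}^\ell=1$ and $\sum_{j,\ell}\mu_{ij}^\ell=\sum_{j,\ell}\mu_{ji}^\ell$ for every $x_i\in\mathcal G_h$. A fully-discrete Mather measure is a minimizer of $\sum_{i,j,\ell}L(x_i,v_{ij}^\ell)\mu_{ij}^\ell$ over $\mathcal H_{h,\tau}$. The fully-discrete Mather set $\widetilde{\mathcal M}_{h,\tau}\subset\mathbb T^d\times\mathbb R^d$ is the closure of the union, over all fully-discrete Mather measures $\mu$, of $\{(x_i,v_{ij}^\ell):\mu_{ij}^\ell>0\}$. Kuratowski upper limit: $z\in\limsup_kA_k$ iff there are $k_j\to\infty$ and $z_{k_j}\in A_{k_j}$ with $z_{k_j}\to z$.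 *)

theory Defs
  imports "HOL-Analysis.Analysis"
begin

text \<open>
  The torus is handled through its universal covering: functions on the torus are
  \<open>\<int>\<^sup>d\<close>-periodic functions on \<open>real ^ 'd\<close>, curves on the torus are given by lifts to
  \<open>real ^ 'd\<close>, and subsets of the product of the torus with \<open>real ^ 'd\<close> by their full
  (periodic) preimages in \<open>(real ^ 'd) \<times> (real ^ 'd)\<close>.  The covering map is an open local
  homeomorphism, so inclusion, closure and Kuratowski upper limit of full preimages
  are the preimages of the same operations downstairs.
\<close>

definition lattice_vec :: "int ^ 'd \<Rightarrow> real ^ 'd" where
  "lattice_vec k = (\<chi> a. real_of_int (k $ a))"

definition periodic :: "(real ^ 'd \<Rightarrow> 'b) \<Rightarrow> bool" where
  "periodic f \<longleftrightarrow> (\<forall>x k. f (x + lattice_vec k) = f x)"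

definition periodize :: "((real ^ 'd) \<times> (real ^ 'd)) set \<Rightarrow> ((real ^ 'd) \<times> (real ^ 'd)) set" where
  "periodize A = {(x + lattice_vec k, v) | x v k. (x, v) \<in> A}"

definition superlinear :: "(real ^ 'd \<Rightarrow> real ^ 'd \<Rightarrow> real) \<Rightarrow> bool" where
  "superlinear F \<longleftrightarrow> (\<forall>K>0. \<exists>C. \<forall>x p. F x p \<ge> K * norm p - C)"

definition tonelli_hamiltonian :: "(real ^ 'd::finite \<Rightarrow> real ^ 'd \<Rightarrow> real) \<Rightarrow> bool" where
  "tonelli_hamiltonian H \<longleftrightarrow>
     periodic H \<and> superlinear H \<and>
     (\<exists>(DH :: (real ^ 'd) \<times> (real ^ 'd) \<Rightarrow> ((real ^ 'd) \<times> (real ^ 'd)) \<Rightarrow>\<^sub>L real)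
       (D2H :: (real ^ 'd) \<times> (real ^ 'd) \<Rightarrow>
          ((real ^ 'd) \<times> (real ^ 'd)) \<Rightarrow>\<^sub>L (((real ^ 'd) \<times> (real ^ 'd)) \<Rightarrow>\<^sub>L real)).
        (\<forall>z. ((\<lambda>(x, p). H x p) has_derivative blinfun_apply (DH z)) (at z)) \<and>
        (\<forall>z. (DH has_derivative blinfun_apply (D2H z)) (at z)) \<and>
        continuous_on UNIV D2H \<and>
        (\<forall>z w. w \<noteq> 0 \<longrightarrow>
           blinfun_apply (blinfun_apply (D2H z) (0, w)) (0, w) > 0))"

definition lagrangian ::
  "(real ^ 'd::finite \<Rightarrow> real ^ 'd \<Rightarrow> real) \<Rightarrow> real ^ 'd \<Rightarrow> real ^ 'd \<Rightarrow> real" where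
  "lagrangian H x v = (SUP p. p \<bullet> v - H x p)"

text \<open>Test functions: \<open>C\<^sup>1\<close> functions \<open>\<phi>\<close> on the torus, with gradient \<open>g\<close>.\<close>

definition test_function :: "(real ^ 'd::finite \<Rightarrow> real) \<Rightarrow> (real ^ 'd \<Rightarrow> real ^ 'd) \<Rightarrow> bool" where
  "test_function \<phi> g \<longleftrightarrow>
     periodic \<phi> \<and> (\<forall>x. (\<phi> has_derivative (\<lambda>w. g x \<bullet> w)) (at x)) \<and> continuous_on UNIV g"

definition viscosity_subsolution ::
  "(real ^ 'd::finite \<Rightarrow> real ^ 'd \<Rightarrow> real) \<Rightarrow> real \<Rightarrow> (real ^ 'd \<Rightarrow> real) \<Rightarrow> bool" where
  "viscosity_subsolution H c u \<longleftrightarrow>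
     (\<forall>\<phi> g x. test_function \<phi> g \<and> (\<forall>\<^sub>F y in nhds x. u y - \<phi> y \<le> u x - \<phi> x)
        \<longrightarrow> H x (g x) \<le> c)"

definition viscosity_supersolution ::
  "(real ^ 'd::finite \<Rightarrow> real ^ 'd \<Rightarrow> real) \<Rightarrow> real \<Rightarrow> (real ^ 'd \<Rightarrow> real) \<Rightarrow> bool" where
  "viscosity_supersolution H c u \<longleftrightarrow>
     (\<forall>\<phi> g x. test_function \<phi> g \<and> (\<forall>\<^sub>F y in nhds x. u y - \<phi> y \<ge> u x - \<phi> x)
        \<longrightarrow> H x (g x) \<ge> c)"

definition viscosity_solution ::
  "(real ^ 'd::finite \<Rightarrow> real ^ 'd \<Rightarrow> real) \<Rightarrow> real \<Rightarrow> (real ^ 'd \<Rightarrow> real) \<Rightarrow> bool" where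
  "viscosity_solution H c u \<longleftrightarrow>
     periodic u \<and> continuous_on UNIV u \<and>
     viscosity_subsolution H c u \<and> viscosity_supersolution H c u"

definition critical_value :: "(real ^ 'd::finite \<Rightarrow> real ^ 'd \<Rightarrow> real) \<Rightarrow> real" where
  "critical_value H = (THE c. \<exists>u. viscosity_solution H c u)"

definition weak_KAM_solutions ::
  "(real ^ 'd::finite \<Rightarrow> real ^ 'd \<Rightarrow> real) \<Rightarrow> (real ^ 'd \<Rightarrow> real) set" where
  "weak_KAM_solutions H = {u. viscosity_solution H (critical_value H) u}"

definition absolutely_continuous_curve_on ::
  "real \<Rightarrow> real \<Rightarrow> (real \<Rightarrow> 'b::real_normed_vector) \<Rightarrow> bool" where
  "absolutely_continuous_curve_on a b \<gamma> \<longleftrightarrow>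
     (\<forall>\<epsilon>>0. \<exists>\<delta>>0. \<forall>(n::nat) s t.
        (\<forall>i<n. a \<le> s i \<and> s i \<le> t i \<and> t i \<le> b) \<and>
        disjoint_family_on (\<lambda>i. {s i<..<t i}) {..<n} \<and>
        (\<Sum>i<n. t i - s i) < \<delta>
        \<longrightarrow> (\<Sum>i<n. norm (\<gamma> (t i) - \<gamma> (s i))) < \<epsilon>)"

text \<open>
  In the action, \<open>vector_derivative\<close> is the velocity at the almost all times at which it
  exists; its arbitrary values elsewhere do not affect the integral.  The Lagrangian is
  bounded below, so a finite action means absolute integrability.
\<close>

definition calibrated ::
  "(real ^ 'd::finite \<Rightarrow> real) \<Rightarrow> (real ^ 'd \<Rightarrow> real ^ 'd \<Rightarrow> real) \<Rightarrow> real \<Rightarrow>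
   (real \<Rightarrow> real ^ 'd) \<Rightarrow> bool" where
  "calibrated u L c \<gamma> \<longleftrightarrow>
     (\<forall>a b. a \<le> b \<longrightarrow>
        absolutely_continuous_curve_on a b \<gamma> \<and>
        (\<lambda>s. L (\<gamma> s) (vector_derivative \<gamma> (at s))) absolutely_integrable_on {a..b} \<and>
        u (\<gamma> b) - u (\<gamma> a) =
          integral {a..b} (\<lambda>s. L (\<gamma> s) (vector_derivative \<gamma> (at s))) + c * (b - a))"

text \<open>
  Calibrated curves turn out to be \<open>C\<^sup>1\<close>, so requiring the velocity to exist at the given
  time excludes none.  Integer translates of lifts of calibrated curves are again such
  lifts, so the set is already periodic.
\<close>

definition calibrated_set ::
  "(real ^ 'd::finite \<Rightarrow> real ^ 'd \<Rightarrow> real) \<Rightarrow> (real ^ 'd \<Rightarrow> real) \<Rightarrow>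
   ((real ^ 'd) \<times> (real ^ 'd)) set" where
  "calibrated_set H u =
     {(\<gamma> t, v) | \<gamma> t v. calibrated u (lagrangian H) (critical_value H) \<gamma> \<and>
                        (\<gamma> has_vector_derivative v) (at t)}"

definition mane_set ::
  "(real ^ 'd::finite \<Rightarrow> real ^ 'd \<Rightarrow> real) \<Rightarrow> ((real ^ 'd) \<times> (real ^ 'd)) set" where
  "mane_set H = (\<Union>u\<in>weak_KAM_solutions H. calibrated_set H u)"

definition mesh_size :: "real \<Rightarrow> bool" where
  "mesh_size h \<longleftrightarrow> (\<exists>N::nat. N \<ge> 1 \<and> h = 1 / real N)"

text \<open>For \<open>h = 1 / N\<close> the bound on the indices says \<open>i a \<in> {0, \<dots>, N - 1}\<close>.\<close>

definition grid :: "real \<Rightarrow> (real ^ 'd::finite) set" where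
  "grid h = {(\<chi> a. real (i a) * h) | i :: 'd \<Rightarrow> nat. \<forall>a. real (i a) < 1 / h}"

definition grid_velocity ::
  "real \<Rightarrow> real ^ 'd::finite \<Rightarrow> real ^ 'd \<Rightarrow> int ^ 'd \<Rightarrow> real ^ 'd" where
  "grid_velocity \<tau> x y l = (y + lattice_vec l - x) /\<^sub>R \<tau>"

text \<open>
  The families are indexed by the grid points themselves; the values of \<open>\<mu>\<close> at points off
  the grid are irrelevant and unconstrained.
\<close>

definition discrete_holonomic ::
  "real \<Rightarrow> (real ^ 'd::finite \<Rightarrow> real ^ 'd \<Rightarrow> int ^ 'd \<Rightarrow> real) set" where
  "discrete_holonomic h =
     {\<mu>. (\<forall>x\<in>grid h. \<forall>y\<in>grid h. \<forall>l. \<mu> x y l \<ge> 0) \<and>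
         ((\<lambda>(x, y, l). \<mu> x y l) has_sum 1) (grid h \<times> grid h \<times> UNIV) \<and>
         (\<forall>x\<in>grid h. (\<Sum>\<^sub>\<infinity>(y, l)\<in>grid h \<times> UNIV. \<mu> x y l) =
                     (\<Sum>\<^sub>\<infinity>(y, l)\<in>grid h \<times> UNIV. \<mu> y x l))}"

definition finite_discrete_action ::
  "(real ^ 'd::finite \<Rightarrow> real ^ 'd \<Rightarrow> real) \<Rightarrow> real \<Rightarrow> real \<Rightarrow>
   (real ^ 'd \<Rightarrow> real ^ 'd \<Rightarrow> int ^ 'd \<Rightarrow> real) \<Rightarrow> bool" where
  "finite_discrete_action L h \<tau> \<mu> \<longleftrightarrow>
     (\<lambda>(x, y, l). L x (grid_velocity \<tau> x y l) * \<mu> x y l) summable_on (grid h \<times> grid h \<times> UNIV)"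

definition discrete_action ::
  "(real ^ 'd::finite \<Rightarrow> real ^ 'd \<Rightarrow> real) \<Rightarrow> real \<Rightarrow> real \<Rightarrow>
   (real ^ 'd \<Rightarrow> real ^ 'd \<Rightarrow> int ^ 'd \<Rightarrow> real) \<Rightarrow> real" where
  "discrete_action L h \<tau> \<mu> =
     (\<Sum>\<^sub>\<infinity>(x, y, l)\<in>grid h \<times> grid h \<times> UNIV. L x (grid_velocity \<tau> x y l) * \<mu> x y l)"

text \<open>
  As \<open>L\<close> is bounded below, the action of every \<open>\<nu>\<close> is well defined in \<open>(-\<infinity>, \<infinity>]\<close>, and it is
  \<open>\<infinity>\<close> exactly when the series is not summable.  Such \<open>\<nu>\<close> are no competitors and, since
  measures of finite action exist, no minimizers; they have to be excluded explicitly
  because \<open>discrete_action\<close> takes the default value 0 on them.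
\<close>

definition discrete_mather_measure ::
  "(real ^ 'd::finite \<Rightarrow> real ^ 'd \<Rightarrow> real) \<Rightarrow> real \<Rightarrow> real \<Rightarrow>
   (real ^ 'd \<Rightarrow> real ^ 'd \<Rightarrow> int ^ 'd \<Rightarrow> real) \<Rightarrow> bool" where
  "discrete_mather_measure L h \<tau> \<mu> \<longleftrightarrow>
     \<mu> \<in> discrete_holonomic h \<and> finite_discrete_action L h \<tau> \<mu> \<and>
     (\<forall>\<nu>\<in>discrete_holonomic h. finite_discrete_action L h \<tau> \<nu> \<longrightarrow>
        discrete_action L h \<tau> \<mu> \<le> discrete_action L h \<tau> \<nu>)"

definition discrete_mather_set ::
  "(real ^ 'd::finite \<Rightarrow> real ^ 'd \<Rightarrow> real) \<Rightarrow> real \<Rightarrow> real \<Rightarrow>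
   ((real ^ 'd) \<times> (real ^ 'd)) set" where
  "discrete_mather_set L h \<tau> =
     closure (periodize (\<Union>\<mu>\<in>{\<mu>. discrete_mather_measure L h \<tau> \<mu>}.
       {(x, grid_velocity \<tau> x y l) | x y l. x \<in> grid h \<and> y \<in> grid h \<and> \<mu> x y l > 0}))"

definition kuratowski_limsup :: "(nat \<Rightarrow> 'b::topological_space set) \<Rightarrow> 'b set" where
  "kuratowski_limsup A =
     {z. \<exists>(k :: nat \<Rightarrow> nat) \<zeta>. filterlim k at_top sequentially \<and>
           (\<forall>j. \<zeta> j \<in> A (k j)) \<and> \<zeta> \<longlonglongrightarrow> z}"

end

theory Submission
  imports Defs "HOL-Complex_Analysis.Great_Picard"
begin

text \<open>
  The support of a fully-discrete Mather measure consists of edges along which any discrete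
  weak KAM solution is calibrated, because the measure is closed and its action is minimal;
  holonomy extends each such edge to a bi-infinite calibrated chain of grid points.
  Minimality of the chain among grid perturbations gives a discrete Euler--Lagrange inequality,
  and with \<open>h = O(\<tau>\<^sup>2)\<close> it bounds the discrete accelerations.  Hence positions, velocities and
  discrete weak KAM solutions converge together along a subsequence; the limit function is a
  viscosity solution by the monotone scheme argument, its energy is the critical value by
  comparison, and the limit curve is calibrated by it.
\<close>

section \<open>Legendre duality for Tonelli Hamiltonians\<close>

text \<open>On the universal cover the grid becomes h Z^d, and an edge with its integer shift
  becomes an ordinary step. All regularity comes from H: the proof works with pairs (v, p) that
  attain the Legendre supremum and turns convexity of H in p into a one-sided second order upper
  bound on L. One side is enough, because minimality is tested only through upper bounds on the
  action of competitors. The obstacle is that competitors must stay on the mesh, so they cannot be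
  moved infinitesimally; the stationarity condition is therefore only approximate, and its error
  must be small enough for velocities, not just positions, to converge. A second obstacle is that
  sampled paths are step functions. Compactness is therefore proved for maps that are Lipschitz up
  to a vanishing error, and derivatives of the limits are obtained by summing increments, both for
  the curve and for the solution along it.\<close>

lemma lattice_vec_add: "lattice_vec (k + l) = lattice_vec k + lattice_vec l"
  by (simp add: lattice_vec_def vec_eq_iff)

lemma lattice_vec_uminus: "lattice_vec (- k) = - lattice_vec k"
  by (simp add: lattice_vec_def vec_eq_iff)

lemma lattice_vec_diff: "lattice_vec (k - l) = lattice_vec k - lattice_vec l"
  by (simp add: lattice_vec_def vec_eq_iff)

lemma norm_le_card_mult:
  fixes x :: "real ^ 'd::finite" and e :: real
  assumes "\<And>a. \<bar>x $ a\<bar> \<le> e"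
  shows "norm x \<le> CARD('d) * e"
  using norm_le_l1_cart[of x] sum_bounded_above[of UNIV "\<lambda>a. \<bar>x $ a\<bar>" e] assms by force

text \<open>Stands in for compactness of the torus: a bound proved for base points in this fixed
  ball holds everywhere by periodicity.\<close>

lemma translate_to_ball:
  fixes x :: "real ^ 'd::finite"
  obtains k where "norm (x + lattice_vec k) \<le> CARD('d)"
proof
  have "norm (x + lattice_vec (\<chi> a. - \<lfloor>x $ a\<rfloor>)) \<le> real CARD('d) * 1"
    by (rule norm_le_card_mult) (auto simp: lattice_vec_def abs_if; linarith)
  then show "norm (x + lattice_vec (\<chi> a. - \<lfloor>x $ a\<rfloor>)) \<le> CARD('d)" by simp
qed

lemma periodicD: "periodic f \<Longrightarrow> f (x + lattice_vec k) = f x"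
  by (simp add: periodic_def)

lemma vertical_line_has_derivative:
  "((\<lambda>t. (x, p + t *\<^sub>R w)) has_derivative (\<lambda>s. (0, s *\<^sub>R w))) (at t)"
  by (rule has_derivative_Pair[OF has_derivative_const],
      rule has_derivative_add_const[where c = p and f = "\<lambda>t. t *\<^sub>R w", simplified add.commute])
    (rule has_derivative_scaleR_left[OF has_derivative_ident])

text \<open>The existential witnesses of \<open>tonelli_hamiltonian\<close> become parameters, so
  that the estimates can name the first and second derivatives of H.\<close>

locale tonelli =
  fixes H :: "real ^ 'd::finite \<Rightarrow> real ^ 'd \<Rightarrow> real"
    and DH :: "(real ^ 'd) \<times> (real ^ 'd) \<Rightarrow> ((real ^ 'd) \<times> (real ^ 'd)) \<Rightarrow>\<^sub>L real"
    and D2H :: "(real ^ 'd) \<times> (real ^ 'd) \<Rightarrow>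
      ((real ^ 'd) \<times> (real ^ 'd)) \<Rightarrow>\<^sub>L (((real ^ 'd) \<times> (real ^ 'd)) \<Rightarrow>\<^sub>L real)"
  assumes per: "periodic H" and superl: "superlinear H"
    and DH: "\<And>z. ((\<lambda>(x, p). H x p) has_derivative blinfun_apply (DH z)) (at z)"
    and D2H: "\<And>z. (DH has_derivative blinfun_apply (D2H z)) (at z)"
    and cont_D2H: "continuous_on UNIV D2H"
    and pos: "\<And>z w. w \<noteq> 0 \<Longrightarrow> blinfun_apply (blinfun_apply (D2H z) (0, w)) (0, w) > 0"
begin

abbreviation L where "L \<equiv> lagrangian H"

lemma H_shift: "H (x + lattice_vec k) = H x"
  using per by (simp add: periodic_def)

lemma cont_H: "continuous_on UNIV (\<lambda>(x, p). H x p)"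
  by (rule has_derivative_continuous_on[OF has_derivative_at_withinI[OF DH]])

lemma tendsto_H:
  "(f \<longlongrightarrow> x) F \<Longrightarrow> (g \<longlongrightarrow> p) F \<Longrightarrow> ((\<lambda>n. H (f n) (g n)) \<longlongrightarrow> H x p) F"
  using continuous_on_tendsto_compose[OF cont_H tendsto_Pair[of f x F g p]] by simp

lemma cont_DH: "continuous_on UNIV DH"
  by (rule has_derivative_continuous_on[OF has_derivative_at_withinI[OF D2H]])

lemma H_bounded:
  obtains B where "B \<ge> 0" "\<And>x p. norm p \<le> P \<Longrightarrow> \<bar>H x p\<bar> \<le> B"
proof -
  let ?K = "cball (0::real^'d) CARD('d) \<times> cball (0::real^'d) P"
  have "compact ((\<lambda>(x, p). H x p) ` ?K)"
    by (intro compact_continuous_image continuous_on_subset[OF cont_H] compact_Times compact_cball) auto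
  then obtain B where B: "\<And>y. y \<in> (\<lambda>(x, p). H x p) ` ?K \<Longrightarrow> norm y \<le> B"
    using compact_imp_bounded bounded_iff by metis
  have "\<bar>H x p\<bar> \<le> max B 0" if "norm p \<le> P" for x p
  proof -
    obtain k where "norm (x + lattice_vec k) \<le> CARD('d)" by (rule translate_to_ball)
    then have "(\<lambda>(x, p). H x p) (x + lattice_vec k, p) \<in> (\<lambda>(x, p). H x p) ` ?K"
      using that by (intro imageI) auto
    from B[OF this] show ?thesis by (auto simp: H_shift)
  qed
  then show ?thesis using that[of "max B 0"] by auto
qed

text \<open>The Legendre relation: in the Tonelli setting it amounts to v = D_p H(x, p), or to p =
  D_v L(x, v). It is kept as a relation so that L is never differentiated.\<close>

definition opt where "opt x v p \<longleftrightarrow> (\<forall>q. q \<bullet> v - H x q \<le> p \<bullet> v - H x p)"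

lemma opt_shift [simp]: "opt (x + lattice_vec k) v p \<longleftrightarrow> opt x v p"
  by (simp add: opt_def H_shift)

lemma opt_L: "opt x v p \<Longrightarrow> L x v = p \<bullet> v - H x p"
  unfolding lagrangian_def opt_def by (intro cSup_eq_maximum) auto

lemma L_shift [simp]: "L (x + lattice_vec k) = L x"
  by (simp add: lagrangian_def H_shift fun_eq_iff)

text \<open>Superlinearity with slope |R| + 1 leaves one unit of |p| after the linear term p . v is
  paid for. The hypothesis asks only that p does as well as the zero momentum, so the bound is
  available before a maximizer is known to exist.\<close>

lemma opt_bounded:
  obtains P where "P > 0" "\<And>x v p. norm v \<le> R \<Longrightarrow> p \<bullet> v - H x p \<ge> - H x 0 \<Longrightarrow> norm p \<le> P"
proof -
  define K where "K = \<bar>R\<bar> + 1"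
  obtain C where C: "\<And>x p. H x p \<ge> K * norm p - C"
    using superl abs_ge_zero[of R] unfolding superlinear_def K_def by (metis add.commute add_nonneg_pos zero_less_one abs_add_one_gt_zero)
  obtain B where B: "B \<ge> 0" "\<And>x p. norm p \<le> 0 \<Longrightarrow> \<bar>H x p\<bar> \<le> B" using H_bounded by metis
  have "norm p \<le> \<bar>C\<bar> + B + 1" if "norm v \<le> R" "p \<bullet> v - H x p \<ge> - H x 0" for x v p
  proof -
    have "p \<bullet> v \<le> norm p * R"
      using norm_cauchy_schwarz[of p v] mult_left_mono[OF that(1), of "norm p"] by simp
    also have "\<dots> \<le> norm p * \<bar>R\<bar>" by (simp add: mult_left_mono)
    finally have "norm p * (\<bar>R\<bar> + 1) - C \<le> norm p * \<bar>R\<bar> + H x 0"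
      using that(2) C[of p x] by (simp add: K_def mult.commute)
    then show ?thesis using B(2)[of 0 x] by (simp add: algebra_simps)
  qed
  then show ?thesis using that[of "\<bar>C\<bar> + B + 1"] B(1) by auto
qed

lemma opt_exists: obtains p where "opt x v p"
proof -
  obtain P where P: "P > 0" "\<And>p. p \<bullet> v - H x p \<ge> - H x 0 \<Longrightarrow> norm p \<le> P"
    using opt_bounded[of "norm v"] by (metis order_refl)
  have "continuous_on (cball 0 P) (\<lambda>p. H x p)"
    using tendsto_H[OF tendsto_const tendsto_ident_at] by (simp add: continuous_on_def)
  then have "\<exists>p\<in>cball 0 P. \<forall>q\<in>cball 0 P. q \<bullet> v - H x q \<le> p \<bullet> v - H x p"
    using P(1) by (intro continuous_attains_sup) (auto intro!: continuous_intros)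
  then obtain p where p: "p \<in> cball 0 P" "\<And>q. q \<in> cball 0 P \<Longrightarrow> q \<bullet> v - H x q \<le> p \<bullet> v - H x p"
    by blast
  \<comment> \<open>Outside the ball of radius P every q does worse than 0, which lies in the ball;
    hence the maximum over the ball is global.\<close>
  have "q \<bullet> v - H x q \<le> p \<bullet> v - H x p" for q
  proof (cases "q \<bullet> v - H x q \<ge> - H x 0")
    case True
    then show ?thesis using p(2)[of q] P(2)[of q] by auto
  next
    case False
    then show ?thesis using p(2)[of 0] P(1) by auto
  qed
  then show ?thesis using that unfolding opt_def by blast
qed

text \<open>\<open>L\<close> is a real-valued SUP, so the inequality is read off from an attained
  maximum.\<close>

lemma fenchel: "p \<bullet> v \<le> H x p + L x v"
proof -
  obtain q where "opt x v q" by (rule opt_exists)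
  then show ?thesis using opt_L[of x v q] unfolding opt_def by (metis add.commute diff_le_eq)
qed

lemma opt_norm_bound:
  obtains P where "P > 0" "\<And>x v p. norm v \<le> R \<Longrightarrow> opt x v p \<Longrightarrow> norm p \<le> P"
proof -
  obtain P where P: "P > 0" "\<And>x v p. norm v \<le> R \<Longrightarrow> p \<bullet> v - H x p \<ge> - H x 0 \<Longrightarrow> norm p \<le> P"
    using opt_bounded[of R] by metis
  show ?thesis
  proof (rule that[OF P(1)])
    fix x v p assume "norm v \<le> R" "opt x v p"
    moreover have "p \<bullet> v - H x p \<ge> - H x 0"
      using \<open>opt x v p\<close>[unfolded opt_def, rule_format, of 0] by simp
    ultimately show "norm p \<le> P" using P(2) by blast
  qed
qed

section \<open>Second order expansion of the Hamiltonian in the momentum\<close>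

lemma DH_line:
  "((\<lambda>t. H x (p + t *\<^sub>R w)) has_real_derivative blinfun_apply (DH (x, p + t *\<^sub>R w)) (0, w)) (at t)"
proof -
  have 1: "((\<lambda>t. (x, p + t *\<^sub>R w)) has_derivative (\<lambda>s. (0, s *\<^sub>R w))) (at t)"
    by (rule vertical_line_has_derivative)
  have "((\<lambda>z. case z of (x, p) \<Rightarrow> H x p) \<circ> (\<lambda>t. (x, p + t *\<^sub>R w)) has_derivative
      blinfun_apply (DH (x, p + t *\<^sub>R w)) \<circ> (\<lambda>s. (0, s *\<^sub>R w))) (at t)"
    by (rule diff_chain_at[OF 1 DH])
  moreover have "blinfun_apply (DH z) (0, s *\<^sub>R w) = blinfun_apply (DH z) (0, w) * s" for z s
  proof -
    have "(0, s *\<^sub>R w) = s *\<^sub>R (0 :: real^'d, w)" by simp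
    then show ?thesis by (simp only: blinfun.scaleR_right real_scaleR_def mult.commute)
  qed
  ultimately show ?thesis by (simp add: has_field_derivative_def o_def)
qed

lemma D2H_line:
  "((\<lambda>t. blinfun_apply (DH (x, p + t *\<^sub>R w)) (0, w)) has_real_derivative
    blinfun_apply (blinfun_apply (D2H (x, p + t *\<^sub>R w)) (0, w)) (0, w)) (at t)"
proof -
  have 1: "((\<lambda>t. (x, p + t *\<^sub>R w)) has_derivative (\<lambda>s. (0, s *\<^sub>R w))) (at t)"
    by (rule vertical_line_has_derivative)
  have "(DH \<circ> (\<lambda>t. (x, p + t *\<^sub>R w)) has_derivative
      blinfun_apply (D2H (x, p + t *\<^sub>R w)) \<circ> (\<lambda>s. (0, s *\<^sub>R w))) (at t)"
    by (rule diff_chain_at[OF 1 D2H])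
  then have "((\<lambda>t. blinfun_apply (DH (x, p + t *\<^sub>R w)) (0, w)) has_derivative
      (\<lambda>s. blinfun_apply (blinfun_apply (D2H (x, p + t *\<^sub>R w)) (0, s *\<^sub>R w)) (0, w))) (at t)"
    unfolding o_def by (rule bounded_linear.has_derivative[OF blinfun.bounded_linear_left])
  moreover have "blinfun_apply (D2H z) (0, s *\<^sub>R w) = s *\<^sub>R blinfun_apply (D2H z) (0, w)" for z s
  proof -
    have "(0, s *\<^sub>R w) = s *\<^sub>R (0 :: real^'d, w)" by simp
    then show ?thesis by (simp only: blinfun.scaleR_right)
  qed
  ultimately show ?thesis
    by (simp add: has_field_derivative_def blinfun.scaleR_left mult.commute[of _ "blinfun_apply _ _"])
qed

lemma taylor_H:
  "\<exists>t. 0 < t \<and> t \<le> 1 \<and>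
    H x (p + w) = H x p + blinfun_apply (DH (x, p)) (0, w) +
      blinfun_apply (blinfun_apply (D2H (x, p + t *\<^sub>R w)) (0, w)) (0, w) / 2"
proof -
  \<comment> \<open>The derivatives along the segment from p to p + w, tabulated in the form that
    \<open>Maclaurin2\<close> expects.\<close>
  define df where "df m = (if m = 0 then (\<lambda>t. H x (p + t *\<^sub>R w))
    else if m = 1 then (\<lambda>t. blinfun_apply (DH (x, p + t *\<^sub>R w)) (0, w))
    else (\<lambda>t. blinfun_apply (blinfun_apply (D2H (x, p + t *\<^sub>R w)) (0, w)) (0, w)))" for m :: nat
  have "\<exists>t. 0 < t \<and> t \<le> 1 \<and> H x (p + 1 *\<^sub>R w) =
     (\<Sum>m<2. df m 0 / fact m * 1 ^ m) + df 2 t / fact 2 * 1 ^ 2"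
  proof (rule Maclaurin2[where diff = df and f = "\<lambda>t. H x (p + t *\<^sub>R w)"])
    show "\<forall>m t. m < 2 \<and> 0 \<le> t \<and> t \<le> 1 \<longrightarrow> DERIV (df m) t :> df (Suc m) t"
      using DH_line D2H_line by (auto simp: df_def less_2_cases_iff)
  qed (auto simp: df_def)
  then show ?thesis by (simp add: df_def numeral_2_eq_2)
qed

text \<open>First order condition at a maximum: the derivative of t -> (p + t w) . v - H(x, p + t w)
  vanishes at t = 0.\<close>

lemma opt_DH:
  assumes "opt x v p" shows "blinfun_apply (DH (x, p)) (0, w) = w \<bullet> v"
proof -
  have 1: "((\<lambda>t. (p + t *\<^sub>R w) \<bullet> v) has_real_derivative w \<bullet> v) (at 0)"
    unfolding inner_add_left inner_scaleR_left by (rule derivative_eq_intros refl | simp)+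
  define f where "f t = (p + t *\<^sub>R w) \<bullet> v - H x (p + t *\<^sub>R w)" for t
  have "(f has_real_derivative w \<bullet> v - blinfun_apply (DH (x, p)) (0, w)) (at 0)"
    using DERIV_diff[OF 1 DH_line[of x p w 0]] by (simp add: f_def [abs_def])
  moreover have "\<forall>t. \<bar>0 - t\<bar> < 1 \<longrightarrow> f t \<le> f 0"
    using assms[unfolded opt_def, rule_format] by (simp add: f_def)
  ultimately have "w \<bullet> v - blinfun_apply (DH (x, p)) (0, w) = 0"
    using DERIV_local_max[of f "w \<bullet> v - blinfun_apply (DH (x, p)) (0, w)" 0 1] by auto
  then show ?thesis by simp
qed

text \<open>Convexity makes a critical momentum a global maximizer, since the Taylor remainder is a
  nonnegative quadratic form.\<close>

lemma opt_of_DH: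
  assumes "\<And>w. blinfun_apply (DH (x, p)) (0, w) = w \<bullet> v" shows "opt x v p"
  unfolding opt_def
proof
  fix q
  obtain t where t: "H x (p + (q - p)) = H x p + blinfun_apply (DH (x, p)) (0, (q - p)) +
      blinfun_apply (blinfun_apply (D2H (x, p + t *\<^sub>R (q - p))) (0, (q - p))) (0, (q - p)) / 2"
    using taylor_H[of x p "q - p"] by blast
  have "blinfun_apply (blinfun_apply (D2H (x, p + t *\<^sub>R (q - p))) (0, (q - p))) (0, (q - p)) \<ge> 0"
  proof (cases "q - p = 0")
    case True
    then show ?thesis by (metis blinfun.zero_right order_refl zero_prod_def)
  qed (use pos less_imp_le in blast)
  then show "q \<bullet> v - H x q \<le> p \<bullet> v - H x p"
    using t assms[of "q - p"] by (simp add: inner_diff_left)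
qed

text \<open>The Legendre map in the opposite direction, v = D_p H(x, p). The subsolution test uses
  it to pick the velocity that recovers H from a given gradient.\<close>

lemma opt_exists_velocity: obtains v where "opt x v p"
proof -
  define v where "v = (\<Sum>b\<in>Basis. blinfun_apply (DH (x, p)) (0, b) *\<^sub>R b)"
  have "blinfun_apply (DH (x, p)) (0, w) = w \<bullet> v" for w
  proof -
    have "linear (\<lambda>w. blinfun_apply (DH (x, p)) (0, w))"
      by (rule linearI)
        (metis add.right_neutral add_Pair blinfun.add_right, metis blinfun.scaleR_right scaleR_Pair scaleR_zero_right)
    from Linear_Algebra.linear_componentwise[OF this, of w 1]
    show ?thesis by (simp add: v_def inner_sum_right mult.commute)
  qed
  then show ?thesis using opt_of_DH that by blast
qed

text \<open>The Hessian in p is positive on a compact set of base points, momenta and unit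
  directions, so it has a positive minimum there. Homogeneity of degree two covers all directions,
  and the segment from p to q stays in the momentum ball. The constant m is half of the minimum, as
  in Taylor's formula.\<close>

lemma strong_convexity:
  obtains m where "m > 0" "\<And>x v p q. opt x v p \<Longrightarrow> norm p \<le> P \<Longrightarrow> norm q \<le> P \<Longrightarrow>
     H x q \<ge> H x p + (q - p) \<bullet> v + m * (norm (q - p))\<^sup>2"
proof -
  let ?Q = "\<lambda>((x, p), w). blinfun_apply (blinfun_apply (D2H (x, p)) (0, w)) (0, w)"
  let ?K = "(cball (0::real^'d) CARD('d) \<times> cball (0::real^'d) \<bar>P\<bar>) \<times> sphere (0::real^'d) 1"
  have "continuous_on ?K (\<lambda>z. D2H (fst z))"
    by (rule continuous_on_compose2[OF cont_D2H continuous_on_fst[OF continuous_on_id]]) simp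
  then have "continuous_on ?K (\<lambda>z. blinfun_apply (blinfun_apply (D2H (fst z)) (0, snd z)) (0, snd z))"
    by (intro bounded_bilinear.continuous_on[OF bounded_bilinear_blinfun_apply]
        continuous_on_Pair continuous_on_const continuous_on_snd continuous_on_id)
  then have "continuous_on ?K ?Q" by (simp add: split_beta)
  moreover have "compact ?K" by (intro compact_Times compact_cball compact_sphere)
  moreover have "?K \<noteq> {}"
  proof -
    have "((0, 0), axis undefined 1) \<in> ?K" by (simp add: norm_axis_1)
    then show ?thesis by blast
  qed
  ultimately obtain z where z: "z \<in> ?K" "\<And>y. y \<in> ?K \<Longrightarrow> ?Q z \<le> ?Q y"
    using continuous_attains_inf[of ?K ?Q] by blast
  define m where "m = ?Q z / 2"
  have "snd z \<noteq> 0" using z(1) by auto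
  then have "m > 0" using pos[of "snd z" "fst z"] by (simp add: m_def split_beta)
  have main: "H x q \<ge> H x p + (q - p) \<bullet> v + m * (norm (q - p))\<^sup>2"
    if o: "opt x v p" and pq: "norm p \<le> P" "norm q \<le> P" and x: "norm x \<le> CARD('d)" for x v p q
  proof (cases "q = p")
    case False
    define w where "w = q - p"
    obtain t where t: "0 < t" "t \<le> 1" "H x (p + w) = H x p + blinfun_apply (DH (x, p)) (0, w) +
        blinfun_apply (blinfun_apply (D2H (x, p + t *\<^sub>R w)) (0, w)) (0, w) / 2"
      using taylor_H[of x p w] by blast
    define e where "e = w /\<^sub>R norm w"
    have e: "norm e = 1" "w = norm w *\<^sub>R e" using False by (auto simp: e_def w_def)
    have "p + t *\<^sub>R w \<in> cball 0 \<bar>P\<bar>"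
    proof -
      have "p + t *\<^sub>R w = (1 - t) *\<^sub>R p + t *\<^sub>R q" by (simp add: w_def algebra_simps)
      then show ?thesis
        using convexD[OF convex_cball[of 0 "\<bar>P\<bar>"], of p q "1 - t" t] pq t by auto
    qed
    then have "?Q z \<le> ?Q ((x, p + t *\<^sub>R w), e)"
      using x e by (intro z(2)) auto
    moreover have "blinfun_apply (blinfun_apply (D2H (x, p + t *\<^sub>R w)) (0, w)) (0, w)
        = (norm w)\<^sup>2 * ?Q ((x, p + t *\<^sub>R w), e)"
    proof -
      have "(0, w) = norm w *\<^sub>R (0 :: real^'d, e)" using e by simp
      then show ?thesis
        by (simp only: blinfun.scaleR_right blinfun.scaleR_left prod.case) (simp add: power2_eq_square)
    qed
    ultimately have "m * (norm w)\<^sup>2 \<le> blinfun_apply (blinfun_apply (D2H (x, p + t *\<^sub>R w)) (0, w)) (0, w) / 2"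
      by (simp add: m_def mult_left_mono mult.commute)
    then show ?thesis using t opt_DH[OF o, of w] by (simp add: w_def)
  qed auto
  have "H x q \<ge> H x p + (q - p) \<bullet> v + m * (norm (q - p))\<^sup>2"
    if o: "opt x v p" and pq: "norm p \<le> P" "norm q \<le> P" for x v p q
  proof -
    obtain k where "norm (x + lattice_vec k) \<le> CARD('d)" by (rule translate_to_ball)
    from main[OF _ pq this, of v] o show ?thesis by (simp add: H_shift)
  qed
  then show ?thesis using that \<open>m > 0\<close> by blast
qed

section \<open>Uniform bounds for the Hamiltonian and regularity of the Lagrangian\<close>

lemma DH_bounded:
  obtains B where "B > 0" "\<And>x p. norm x \<le> r \<Longrightarrow> norm p \<le> P \<Longrightarrow> norm (DH (x, p)) \<le> B"
proof -
  have "compact (DH ` (cball 0 r \<times> cball 0 P))"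
    by (intro compact_continuous_image continuous_on_subset[OF cont_DH] compact_Times compact_cball) auto
  then obtain B where "B > 0" "\<And>y. y \<in> DH ` (cball 0 r \<times> cball 0 P) \<Longrightarrow> norm y \<le> B"
    using compact_imp_bounded bounded_pos by metis
  then show ?thesis using that by fastforce
qed

lemma D2H_bounded:
  obtains B where "B > 0" "\<And>x p. norm x \<le> r \<Longrightarrow> norm p \<le> P \<Longrightarrow> norm (D2H (x, p)) \<le> B"
proof -
  have "compact (D2H ` (cball 0 r \<times> cball 0 P))"
    by (intro compact_continuous_image continuous_on_subset[OF cont_D2H] compact_Times compact_cball) auto
  then obtain B where "B > 0" "\<And>y. y \<in> D2H ` (cball 0 r \<times> cball 0 P) \<Longrightarrow> norm y \<le> B"
    using compact_imp_bounded bounded_pos by metis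
  then show ?thesis using that by fastforce
qed

lemma H_lipschitz_x:
  obtains B where "B > 0"
    "\<And>x e p. norm e \<le> 1 \<Longrightarrow> norm p \<le> P \<Longrightarrow> \<bar>H (x + e) p - H x p\<bar> \<le> B * norm e"
proof -
  obtain B where B: "B > 0" "\<And>x p. norm x \<le> CARD('d) + 1 \<Longrightarrow> norm p \<le> P \<Longrightarrow> norm (DH (x, p)) \<le> B"
    using DH_bounded by blast
  have main: "\<bar>H (x + e) p - H x p\<bar> \<le> B * norm e"
    if "norm x \<le> CARD('d)" "norm e \<le> 1" "norm p \<le> P" for x e p
  proof -
    let ?S = "cball (0::real^'d) (CARD('d) + 1) \<times> {p}"
    have "norm ((\<lambda>(x, p). H x p) (x + e, p) - (\<lambda>(x, p). H x p) (x, p)) \<le> B * norm ((x + e, p) - (x, p))"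
    proof (rule differentiable_bound[where S = ?S])
      show "convex ?S" by (intro convex_Times) auto
      show "((\<lambda>(x, p). H x p) has_derivative blinfun_apply (DH z)) (at z within ?S)" for z
        by (rule has_derivative_at_withinI[OF DH])
      show "onorm (blinfun_apply (DH z)) \<le> B" if "z \<in> ?S" for z
        using that B(2)[of "fst z" "snd z"] \<open>norm p \<le> P\<close> by (auto simp: norm_blinfun.rep_eq)
    qed (use that norm_triangle_ineq[of x e] in auto)
    then show ?thesis by (simp add: norm_Pair)
  qed
  show ?thesis
  proof (rule that[OF B(1)])
    fix x e p :: "real^'d" assume *: "norm e \<le> 1" "norm p \<le> P"
    obtain k where "norm (x + lattice_vec k) \<le> CARD('d)" by (rule translate_to_ball)
    from main[OF this *] show "\<bar>H (x + e) p - H x p\<bar> \<le> B * norm e"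
      using H_shift[of "x + e" k] by (simp add: H_shift add.assoc add.commute[of e])
  qed
qed

text \<open>The velocity is D_p H(x, p), which is C^1 and hence Lipschitz on compact sets; this
  later turns a bound on momentum jumps into one on velocity jumps. The translation is chosen for x
  and applied to both base points, which is why their distance is limited to 1.\<close>

lemma velocity_lipschitz:
  obtains B where "B > 0"
    "\<And>x v p x' v' p'. opt x v p \<Longrightarrow> opt x' v' p' \<Longrightarrow> norm v \<le> R \<Longrightarrow> norm v' \<le> R \<Longrightarrow>
       norm (x' - x) \<le> 1 \<Longrightarrow> norm (v' - v) \<le> B * (norm (x' - x) + norm (p' - p))"
proof -
  obtain P where P: "P > 0" "\<And>x v p. norm v \<le> R \<Longrightarrow> opt x v p \<Longrightarrow> norm p \<le> P"
    using opt_norm_bound by blast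
  obtain B where B: "B > 0" "\<And>x p. norm x \<le> CARD('d) + 1 \<Longrightarrow> norm p \<le> P \<Longrightarrow> norm (D2H (x, p)) \<le> B"
    using D2H_bounded by blast
  have main: "norm (v' - v) \<le> B * (norm (x' - x) + norm (p' - p))"
    if o: "opt x v p" "opt x' v' p'" "norm v \<le> R" "norm v' \<le> R" "norm (x' - x) \<le> 1"
      and x: "norm x \<le> CARD('d)" for x v p x' v' p'
  proof -
    let ?S = "cball (0::real^'d) (CARD('d) + 1) \<times> cball (0::real^'d) P"
    have D: "norm (DH (x', p') - DH (x, p)) \<le> B * norm ((x', p') - (x, p))"
    proof (rule differentiable_bound[where S = ?S])
      show "convex ?S" by (intro convex_Times) auto
      show "(DH has_derivative blinfun_apply (D2H z)) (at z within ?S)" for z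
        by (rule has_derivative_at_withinI[OF D2H])
      show "onorm (blinfun_apply (D2H z)) \<le> B" if "z \<in> ?S" for z
        using that B(2)[of "fst z" "snd z"] by (auto simp: norm_blinfun.rep_eq)
    qed (use P(2) o x norm_triangle_sub[of x' x] in auto)
    let ?w = "v' - v"
    \<comment> \<open>Testing the difference of the two derivatives of H on v' - v itself produces
      the square of its norm.\<close>
    have "norm ?w * norm ?w = ?w \<bullet> v' - ?w \<bullet> v"
      by (metis inner_diff_right power2_eq_square power2_norm_eq_inner)
    also have "\<dots> = blinfun_apply (DH (x', p') - DH (x, p)) (0, ?w)"
      using opt_DH[OF o(1)] opt_DH[OF o(2)] by (simp add: blinfun.diff_left)
    also have "\<dots> \<le> norm (DH (x', p') - DH (x, p)) * norm ?w"
      using norm_blinfun[of "DH (x', p') - DH (x, p)" "(0, ?w)"] by (simp add: norm_Pair)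
    finally have "norm ?w \<le> norm (DH (x', p') - DH (x, p))"
      by (cases "?w = 0") auto
    also have "\<dots> \<le> B * (norm (x' - x) + norm (p' - p))"
      by (rule order_trans[OF D[unfolded diff_Pair] mult_left_mono[OF norm_Pair_le less_imp_le[OF B(1)]]])
    finally show ?thesis .
  qed
  show ?thesis
  proof (rule that[OF B(1)])
    fix x v p x' v' p' :: "real^'d"
    assume *: "opt x v p" "opt x' v' p'" "norm v \<le> R" "norm v' \<le> R" "norm (x' - x) \<le> 1"
    obtain k where "norm (x + lattice_vec k) \<le> CARD('d)" by (rule translate_to_ball)
    from main[OF _ _ *(3,4) _ this, of p "x' + lattice_vec k" p'] *
    show "norm (v' - v) \<le> B * (norm (x' - x) + norm (p' - p))" by simp
  qed
qed

text \<open>A maximizer q at the perturbed point gives L(x + e, v + \<eta>) = q . (v + \<eta>) - H(x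
  + e, q), and strong convexity bounds H(x, q) from below by its expansion at p. The mixed term (q -
  p) . \<eta> is absorbed by the quadratic gain.\<close>

lemma L_upper_expansion:
  obtains B where "B > 0"
    "\<And>x v p e \<eta>. opt x v p \<Longrightarrow> norm v \<le> R \<Longrightarrow> norm e \<le> 1 \<Longrightarrow> norm \<eta> \<le> 1 \<Longrightarrow>
       L (x + e) (v + \<eta>) \<le> L x v + p \<bullet> \<eta> + B * ((norm \<eta>)\<^sup>2 + norm e)"
proof -
  obtain P where P: "P > 0" "\<And>x v p. norm v \<le> R + 1 \<Longrightarrow> opt x v p \<Longrightarrow> norm p \<le> P"
    using opt_norm_bound by blast
  obtain m where m: "m > 0" "\<And>x v p q. opt x v p \<Longrightarrow> norm p \<le> P \<Longrightarrow> norm q \<le> P \<Longrightarrow>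
     H x q \<ge> H x p + (q - p) \<bullet> v + m * (norm (q - p))\<^sup>2"
    using strong_convexity by blast
  obtain B where B: "B > 0"
    "\<And>x e p. norm e \<le> 1 \<Longrightarrow> norm p \<le> P \<Longrightarrow> \<bar>H (x + e) p - H x p\<bar> \<le> B * norm e"
    using H_lipschitz_x by blast
  have "L (x + e) (v + \<eta>) \<le> L x v + p \<bullet> \<eta> + (B + 1 / m) * ((norm \<eta>)\<^sup>2 + norm e)"
    if o: "opt x v p" and n: "norm v \<le> R" "norm e \<le> 1" "norm \<eta> \<le> 1" for x v p e \<eta>
  proof -
    obtain q where q: "opt (x + e) (v + \<eta>) q" by (rule opt_exists)
    have pq: "norm p \<le> P" "norm q \<le> P"
      using P(2)[OF _ o] P(2)[OF _ q] n norm_triangle_ineq[of v \<eta>] by auto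
    \<comment> \<open>Young's inequality, weighted so that the quadratic term matches the convexity
      constant m.\<close>
    have "(q - p) \<bullet> \<eta> \<le> m * (norm (q - p))\<^sup>2 + (1 / m) * (norm \<eta>)\<^sup>2"
    proof -
      have "0 \<le> (m * norm (q - p) - norm \<eta>)\<^sup>2" by simp
      then have "2 * (m * norm (q - p)) * norm \<eta> \<le> (m * norm (q - p))\<^sup>2 + (norm \<eta>)\<^sup>2"
        by (simp add: power2_diff)
      then have "m * (norm (q - p) * norm \<eta>) \<le> (m * norm (q - p))\<^sup>2 + (norm \<eta>)\<^sup>2"
        using mult_nonneg_nonneg[OF mult_nonneg_nonneg[OF less_imp_le[OF m(1)] norm_ge_zero[of "q - p"]]
            norm_ge_zero[of \<eta>]] by (simp add: mult.assoc)
      then have "norm (q - p) * norm \<eta> \<le> m * (norm (q - p))\<^sup>2 + (1 / m) * (norm \<eta>)\<^sup>2"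
        using m(1) by (simp add: field_simps power2_eq_square)
      then show ?thesis using norm_cauchy_schwarz[of "q - p" \<eta>] by linarith
    qed
    moreover have "H (x + e) q \<ge> H x q - B * norm e" using B(2)[OF n(2) pq(2), of x] by linarith
    moreover have "H x q \<ge> H x p + (q - p) \<bullet> v + m * (norm (q - p))\<^sup>2" by (rule m(2)[OF o pq])
    moreover have "L (x + e) (v + \<eta>) = q \<bullet> (v + \<eta>) - H (x + e) q" "L x v = p \<bullet> v - H x p"
      using opt_L o q by auto
    ultimately have "L (x + e) (v + \<eta>) \<le> L x v + p \<bullet> \<eta> + ((1 / m) * (norm \<eta>)\<^sup>2 + B * norm e)"
      by (simp add: inner_diff_left inner_add_right)
    also have "\<dots> \<le> L x v + p \<bullet> \<eta> + (B + 1 / m) * ((norm \<eta>)\<^sup>2 + norm e)"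
      using B(1) m(1) by (simp add: distrib_left distrib_right)
    finally show ?thesis .
  qed
  then show ?thesis using that[of "B + 1 / m"] B(1) m(1) by (simp add: add_pos_pos)
qed

text \<open>The upper expansion is applied in both directions between the two points; the squared
  velocity increment is at most the increment because its norm is at most 1.\<close>

lemma L_lipschitz:
  obtains B where "B > 0"
    "\<And>x v x' v'. norm v \<le> R \<Longrightarrow> norm v' \<le> R \<Longrightarrow> norm (x' - x) \<le> 1 \<Longrightarrow> norm (v' - v) \<le> 1 \<Longrightarrow>
       \<bar>L x' v' - L x v\<bar> \<le> B * (norm (x' - x) + norm (v' - v))"
proof -
  obtain P where P: "P > 0" "\<And>x v p. norm v \<le> R \<Longrightarrow> opt x v p \<Longrightarrow> norm p \<le> P"
    using opt_norm_bound by blast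
  obtain B where B: "B > 0"
    "\<And>x v p e \<eta>. opt x v p \<Longrightarrow> norm v \<le> R \<Longrightarrow> norm e \<le> 1 \<Longrightarrow> norm \<eta> \<le> 1 \<Longrightarrow>
       L (x + e) (v + \<eta>) \<le> L x v + p \<bullet> \<eta> + B * ((norm \<eta>)\<^sup>2 + norm e)"
    using L_upper_expansion by blast
  have main: "L x' v' - L x v \<le> (B + P) * (norm (x' - x) + norm (v' - v))"
    if n: "norm v \<le> R" "norm (x' - x) \<le> 1" "norm (v' - v) \<le> 1" for x v x' v'
  proof -
    obtain p where o: "opt x v p" by (rule opt_exists)
    have "L x' v' - L x v \<le> p \<bullet> (v' - v) + B * ((norm (v' - v))\<^sup>2 + norm (x' - x))"
      using B(2)[OF o n] by simp
    also have "p \<bullet> (v' - v) \<le> P * norm (v' - v)"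
      using norm_cauchy_schwarz[of p "v' - v"] mult_right_mono[OF P(2)[OF n(1) o], of "norm (v' - v)"] by simp
    also have "(norm (v' - v))\<^sup>2 \<le> norm (v' - v)"
      using n(3) by (simp add: power2_eq_square mult_left_le)
    finally have "L x' v' - L x v \<le> P * norm (v' - v) + B * (norm (v' - v) + norm (x' - x))"
      using B(1) by simp
    also have "\<dots> \<le> (B + P) * (norm (x' - x) + norm (v' - v))"
      using P(1) by (simp add: algebra_simps)
    finally show ?thesis .
  qed
  have "\<bar>L x' v' - L x v\<bar> \<le> (B + P) * (norm (x' - x) + norm (v' - v))"
    if n: "norm v \<le> R" "norm v' \<le> R" "norm (x' - x) \<le> 1" "norm (v' - v) \<le> 1" for x v x' v'
    using main[OF n(1,3,4)] main[OF n(2), of x x' v] n(3,4)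
    by (simp add: norm_minus_commute abs_le_iff)
  then show ?thesis using that[of "B + P"] B(1) P(1) by (simp add: add_pos_pos)
qed

lemma cont_L: "continuous_on UNIV (\<lambda>(x, v). L x v)"
proof -
  have "((\<lambda>z. L (fst z) (snd z)) \<longlongrightarrow> L x v) (at (x, v))" for x v
  proof -
    obtain B where B: "B > 0"
      "\<And>x' v'. norm v' \<le> norm v + 1 \<Longrightarrow> norm (x' - x) \<le> 1 \<Longrightarrow> norm (v' - v) \<le> 1 \<Longrightarrow>
         \<bar>L x' v' - L x v\<bar> \<le> B * (norm (x' - x) + norm (v' - v))"
      using L_lipschitz[of "norm v + 1"] by (metis le_add_same_cancel1 zero_le_one)
    have ev: "\<forall>\<^sub>F z in at (x, v). norm (fst z - x) \<le> 1 \<and> norm (snd z - v) \<le> 1"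
    proof -
      have "((\<lambda>z. fst z - x) \<longlongrightarrow> 0) (at (x, v))" "((\<lambda>z. snd z - v) \<longlongrightarrow> 0) (at (x, v))"
        by (auto intro!: tendsto_eq_intros)
      then have "\<forall>\<^sub>F z in at (x, v). dist (fst z - x) 0 < 1" "\<forall>\<^sub>F z in at (x, v). dist (snd z - v) 0 < 1"
        using zero_less_one by (auto dest!: tendstoD)
      then show ?thesis by eventually_elim auto
    qed
    have "((\<lambda>z. L (fst z) (snd z) - L x v) \<longlongrightarrow> 0) (at (x, v))"
    proof (rule Lim_null_comparison)
      show "\<forall>\<^sub>F z in at (x, v). norm (L (fst z) (snd z) - L x v)
          \<le> B * (norm (fst z - x) + norm (snd z - v))"
        using ev
      proof eventually_elim
        case (elim z)
        then show ?case using B(2)[of "snd z" "fst z"] norm_triangle_sub[of "snd z" v] by auto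
      qed
      show "((\<lambda>z. B * (norm (fst z - x) + norm (snd z - v))) \<longlongrightarrow> 0) (at (x, v))"
        by (auto intro!: tendsto_eq_intros)
    qed
    then show ?thesis by (simp add: LIM_zero_iff)
  qed
  then show ?thesis by (auto simp: continuous_on_def split_beta)
qed

lemma tendsto_L:
  "(f \<longlongrightarrow> x) F \<Longrightarrow> (g \<longlongrightarrow> p) F \<Longrightarrow> ((\<lambda>n. L (f n) (g n)) \<longlongrightarrow> L x p) F"
  using continuous_on_tendsto_compose[OF cont_L tendsto_Pair[of f x F g p]] by simp

lemma L_bounded:
  obtains B where "B \<ge> 0" "\<And>x v. norm v \<le> R \<Longrightarrow> \<bar>L x v\<bar> \<le> B"
proof -
  obtain P where P: "P > 0" "\<And>x v p. norm v \<le> R \<Longrightarrow> opt x v p \<Longrightarrow> norm p \<le> P"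
    using opt_norm_bound by blast
  obtain B where B: "B \<ge> 0" "\<And>x p. norm p \<le> P \<Longrightarrow> \<bar>H x p\<bar> \<le> B" using H_bounded by blast
  have "\<bar>L x v\<bar> \<le> P * \<bar>R\<bar> + B" if "norm v \<le> R" for x v
  proof -
    obtain p where o: "opt x v p" by (rule opt_exists)
    have p: "norm p \<le> P" using P(2)[OF that o] .
    have "\<bar>p \<bullet> v\<bar> \<le> P * \<bar>R\<bar>"
      using Cauchy_Schwarz_ineq2[of p v] mult_mono[of "norm p" P "norm v" "\<bar>R\<bar>"] p that P(1) by auto
    then show ?thesis using opt_L[OF o] B(2)[OF p, of x] by linarith
  qed
  then show ?thesis using that[of "P * \<bar>R\<bar> + B"] P(1) B(1) by simp
qed

lemma L_superlinear:
  assumes "K \<ge> 0"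
  obtains C where "C \<ge> 0" "\<And>x v. L x v \<ge> K * norm v - C"
proof -
  obtain B where B: "B \<ge> 0" "\<And>x p. norm p \<le> K \<Longrightarrow> \<bar>H x p\<bar> \<le> B" using H_bounded by blast
  have "L x v \<ge> K * norm v - B" for x v
  proof -
    \<comment> \<open>The momentum of norm K aligned with v. For v = 0 the division convention gives
      p = 0, and the claim still holds.\<close>
    define p where "p = (K / norm v) *\<^sub>R v"
    have "norm p \<le> K" "p \<bullet> v = K * norm v"
      using assms by (cases "v = 0"; simp add: p_def power2_norm_eq_inner[symmetric] power2_eq_square)+
    then show ?thesis using fenchel[of p v x] B(2)[of p x] by linarith
  qed
  then show ?thesis using that B(1) by blast
qed

end

lemma tonelli_hamiltonian_imp_tonelli:
  assumes "tonelli_hamiltonian H"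
  obtains DH D2H where "tonelli H DH D2H"
  using assms unfolding tonelli_hamiltonian_def tonelli_def by metis

section \<open>Uniqueness of the critical value\<close>

text \<open>A smooth periodic substitute for |z|^2 that vanishes exactly on the integer lattice.
  Test functions have to be periodic, which rules out the usual quadratic penalty in the doubling of
  variables.\<close>

definition torus_penalty :: "real ^ 'd::finite \<Rightarrow> real" where
  "torus_penalty z = (\<Sum>a\<in>UNIV. 1 - cos (2 * pi * z $ a))"

definition torus_penalty_grad :: "real ^ 'd::finite \<Rightarrow> real ^ 'd" where
  "torus_penalty_grad z = (\<chi> a. 2 * pi * sin (2 * pi * z $ a))"

lemma torus_penalty_nonneg: "torus_penalty z \<ge> 0"
  unfolding torus_penalty_def by (intro sum_nonneg) simp

lemma torus_penalty_0 [simp]: "torus_penalty 0 = 0"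
  by (simp add: torus_penalty_def)

lemma cos_add_int_period: "cos (2 * pi * (t + real_of_int n)) = cos (2 * pi * t)"
  by (simp add: distrib_left cos_add)

lemma torus_penalty_shift: "torus_penalty (z + lattice_vec k) = torus_penalty z"
  unfolding torus_penalty_def lattice_vec_def by (simp add: cos_add_int_period)

lemma torus_penalty_uminus: "torus_penalty (- z) = torus_penalty z"
  by (simp add: torus_penalty_def)

lemma torus_penalty_grad_uminus: "torus_penalty_grad (- z) = - torus_penalty_grad z"
  by (simp add: torus_penalty_grad_def vec_eq_iff)

lemma torus_penalty_eq_0:
  assumes "torus_penalty z = 0" obtains k where "z = lattice_vec k"
proof -
  have "\<exists>n::int. z $ a = real_of_int n" for a
  proof -
    have "1 - cos (2 * pi * z $ a) = 0"
      using assms sum_nonneg_eq_0_iff[of UNIV "\<lambda>a. 1 - cos (2 * pi * z $ a)"]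
      unfolding torus_penalty_def by simp
    then show ?thesis using cos_one_2pi_int[of "2 * pi * z $ a"] by auto
  qed
  then obtain k where "\<And>a. z $ a = real_of_int (k a)" by metis
  then have "z = lattice_vec (\<chi> a. k a)" by (simp add: lattice_vec_def vec_eq_iff)
  then show ?thesis by (rule that)
qed

lemma torus_penalty_has_derivative:
  "(torus_penalty has_derivative (\<lambda>w. torus_penalty_grad z \<bullet> w)) (at z)"
  unfolding torus_penalty_def [abs_def]
  by (auto intro!: derivative_eq_intros bounded_linear.has_derivative[OF bounded_linear_vec_nth]
      simp: torus_penalty_grad_def inner_vec_def sum_distrib_left intro!: sum.cong)

lemma continuous_on_torus_penalty_grad: "continuous_on S torus_penalty_grad"
  unfolding torus_penalty_grad_def [abs_def] by (intro continuous_intros)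

lemma continuous_on_torus_penalty: "continuous_on S torus_penalty"
  by (rule has_derivative_continuous_on[OF has_derivative_at_withinI[OF torus_penalty_has_derivative]])

lemma test_function_torus_penalty:
  "test_function (\<lambda>x. c * torus_penalty (x - y)) (\<lambda>x. c *\<^sub>R torus_penalty_grad (x - y))"
  unfolding test_function_def
proof (intro conjI allI)
  show "periodic (\<lambda>x. c * torus_penalty (x - y))"
    unfolding periodic_def using torus_penalty_shift by (metis add_diff_eq diff_add_eq)
  show "continuous_on UNIV (\<lambda>x. c *\<^sub>R torus_penalty_grad (x - y))"
    by (intro continuous_on_scaleR continuous_on_const
        continuous_on_compose2[OF continuous_on_torus_penalty_grad[of UNIV]]) (auto intro!: continuous_intros)
  fix x
  have "((\<lambda>x. torus_penalty (x - y)) has_derivative (\<lambda>w. torus_penalty_grad (x - y) \<bullet> w)) (at x)"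
    using has_derivative_compose[OF has_derivative_diff[OF has_derivative_ident has_derivative_const]
        torus_penalty_has_derivative, of y x UNIV] by simp
  then show "((\<lambda>x. c * torus_penalty (x - y)) has_derivative
      (\<lambda>w. (c *\<^sub>R torus_penalty_grad (x - y)) \<bullet> w)) (at x)"
    by (auto intro!: derivative_eq_intros)
qed

lemma viscosity_solution_le:
  assumes "viscosity_solution H c u" "test_function \<phi> g" "\<forall>\<^sub>F y in nhds x. u y - \<phi> y \<le> u x - \<phi> x"
  shows "H x (g x) \<le> c"
  using assms unfolding viscosity_solution_def viscosity_subsolution_def by metis

lemma viscosity_solution_ge:
  assumes "viscosity_solution H c u" "test_function \<phi> g" "\<forall>\<^sub>F y in nhds x. u y - \<phi> y \<ge> u x - \<phi> x"
  shows "H x (g x) \<ge> c"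
  using assms unfolding viscosity_solution_def viscosity_supersolution_def by metis

context tonelli
begin

text \<open>Doubling of variables. A maximizer (x_n, y_n) of u1(x) - u2(y) - n penalty(x - y)
  supplies one momentum p_n that is tested at x_n for u1 and at y_n for u2. The momenta are bounded
  because H(x_n, p_n) \<le> c1 and H is superlinear. At a limit point x and y differ by a lattice
  vector, so both inequalities concern the same value of H.\<close>

lemma comparison_principle:
  assumes u1: "viscosity_solution H c1 u1" and u2: "viscosity_solution H c2 u2"
  shows "c2 \<le> c1"
proof (rule ccontr)
  assume "\<not> c2 \<le> c1"
  let ?K = "cball (0::real^'d) CARD('d)"
  note u = u1[unfolded viscosity_solution_def] u2[unfolded viscosity_solution_def]
  define f where "f n = (\<lambda>(x, y). u1 x - u2 y - real n * torus_penalty (x - y))" for n :: nat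
  have "\<exists>z \<in> ?K \<times> ?K. \<forall>y. f n y \<le> f n z" for n
  proof -
    have "continuous_on (?K \<times> ?K) (\<lambda>z. u1 (fst z))" "continuous_on (?K \<times> ?K) (\<lambda>z. u2 (snd z))"
      using u by (auto intro: continuous_on_compose2[OF _ continuous_on_fst[OF continuous_on_id]]
          continuous_on_compose2[OF _ continuous_on_snd[OF continuous_on_id]])
    moreover have "continuous_on (?K \<times> ?K) (\<lambda>z. torus_penalty (fst z - snd z))"
      by (rule continuous_on_compose2[OF continuous_on_torus_penalty[of UNIV]])
        (auto intro!: continuous_intros)
    ultimately have "continuous_on (?K \<times> ?K) (f n)"
      unfolding f_def split_beta by (intro continuous_on_diff continuous_on_mult continuous_on_const)
    moreover have "?K \<times> ?K \<noteq> {}" by auto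
    ultimately obtain z where z: "z \<in> ?K \<times> ?K" "\<And>y. y \<in> ?K \<times> ?K \<Longrightarrow> f n y \<le> f n z"
      using continuous_attains_sup[of "?K \<times> ?K" "f n"] compact_Times[OF compact_cball compact_cball] by blast
    have "f n (x, y) \<le> f n z" for x y
    proof -
      obtain k where k: "norm (x + lattice_vec k) \<le> CARD('d)" by (rule translate_to_ball)
      obtain l where l: "norm (y + lattice_vec l) \<le> CARD('d)" by (rule translate_to_ball)
      have "torus_penalty (x + lattice_vec k - (y + lattice_vec l)) = torus_penalty (x - y)"
        using torus_penalty_shift[of "x - y" "k - l"] by (simp add: lattice_vec_diff algebra_simps)
      then have "f n (x, y) = f n (x + lattice_vec k, y + lattice_vec l)"
        using u by (simp add: f_def periodicD)
      then show ?thesis using z(2) k l by simp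
    qed
    then show ?thesis using z(1) by auto
  qed
  then obtain z where z: "\<And>n. z n \<in> ?K \<times> ?K" "\<And>n y. f n y \<le> f n (z n)" by metis
  define x where "x n = fst (z n)" for n
  define y where "y n = snd (z n)" for n
  define p where "p n = real n *\<^sub>R torus_penalty_grad (x n - y n)" for n
  have xy: "x n \<in> ?K" "y n \<in> ?K" for n using z(1)[of n] by (auto simp: x_def y_def)
  have max: "u1 x' - u2 y' - real n * torus_penalty (x' - y')
      \<le> u1 (x n) - u2 (y n) - real n * torus_penalty (x n - y n)" for n x' y'
    using z(2)[of n "(x', y')"] by (simp add: f_def split_beta x_def y_def)
  have H1: "H (x n) (p n) \<le> c1" for n
  proof -
    have "\<forall>\<^sub>F x' in nhds (x n). u1 x' - real n * torus_penalty (x' - y n)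
        \<le> u1 (x n) - real n * torus_penalty (x n - y n)"
      using max[of _ "y n" n] by (intro always_eventually) (auto simp: algebra_simps)
    from viscosity_solution_le[OF u1 test_function_torus_penalty this] show ?thesis by (simp add: p_def)
  qed
  have H2: "H (y n) (p n) \<ge> c2" for n
  proof -
    \<comment> \<open>For u2 the touching function is - n penalty(y' - x_n); the gradient of the
      penalty is odd, so the momentum is again p_n.\<close>
    have g: "torus_penalty_grad (y n - x n) = - torus_penalty_grad (x n - y n)"
      using torus_penalty_grad_uminus[of "x n - y n"] by simp
    have "\<forall>\<^sub>F y' in nhds (y n). u2 y' - (- real n) * torus_penalty (y' - x n)
        \<ge> u2 (y n) - (- real n) * torus_penalty (y n - x n)"
      using max[of "x n" _ n] torus_penalty_uminus[of "x n - _"]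
      by (intro always_eventually) (auto simp: algebra_simps)
    from viscosity_solution_ge[OF u2 test_function_torus_penalty this] show ?thesis by (simp add: p_def g)
  qed
  obtain C where C: "\<And>x p. H x p \<ge> 1 * norm p - C"
    using superl unfolding superlinear_def by (meson zero_less_one)
  have "p n \<in> cball 0 (c1 + C)" for n using C[of "p n" "x n"] H1[of n] by simp
  then have mem: "\<forall>n. (x n, y n, p n) \<in> ?K \<times> ?K \<times> cball 0 (c1 + C)" using xy by auto
  have sc: "seq_compact (?K \<times> ?K \<times> cball (0::real^'d) (c1 + C))"
    by (intro compact_imp_seq_compact compact_Times compact_cball)
  obtain l r where l: "strict_mono r" "((\<lambda>n. (x n, y n, p n)) \<circ> r) \<longlonglongrightarrow> l"
    by (rule seq_compactE[OF sc mem])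
  define x' where "x' = fst l" define y' where "y' = fst (snd l)" define p' where "p' = snd (snd l)"
  have lim: "(\<lambda>n. x (r n)) \<longlonglongrightarrow> x'" "(\<lambda>n. y (r n)) \<longlonglongrightarrow> y'" "(\<lambda>n. p (r n)) \<longlonglongrightarrow> p'"
    using tendsto_fst[OF l(2)] tendsto_fst[OF tendsto_snd[OF l(2)]] tendsto_snd[OF tendsto_snd[OF l(2)]]
    by (simp_all add: o_def x'_def y'_def p'_def)
  have "bounded (u ` ?K)" if "continuous_on UNIV u" for u :: "real^'d \<Rightarrow> real"
    using that by (intro compact_imp_bounded compact_continuous_image compact_cball) (rule continuous_on_subset, auto)
  then have "\<exists>B. \<forall>x\<in>?K. \<bar>u x\<bar> \<le> B" if "continuous_on UNIV u" for u :: "real^'d \<Rightarrow> real"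
    using that unfolding bounded_iff by fastforce
  then obtain B1 B2 where B: "\<And>x. x \<in> ?K \<Longrightarrow> \<bar>u1 x\<bar> \<le> B1" "\<And>x. x \<in> ?K \<Longrightarrow> \<bar>u2 x\<bar> \<le> B2"
    using u by metis
  \<comment> \<open>Comparison with the diagonal point (0, 0), where the penalty vanishes, bounds n
    times the penalty; hence the penalty tends to 0.\<close>
  have pen: "real n * torus_penalty (x n - y n) \<le> 2 * (B1 + B2)" for n
    using max[of 0 0 n] B(1)[of 0] B(1)[OF xy(1)[of n]] B(2)[of 0] B(2)[OF xy(2)[of n]] by simp
  have "(\<lambda>n. torus_penalty (x (r n) - y (r n))) \<longlonglongrightarrow> 0"
  proof (rule tendsto_sandwich[OF always_eventually _ tendsto_const])
    show "\<forall>n. 0 \<le> torus_penalty (x (r n) - y (r n))" by (simp add: torus_penalty_nonneg)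
    show "\<forall>\<^sub>F n in sequentially. torus_penalty (x (r n) - y (r n)) \<le> 2 * (B1 + B2) / real (r n)"
      using eventually_gt_at_top[of 0]
    proof eventually_elim
      case (elim n)
      then have "r n > 0" using seq_suble[OF l(1), of n] by simp
      then show ?case using pen[of "r n"] by (simp add: field_simps)
    qed
    show "(\<lambda>n. 2 * (B1 + B2) / real (r n)) \<longlonglongrightarrow> 0"
      by (intro tendsto_divide_0[OF tendsto_const]
          filterlim_at_top_imp_at_infinity[OF filterlim_compose[OF filterlim_real_sequentially
            filterlim_subseq[OF l(1)]]])
  qed
  moreover have "(\<lambda>n. torus_penalty (x (r n) - y (r n))) \<longlonglongrightarrow> torus_penalty (x' - y')"
    using continuous_on_tendsto_compose[OF continuous_on_torus_penalty[of UNIV] tendsto_diff[OF lim(1,2)]]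
    by simp
  ultimately have "torus_penalty (x' - y') = 0" using LIMSEQ_unique by blast
  then obtain k where "x' - y' = lattice_vec k" by (rule torus_penalty_eq_0)
  then have "H x' = H y'" using H_shift[of y' k] by (simp add: algebra_simps)
  moreover have "H x' p' \<le> c1"
    by (rule tendsto_upperbound[OF tendsto_H[OF lim(1,3)]]) (use H1 in auto)
  moreover have "H y' p' \<ge> c2"
    by (rule tendsto_lowerbound[OF tendsto_H[OF lim(2,3)]]) (use H2 in auto)
  ultimately show False using \<open>\<not> c2 \<le> c1\<close> by simp
qed

text \<open>The comparison principle, used in both directions, shows that two energies admitting
  solutions coincide, which resolves the THE.\<close>

lemma critical_value_eq:
  assumes "viscosity_solution H c u" shows "critical_value H = c"
  unfolding critical_value_def
  using assms comparison_principle by (intro the_equality) (auto intro: order_antisym)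

end

section \<open>Continuous convergence and discrete derivatives\<close>

text \<open>Continuous convergence: \<open>F n (x n) \<rightarrow> f t\<close> whenever \<open>x n \<rightarrow> t\<close>.\<close>

definition cconv :: "(nat \<Rightarrow> 'a::topological_space \<Rightarrow> 'b::topological_space) \<Rightarrow> ('a \<Rightarrow> 'b) \<Rightarrow> bool" where
  "cconv F f \<longleftrightarrow> (\<forall>t. ((\<lambda>z. F (fst z) (snd z)) \<longlongrightarrow> f t) (sequentially \<times>\<^sub>F nhds t))"

lemma cconvD:
  assumes "cconv F f" "x \<longlonglongrightarrow> t" shows "(\<lambda>n. F n (x n)) \<longlonglongrightarrow> f t"
  using filterlim_compose[OF assms(1)[unfolded cconv_def, rule_format, of t]
      filterlim_Pair[OF filterlim_ident assms(2)]] by simp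

lemma cconv_subseq:
  fixes F :: "nat \<Rightarrow> 'a::topological_space \<Rightarrow> 'b::topological_space"
  assumes "cconv F f" "strict_mono r" shows "cconv (\<lambda>n. F (r n)) f"
  unfolding cconv_def
proof
  fix t :: 'a
  have "filterlim (\<lambda>z. (r (fst z), snd z)) (sequentially \<times>\<^sub>F nhds t) (sequentially \<times>\<^sub>F nhds t)"
    by (intro filterlim_Pair filterlim_compose[OF filterlim_subseq[OF assms(2)]] filterlim_fst filterlim_snd)
  from filterlim_compose[OF assms(1)[unfolded cconv_def, rule_format, of t] this]
  show "((\<lambda>z. F (r (fst z)) (snd z)) \<longlongrightarrow> f t) (sequentially \<times>\<^sub>F nhds t)" by simp
qed

text \<open>The F n may be step functions: continuity of the limit comes from the uniformity in a
  neighbourhood of t that is built into \<open>cconv\<close>.\<close>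

lemma cconv_continuous_on:
  fixes F :: "nat \<Rightarrow> 'a::metric_space \<Rightarrow> 'b::metric_space"
  assumes "cconv F f" shows "continuous_on UNIV f"
proof -
  have "\<exists>d>0. \<forall>s. dist s t < d \<longrightarrow> dist (f s) (f t) < \<epsilon>" if "\<epsilon> > 0" for t \<epsilon>
  proof -
    have "\<forall>\<^sub>F z in sequentially \<times>\<^sub>F nhds t. dist (F (fst z) (snd z)) (f t) < \<epsilon> / 2"
      using assms that unfolding cconv_def by (intro tendstoD) auto
    then obtain P Q where PQ: "eventually P sequentially" "eventually Q (nhds t)"
      "\<And>n s. P n \<Longrightarrow> Q s \<Longrightarrow> dist (F n s) (f t) < \<epsilon> / 2"
      unfolding eventually_prod_filter by auto
    obtain d where d: "d > 0" "\<And>s. dist s t < d \<Longrightarrow> Q s"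
      using PQ(2) unfolding eventually_nhds_metric by blast
    have "dist (f s) (f t) < \<epsilon>" if "dist s t < d" for s
    proof -
      have "dist (f s) (f t) \<le> \<epsilon> / 2"
      proof (rule tendsto_upperbound)
        show "(\<lambda>n. dist (F n s) (f t)) \<longlonglongrightarrow> dist (f s) (f t)"
          by (intro tendsto_dist cconvD[OF assms] tendsto_const)
        show "\<forall>\<^sub>F n in sequentially. dist (F n s) (f t) \<le> \<epsilon> / 2"
          using PQ(1) by eventually_elim (use PQ(3) d(2) that less_imp_le in blast)
      qed simp
      then show ?thesis using \<open>\<epsilon> > 0\<close> by linarith
    qed
    then show ?thesis using d(1) by blast
  qed
  then show ?thesis unfolding continuous_on_iff by (metis UNIV_I)
qed

lemma cconvI_lipschitz:
  fixes F :: "nat \<Rightarrow> 'a::real_normed_vector \<Rightarrow> 'b::real_normed_vector"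
  assumes pt: "\<And>x. (\<lambda>n. F n x) \<longlonglongrightarrow> f x" and e: "e \<longlonglongrightarrow> 0"
    and lip: "\<And>n x y. norm (F n x - F n y) \<le> K * norm (x - y) + e n"
  shows "cconv F f"
  unfolding cconv_def
proof
  fix t :: 'a
  let ?F = "sequentially \<times>\<^sub>F nhds t"
  have "((\<lambda>z. F (fst z) (snd z) - f t) \<longlongrightarrow> 0) ?F"
  proof (rule Lim_null_comparison)
    show "\<forall>\<^sub>F z in ?F. norm (F (fst z) (snd z) - f t)
        \<le> K * norm (snd z - t) + e (fst z) + norm (F (fst z) t - f t)"
    proof (intro always_eventually allI)
      fix z
      show "norm (F (fst z) (snd z) - f t) \<le> K * norm (snd z - t) + e (fst z) + norm (F (fst z) t - f t)"
        using norm_triangle_ineq[of "F (fst z) (snd z) - F (fst z) t" "F (fst z) t - f t"]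
          lip[of "fst z" "snd z" t] by simp
    qed
    have s: "((\<lambda>z. snd z) \<longlongrightarrow> t) ?F" by (rule filterlim_snd)
    have "((\<lambda>z. e (fst z)) \<longlongrightarrow> 0) ?F" by (rule filterlim_compose[OF e filterlim_fst])
    moreover have "((\<lambda>z. F (fst z) t) \<longlongrightarrow> f t) ?F" by (rule filterlim_compose[OF pt filterlim_fst])
    ultimately have "((\<lambda>z. K * norm (snd z - t) + e (fst z) + norm (F (fst z) t - f t)) \<longlongrightarrow>
        K * norm (t - t) + 0 + norm (f t - f t)) ?F"
      by (intro tendsto_add tendsto_mult tendsto_norm tendsto_diff tendsto_const s)
    then show "((\<lambda>z. K * norm (snd z - t) + e (fst z) + norm (F (fst z) t - f t)) \<longlongrightarrow> 0) ?F"
      by simp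
  qed
  then show "((\<lambda>z. F (fst z) (snd z)) \<longlongrightarrow> f t) ?F" by (simp add: LIM_zero_iff)
qed

text \<open>Arzela-Ascoli with an error e n that absorbs the jumps of step functions. A diagonal
  subsequence converges on a countable dense set, and the approximate Lipschitz bound carries the
  Cauchy property to all other points.\<close>

lemma approx_lipschitz_compactness:
  fixes F :: "nat \<Rightarrow> 'a::euclidean_space \<Rightarrow> 'b::{heine_borel,banach}"
  assumes e: "e \<longlonglongrightarrow> 0"
    and lip: "\<And>n x y. norm (F n x - F n y) \<le> K * norm (x - y) + e n"
    and bdd: "\<And>x. \<exists>M. \<forall>n. norm (F n x) \<le> M"
  shows "\<exists>r f. strict_mono r \<and> cconv (\<lambda>n. F (r n)) f \<and> (\<forall>x y. norm (f x - f y) \<le> K * norm (x - y))"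
proof -
  obtain M where M: "\<And>x n. norm (F n x) \<le> M x" using bdd by metis
  obtain D :: "'a set" where D: "countable D" "\<And>X. open X \<Longrightarrow> X \<noteq> {} \<Longrightarrow> \<exists>d\<in>D. d \<in> X"
    using countable_dense_exists by blast
  \<comment> \<open>Pointwise rescaling by M x, because
    \<open>function_convergent_subsequence\<close> asks for one bound at all points.\<close>
  define G where "G n x = F n x /\<^sub>R (\<bar>M x\<bar> + 1)" for n x
  have "norm (G n x) \<le> 1" for n x
  proof -
    have "norm (F n x) \<le> \<bar>M x\<bar> + 1" using M[of n x] by linarith
    then show ?thesis by (simp add: G_def field_simps)
  qed
  then obtain k where k: "strict_mono k" "\<And>x. x \<in> D \<Longrightarrow> \<exists>l. (\<lambda>n. G (k n) x) \<longlonglongrightarrow> l"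
    using function_convergent_subsequence[OF D(1), of G 1] by blast
  have conv: "convergent (\<lambda>n. F (k n) d)" if "d \<in> D" for d
  proof -
    obtain l where "(\<lambda>n. G (k n) d) \<longlonglongrightarrow> l" using k(2) \<open>d \<in> D\<close> by blast
    from tendsto_scaleR[OF tendsto_const[of "\<bar>M d\<bar> + 1"] this] show ?thesis
      by (auto simp: G_def convergent_def)
  qed
  have ek: "(\<lambda>n. e (k n)) \<longlonglongrightarrow> 0" by (rule filterlim_compose[OF e filterlim_subseq[OF k(1)]])
  have "Cauchy (\<lambda>n. F (k n) x)" for x
  proof (rule CauchyI)
    fix \<epsilon> :: real assume "\<epsilon> > 0"
    define c where "c = \<bar>K\<bar> + 1"
    have c: "c > 0" "K \<le> c" by (auto simp: c_def)
    \<comment> \<open>Five contributions share \<epsilon>: two Lipschitz terms, two errors e, and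
      one Cauchy difference at d.\<close>
    define \<delta> where "\<delta> = \<epsilon> / 5 / c"
    have "\<delta> > 0" using \<open>\<epsilon> > 0\<close> c by (simp add: \<delta>_def)
    then obtain d where d: "d \<in> D" "dist x d < \<delta>" using D(2)[of "ball x \<delta>"] by auto
    have Kd: "K * norm (x - d) < \<epsilon> / 5" "K * norm (d - x) < \<epsilon> / 5"
    proof -
      have "K * norm (x - d) \<le> c * norm (x - d)" using c by (simp add: mult_right_mono)
      also have "\<dots> < c * \<delta>"
        using d(2) c by (intro mult_strict_left_mono) (auto simp: dist_norm)
      also have "\<dots> = \<epsilon> / 5" using c by (simp add: \<delta>_def)
      finally show "K * norm (x - d) < \<epsilon> / 5" "K * norm (d - x) < \<epsilon> / 5"
        by (simp_all add: norm_minus_commute)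
    qed
    have "Cauchy (\<lambda>n. F (k n) d)" using conv[OF d(1)] convergent_Cauchy by blast
    then obtain N1 where N1: "\<And>m n. m \<ge> N1 \<Longrightarrow> n \<ge> N1 \<Longrightarrow> norm (F (k m) d - F (k n) d) < \<epsilon> / 5"
      using \<open>\<epsilon> > 0\<close> CauchyD[of "\<lambda>n. F (k n) d" "\<epsilon> / 5"] by auto
    obtain N2 where N2: "\<And>n. n \<ge> N2 \<Longrightarrow> e (k n) < \<epsilon> / 5"
      using order_tendstoD(2)[OF ek, of "\<epsilon> / 5"] \<open>\<epsilon> > 0\<close> unfolding eventually_sequentially by auto
    have "norm (F (k m) x - F (k n) x) < \<epsilon>" if "m \<ge> max N1 N2" "n \<ge> max N1 N2" for m n
    proof -
      have "norm (F (k m) x - F (k n) x) \<le> norm (F (k m) x - F (k m) d) +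
          (norm (F (k m) d - F (k n) d) + norm (F (k n) d - F (k n) x))"
        using norm_triangle_ineq[of "F (k m) x - F (k m) d" "F (k m) d - F (k n) x"]
          norm_triangle_ineq[of "F (k m) d - F (k n) d" "F (k n) d - F (k n) x"] by simp
      then show ?thesis
        using lip[of "k m" x d] lip[of "k n" d x] Kd N1[of m n] N2[of m] N2[of n] that by simp
    qed
    then show "\<exists>N. \<forall>m\<ge>N. \<forall>n\<ge>N. norm (F (k m) x - F (k n) x) < \<epsilon>" by blast
  qed
  then have "\<forall>x. \<exists>l. (\<lambda>n. F (k n) x) \<longlonglongrightarrow> l"
    by (simp add: Cauchy_convergent_iff convergent_def)
  then obtain f where f: "\<And>x. (\<lambda>n. F (k n) x) \<longlonglongrightarrow> f x" by metis
  have "norm (f x - f y) \<le> K * norm (x - y)" for x y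
  proof (rule LIMSEQ_le)
    show "(\<lambda>n. norm (F (k n) x - F (k n) y)) \<longlonglongrightarrow> norm (f x - f y)"
      by (intro tendsto_norm tendsto_diff f)
    show "(\<lambda>n. K * norm (x - y) + e (k n)) \<longlonglongrightarrow> K * norm (x - y)"
      using tendsto_add[OF tendsto_const ek] by simp
  qed (use lip in blast)
  moreover have "cconv (\<lambda>n. F (k n)) f" by (rule cconvI_lipschitz[OF f ek lip])
  ultimately show ?thesis using k(1) by (intro exI[of _ k] exI[of _ f]) simp
qed

lemma tendsto_floor_scale:
  assumes "\<And>n. \<tau> n > (0::real)" "\<tau> \<longlonglongrightarrow> 0"
  shows "(\<lambda>n. \<tau> n * real_of_int \<lfloor>t / \<tau> n\<rfloor>) \<longlonglongrightarrow> t"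
proof (rule tendsto_sandwich[OF always_eventually always_eventually])
  show "(\<lambda>n. t - \<tau> n) \<longlonglongrightarrow> t" using tendsto_diff[OF tendsto_const assms(2), of t] by simp
  show "\<forall>n. t - \<tau> n \<le> \<tau> n * real_of_int \<lfloor>t / \<tau> n\<rfloor>"
  proof
    fix n
    have "t / \<tau> n - 1 \<le> real_of_int \<lfloor>t / \<tau> n\<rfloor>" by linarith
    from mult_left_mono[OF this, of "\<tau> n"] show "t - \<tau> n \<le> \<tau> n * real_of_int \<lfloor>t / \<tau> n\<rfloor>"
      using assms(1)[of n] by (simp add: right_diff_distrib)
  qed
  show "\<forall>n. \<tau> n * real_of_int \<lfloor>t / \<tau> n\<rfloor> \<le> t"
  proof
    fix n
    have "real_of_int \<lfloor>t / \<tau> n\<rfloor> \<le> t / \<tau> n" by linarith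
    from mult_left_mono[OF this, of "\<tau> n"] show "\<tau> n * real_of_int \<lfloor>t / \<tau> n\<rfloor> \<le> t"
      using assms(1)[of n] by simp
  qed
qed auto

text \<open>The left side telescopes into the sum of \<tau> (g k - c). It serves for derivatives
  and, with \<tau> = 1 and c = 0, for Lipschitz bounds along paths.\<close>

lemma increment_sum_bound:
  fixes S g :: "int \<Rightarrow> 'b::real_normed_vector"
  assumes step: "\<And>k. S (k + 1) = S k + \<tau> *\<^sub>R g k" and "\<tau> \<ge> 0" "a \<le> b"
    and "\<And>k. a \<le> k \<Longrightarrow> k < b \<Longrightarrow> norm (g k - c) \<le> \<epsilon>"
  shows "norm (S b - S a - (\<tau> * real_of_int (b - a)) *\<^sub>R c) \<le> (\<tau> * real_of_int (b - a)) * \<epsilon>"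
  using \<open>a \<le> b\<close> assms(4)
proof (induction b rule: int_ge_induct)
  case (step i)
  have "S (i + 1) - S a - (\<tau> * real_of_int (i + 1 - a)) *\<^sub>R c
      = (S i - S a - (\<tau> * real_of_int (i - a)) *\<^sub>R c) + \<tau> *\<^sub>R (g i - c)"
    unfolding assms(1) by (simp add: algebra_simps)
  also have "norm \<dots> \<le> (\<tau> * real_of_int (i - a)) * \<epsilon> + \<tau> * \<epsilon>"
    using step \<open>\<tau> \<ge> 0\<close> by (intro norm_triangle_mono) (auto intro!: mult_left_mono)
  finally show ?case by (simp add: algebra_simps)
qed simp

text \<open>Near t all discrete slopes are within \<epsilon> of G t for large n. Summing them over a
  short interval gives s(b) - s(a) = (b - a) G(t) up to (b - a) \<epsilon>, and this bound survives
  the limit in n.\<close>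

lemma discrete_derivative:
  fixes S g :: "nat \<Rightarrow> int \<Rightarrow> 'b::real_normed_vector"
  assumes \<tau>: "\<And>n. \<tau> n > 0" "\<tau> \<longlonglongrightarrow> 0"
    and step: "\<And>n k. S n (k + 1) = S n k + \<tau> n *\<^sub>R g n k"
    and S: "cconv (\<lambda>n t. S n \<lfloor>t / \<tau> n\<rfloor>) s"
    and g: "cconv (\<lambda>n t. g n \<lfloor>t / \<tau> n\<rfloor>) G"
  shows "(s has_vector_derivative G t) (at t)"
proof -
  have main: "\<exists>d>0. \<forall>a b. a \<le> b \<and> \<bar>a - t\<bar> < d \<and> \<bar>b - t\<bar> < d \<longrightarrow>
      norm (s b - s a - (b - a) *\<^sub>R G t) \<le> (b - a) * \<epsilon>" if "\<epsilon> > 0" for \<epsilon>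
  proof -
    have "\<forall>\<^sub>F z in sequentially \<times>\<^sub>F nhds t. dist (g (fst z) \<lfloor>snd z / \<tau> (fst z)\<rfloor>) (G t) < \<epsilon>"
      using g that unfolding cconv_def by (intro tendstoD) auto
    then obtain P Q where PQ: "eventually P sequentially" "eventually Q (nhds t)"
      "\<And>n s. P n \<Longrightarrow> Q s \<Longrightarrow> dist (g n \<lfloor>s / \<tau> n\<rfloor>) (G t) < \<epsilon>"
      unfolding eventually_prod_filter by auto
    obtain d where d: "d > 0" "\<And>s. dist s t < d \<Longrightarrow> Q s"
      using PQ(2) unfolding eventually_nhds_metric by blast
    \<comment> \<open>Half of d is kept in reserve: the sampled times may lie up to \<tau> n below
      a, and eventually \<tau> n < d / 2.\<close>
    have "norm (s b - s a - (b - a) *\<^sub>R G t) \<le> (b - a) * \<epsilon>"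
      if ab: "a \<le> b" "\<bar>a - t\<bar> < d / 2" "\<bar>b - t\<bar> < d / 2" for a b
    proof (rule LIMSEQ_le)
      let ?k = "\<lambda>n x. \<lfloor>x / \<tau> n\<rfloor>"
      have lim: "(\<lambda>n. \<tau> n * real_of_int (?k n b - ?k n a)) \<longlonglongrightarrow> b - a"
        using tendsto_diff[OF tendsto_floor_scale[OF \<tau>, of b] tendsto_floor_scale[OF \<tau>, of a]]
        by (simp add: right_diff_distrib)
      show "(\<lambda>n. norm (S n (?k n b) - S n (?k n a) - (\<tau> n * real_of_int (?k n b - ?k n a)) *\<^sub>R G t))
          \<longlonglongrightarrow> norm (s b - s a - (b - a) *\<^sub>R G t)"
        by (intro tendsto_intros lim cconvD[OF S])
      show "(\<lambda>n. \<tau> n * real_of_int (?k n b - ?k n a) * \<epsilon>) \<longlonglongrightarrow> (b - a) * \<epsilon>"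
        by (intro tendsto_intros lim)
      have "\<forall>\<^sub>F n in sequentially. \<tau> n < d / 2"
        using order_tendstoD(2)[OF \<tau>(2), of "d / 2"] d(1) by simp
      with PQ(1) have "\<forall>\<^sub>F n in sequentially.
          norm (S n (?k n b) - S n (?k n a) - (\<tau> n * real_of_int (?k n b - ?k n a)) *\<^sub>R G t)
          \<le> \<tau> n * real_of_int (?k n b - ?k n a) * \<epsilon>"
      proof eventually_elim
        case (elim n)
        show ?case
        proof (rule increment_sum_bound[of "S n" "\<tau> n" "g n", OF step])
          show "0 \<le> \<tau> n" using \<tau>(1)[of n] by simp
          then show "?k n a \<le> ?k n b" using ab(1) by (intro floor_mono divide_right_mono)
          fix k assume k: "?k n a \<le> k" "k < ?k n b"
          then have "a / \<tau> n - 1 < real_of_int k" "real_of_int k < b / \<tau> n" by linarith+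
          then have "a - \<tau> n < \<tau> n * real_of_int k" "\<tau> n * real_of_int k < b"
            using \<tau>(1)[of n] by (simp_all add: field_simps)
          then have "dist (\<tau> n * real_of_int k) t < d"
            using ab elim(2) by (simp add: dist_real_def abs_if split: if_splits)
          from PQ(3)[OF elim(1) d(2)[OF this]]
          show "norm (g n k - G t) \<le> \<epsilon>"
            using \<tau>(1)[of n] by (simp add: dist_norm)
        qed
      qed
      then show "\<exists>N. \<forall>n\<ge>N.
          norm (S n (?k n b) - S n (?k n a) - (\<tau> n * real_of_int (?k n b - ?k n a)) *\<^sub>R G t)
          \<le> \<tau> n * real_of_int (?k n b - ?k n a) * \<epsilon>"
        unfolding eventually_sequentially .
    qed
    then show ?thesis using d(1) by (intro exI[of _ "d / 2"] conjI allI impI) auto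
  qed
  show ?thesis
    unfolding has_vector_derivative_def has_derivative_within_alt
  proof (intro conjI allI impI)
    fix \<epsilon> :: real assume "\<epsilon> > 0"
    obtain d where d: "d > 0" and dd: "\<forall>a b. a \<le> b \<and> \<bar>a - t\<bar> < d \<and> \<bar>b - t\<bar> < d \<longrightarrow>
      norm (s b - s a - (b - a) *\<^sub>R G t) \<le> (b - a) * \<epsilon>" using main[OF \<open>\<epsilon> > 0\<close>] by (elim exE conjE)
    have "norm (s y - s t - (y - t) *\<^sub>R G t) \<le> \<epsilon> * norm (y - t)" if "norm (y - t) < d" for y
    proof (cases "t \<le> y")
      case True
      then show ?thesis using dd[rule_format, of t y] d that by (simp add: mult.commute)
    next
      case False
      have "s y - s t - (y - t) *\<^sub>R G t = - (s t - s y - (t - y) *\<^sub>R G t)"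
        by (simp add: algebra_simps)
      then have "norm (s y - s t - (y - t) *\<^sub>R G t) = norm (s t - s y - (t - y) *\<^sub>R G t)"
        by (metis norm_minus_cancel)
      then show ?thesis using dd[rule_format, of y t] d that False by (simp add: mult.commute)
    qed
    then show "\<exists>d>0. \<forall>y\<in>UNIV. norm (y - t) < d \<longrightarrow>
        norm (s y - s t - (y - t) *\<^sub>R G t) \<le> \<epsilon> * norm (y - t)" using d by (intro exI[of _ d]) auto
  qed (rule bounded_linear_scaleR_left)
qed

section \<open>Min-plus eigenvectors\<close>

text \<open>The minima of the iterates T^k 0 are superadditive in k, the maxima are subadditive, and
  a single application of T bounds the oscillation. So there is a growth rate a for which T^k 0 - k
  a stays bounded. The limit inferior of this sequence is fixed by T - a, which gives c = -
  a.\<close>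

lemma min_plus_eigenvector:
  fixes A :: "'a \<Rightarrow> 'a \<Rightarrow> real"
  assumes fin: "finite G" and ne: "G \<noteq> {}"
  obtains w c where "\<And>x y. x \<in> G \<Longrightarrow> y \<in> G \<Longrightarrow> w y \<le> w x + A x y + c"
    "\<And>y. y \<in> G \<Longrightarrow> \<exists>x\<in>G. w y = w x + A x y + c"
proof -
  define T where "T w y = Min ((\<lambda>x. w x + A x y) ` G)" for w y
  have T_le: "T w y \<le> w x + A x y" if "x \<in> G" for w x y
    unfolding T_def using fin that by (intro Min_le) auto
  have T_att: "\<exists>x\<in>G. T w y = w x + A x y" for w y
  proof -
    have "T w y \<in> (\<lambda>x. w x + A x y) ` G"
      unfolding T_def using fin ne by (intro Min_in) auto
    then show ?thesis by auto
  qed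
  \<comment> \<open>Monotonicity of T and its commutation with constants in one statement.\<close>
  have T_mono: "T w y \<le> T w' y + a" if "\<And>x. x \<in> G \<Longrightarrow> w x \<le> w' x + a" for w w' y a
  proof -
    obtain x where "x \<in> G" "T w' y = w' x + A x y" using T_att by blast
    then show ?thesis using T_le[of x w y] that[of x] by linarith
  qed
  define V where "V k = (T ^^ k) (\<lambda>_. 0)" for k :: nat
  define m where "m k = Min (V k ` G)" for k
  define M where "M k = Max (V k ` G)" for k
  have mM: "m k \<le> V k y" "V k y \<le> M k" if "y \<in> G" for k y
    unfolding m_def M_def using fin that by auto
  have m_att: "\<exists>y\<in>G. m k = V k y" for k
  proof -
    have "Min (V k ` G) \<in> V k ` G" using fin ne by (intro Min_in) auto
    then show ?thesis unfolding m_def by blast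
  qed
  have M_att: "\<exists>y\<in>G. M k = V k y" for k
  proof -
    have "Max (V k ` G) \<in> V k ` G" using fin ne by (intro Max_in) auto
    then show ?thesis unfolding M_def by blast
  qed
  have V_Suc: "V (Suc k) = T (V k)" for k by (simp add: V_def)
  have V_mono: "(T ^^ k) w y \<le> V k y + a" if "\<And>x. x \<in> G \<Longrightarrow> w x \<le> a" "y \<in> G" for k w y a
    using \<open>y \<in> G\<close>
  proof (induction k arbitrary: y)
    case (Suc k)
    then show ?case using T_mono[of "(T ^^ k) w" "V k" a y] by (simp add: V_Suc)
  qed (use that in \<open>simp add: V_def\<close>)
  have V_mono': "V k y + a \<le> (T ^^ k) w y" if "\<And>x. x \<in> G \<Longrightarrow> a \<le> w x" "y \<in> G" for k w y a
    using \<open>y \<in> G\<close>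
  proof (induction k arbitrary: y)
    case (Suc k)
    then show ?case using T_mono[of "V k" "(T ^^ k) w" "- a" y] by (simp add: V_Suc add.commute le_diff_eq)
  qed (use that in \<open>simp add: V_def\<close>)
  have V_add: "V (k + l) = (T ^^ l) (V k)" for k l
    unfolding V_def by (simp add: funpow_add add.commute[of k])
  have m_add: "m k + m l \<le> m (k + l)" for k l
  proof -
    obtain y where "y \<in> G" "m (k + l) = V (k + l) y" using m_att by blast
    then show ?thesis using V_mono'[of "m k" "V k" y l] mM(1)[of y l] mM(1)[of _ k] by (simp add: V_add)
  qed
  have M_add: "M (k + l) \<le> M k + M l" for k l
  proof -
    obtain y where "y \<in> G" "M (k + l) = V (k + l) y" using M_att by blast
    then show ?thesis using V_mono[of "V k" "M k" y l] mM(2)[of y l] mM(2)[of _ k] by (simp add: V_add)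
  qed
  have m0: "m 0 = 0" "M 0 = 0" using m_att[of 0] M_att[of 0] by (auto simp: V_def)
  have m_mult: "real j * m k \<le> m (j * k)" for j k
  proof (induction j)
    case (Suc j)
    then show ?case using m_add[of k "j * k"] by (simp add: algebra_simps)
  qed (simp add: m0)
  have M_mult: "M (j * k) \<le> real j * M k" for j k
  proof (induction j)
    case (Suc j)
    then show ?case using M_add[of k "j * k"] by (simp add: algebra_simps)
  qed (simp add: m0)
  have m_le_M: "m k \<le> M k" for k using m_att[of k] mM(2)[of _ k] by auto
  have cross: "m k / real k \<le> M l / real l" if "k > 0" "l > 0" for k l
  proof -
    have "real l * m k \<le> real k * M l"
      using m_mult[of l k] M_mult[of k l] m_le_M[of "k * l"] by (simp add: mult.commute)
    then show ?thesis using that by (simp add: field_simps)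
  qed
  \<comment> \<open>By \<open>cross\<close> every m k / k lies below every M l / l with k, l > 0; a
    separates the two families.\<close>
  define a where "a = (SUP k\<in>{0<..}. m k / real k)"
  have a: "m k \<le> real k * a" "real k * a \<le> M k" for k
  proof -
    have "bdd_above ((\<lambda>k. m k / real k) ` {0<..})"
      using cross[of _ 1] by (intro bdd_aboveI[of _ "M 1"]) auto
    then have "m k / real k \<le> a" if "k > 0" unfolding a_def using that by (intro cSUP_upper) auto
    then show "m k \<le> real k * a" by (cases "k = 0") (auto simp: m0 field_simps)
    have "a \<le> M k / real k" if "k > 0" unfolding a_def using that cross by (intro cSUP_least) auto
    then show "real k * a \<le> M k" by (cases "k = 0") (auto simp: m0 field_simps)
  qed
  define B where "B = Max ((\<lambda>(x, y). \<bar>A x y\<bar>) ` (G \<times> G))"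
  have B: "\<bar>A x y\<bar> \<le> B" if "x \<in> G" "y \<in> G" for x y
    unfolding B_def using fin that by (intro Max_ge) auto
  have B0: "B \<ge> 0" using B ne abs_ge_zero order_trans by blast
  \<comment> \<open>The minimizing predecessor x of y is also a candidate predecessor of y', so the
    two extremal values differ by at most two entries of A.\<close>
  have osc: "M k \<le> m k + 2 * B" for k
  proof (cases k)
    case 0
    then show ?thesis using m0 B0 by simp
  next
    case (Suc j)
    obtain y where y: "y \<in> G" "m k = V k y" using m_att by blast
    obtain y' where y': "y' \<in> G" "M k = V k y'" using M_att by blast
    obtain x where "x \<in> G" "V k y = V j x + A x y" using T_att[of "V j" y] Suc V_Suc by auto
    then show ?thesis using T_le[of x "V j" y'] y y' B[of x y] B[of x y'] Suc V_Suc[of j] by simp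
  qed
  define W where "W k y = V k y - real k * a" for k y
  have W: "\<bar>W k y\<bar> \<le> 2 * B" if "y \<in> G" for k y
    using mM[OF that, of k] a[of k] osc[of k] by (simp add: W_def abs_le_iff)
  have W_le: "W (Suc k) y \<le> W k x + A x y - a" if "x \<in> G" for k x y
    using T_le[OF that, of "V k" y] by (simp add: W_def V_Suc algebra_simps)
  have W_att: "\<exists>x\<in>G. W (Suc k) y = W k x + A x y - a" for k y
    using T_att[of "V k" y] by (auto simp: W_def V_Suc algebra_simps)
  \<comment> \<open>Tail infima instead of the sequence itself: the infimum over k commutes with the
    finite minimum in T, so on G one has w (Suc j) = T (w j) - a exactly, while w j increases with
    j.\<close>
  define w where "w j y = (INF k\<in>{j..}. W k y)" for j y
  have bdd: "bdd_below ((\<lambda>k. W k y) ` {j..})" if "y \<in> G" for j y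
    using W[OF that] by (intro bdd_belowI[of _ "- (2 * B)"]) (auto simp: abs_le_iff minus_le_iff)
  have w_le: "w j y \<le> W k y" if "y \<in> G" "j \<le> k" for j k y
    unfolding w_def using that by (intro cINF_lower bdd) auto
  have w_ge: "b \<le> w j y" if "\<And>k. j \<le> k \<Longrightarrow> b \<le> W k y" for b j y
    unfolding w_def using that by (intro cINF_greatest) auto
  have w_inc: "w j y \<le> w i y" if "y \<in> G" "j \<le> i" for i j y
    using that by (intro w_ge w_le) auto
  have w_sub: "w (Suc j) y \<le> w j x + A x y - a" if "x \<in> G" "y \<in> G" for x y j
  proof -
    have "w (Suc j) y - A x y + a \<le> w j x"
    proof (rule w_ge)
      fix k assume "j \<le> k"
      then show "w (Suc j) y - A x y + a \<le> W k x"
        using w_le[OF that(2), of "Suc j" "Suc k"] W_le[OF that(1), of k y] by simp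
    qed
    then show ?thesis by linarith
  qed
  have w_att: "\<exists>x\<in>G. w j x + A x y - a \<le> w (Suc j) y" if "y \<in> G" for y j
  proof -
    obtain x where x: "x \<in> G" "\<And>x'. x' \<in> G \<Longrightarrow> w j x + A x y \<le> w j x' + A x' y"
      using ex_min_if_finite[of "(\<lambda>x. w j x + A x y) ` G"] fin ne T_att[of "w j" y] T_le[of _ "w j" y] by metis
    have "w j x + A x y - a \<le> w (Suc j) y"
    proof (rule w_ge)
      fix k assume "Suc j \<le> k"
      then obtain i where i: "k = Suc i" "j \<le> i" by (cases k) auto
      obtain x' where "x' \<in> G" "W (Suc i) y = W i x' + A x' y - a" using W_att by blast
      then show "w j x + A x y - a \<le> W k y"
        using x(2)[of x'] w_le[of x' j i] i by simp
    qed
    then show ?thesis using x(1) by blast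
  qed
  define u where "u y = (SUP j. w j y)" for y
  have lim: "(\<lambda>j. w j y) \<longlonglongrightarrow> u y" "w j y \<le> u y" if "y \<in> G" for y j
  proof -
    have b: "bdd_above (range (\<lambda>j. w j y))"
    proof (intro bdd_aboveI[of _ "2 * B"])
      fix v assume "v \<in> range (\<lambda>j. w j y)"
      then obtain j where "v = w j y" by blast
      then show "v \<le> 2 * B" using w_le[OF that, of j j] W[OF that, of j] by (simp add: abs_le_iff)
    qed
    show "(\<lambda>j. w j y) \<longlonglongrightarrow> u y"
      unfolding u_def using w_inc[OF that] b by (intro LIMSEQ_incseq_SUP) (auto simp: incseq_def)
    show "w j y \<le> u y" unfolding u_def using b by (intro cSUP_upper) auto
  qed
  show ?thesis
  proof (rule that[of u "- a"])
    fix x y assume xy: "x \<in> G" "y \<in> G"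
    have "u y \<le> u x + A x y - a"
    proof (rule LIMSEQ_le[OF LIMSEQ_Suc[OF lim(1)[OF xy(2)]]])
      show "(\<lambda>j. w j x + A x y - a) \<longlonglongrightarrow> u x + A x y - a"
        by (intro tendsto_intros lim xy)
    qed (use w_sub xy in blast)
    then show "u y \<le> u x + A x y + - a" by simp
  next
    fix y assume y: "y \<in> G"
    \<comment> \<open>The minimizer may change with j. As G is finite, strict inequalities in the
      limit would hold for all x at a common j, against \<open>w_att\<close>.\<close>
    have "\<exists>x\<in>G. u x + A x y - a \<le> u y"
    proof (rule ccontr)
      assume "\<not> (\<exists>x\<in>G. u x + A x y - a \<le> u y)"
      then have "\<forall>x\<in>G. \<forall>\<^sub>F j in sequentially. u y < w j x + A x y - a"
        by (auto simp: not_le intro!: order_tendstoD(1) tendsto_intros lim)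
      then have "\<forall>\<^sub>F j in sequentially. \<forall>x\<in>G. u y < w j x + A x y - a"
        using fin by (simp add: eventually_ball_finite)
      then obtain j where j: "\<forall>x\<in>G. u y < w j x + A x y - a"
        unfolding eventually_sequentially by blast
      obtain x where "x \<in> G" "w j x + A x y - a \<le> w (Suc j) y" using w_att[OF y] by blast
      then show False using j lim(2)[OF y, of "Suc j"] by force
    qed
    then obtain x where x: "x \<in> G" "u x + A x y - a \<le> u y" by blast
    have "u y \<le> u x + A x y - a"
    proof (rule LIMSEQ_le[OF LIMSEQ_Suc[OF lim(1)[OF y]]])
      show "(\<lambda>j. w j x + A x y - a) \<longlonglongrightarrow> u x + A x y - a"
        by (intro tendsto_intros lim x)
    qed (use w_sub x y in blast)
    then show "\<exists>x\<in>G. u y = u x + A x y + - a" using x by (intro bexI[of _ x]) auto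
  qed
qed

section \<open>Discrete weak KAM solutions\<close>

text \<open>The lattice h Z^d. For h = 1 / N it contains Z^d and is the full preimage of the grid,
  so an edge (x, y, l) becomes a plain pair of lattice points.\<close>

definition mesh_lattice :: "real \<Rightarrow> (real ^ 'd::finite) set" where
  "mesh_lattice h = {x. \<forall>a. \<exists>k::int. x $ a = real_of_int k * h}"

lemma mesh_size_pos: "mesh_size h \<Longrightarrow> h > 0"
  by (auto simp: mesh_size_def)

lemma mesh_lattice_add: "x \<in> mesh_lattice h \<Longrightarrow> y \<in> mesh_lattice h \<Longrightarrow> x + y \<in> mesh_lattice h"
  unfolding mesh_lattice_def mem_Collect_eq vector_add_component by (metis distrib_right of_int_add)

lemma lattice_vec_mesh_lattice: "mesh_size h \<Longrightarrow> lattice_vec k \<in> mesh_lattice h"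
proof -
  assume "mesh_size h"
  then obtain N :: nat where N: "N \<ge> 1" "h = 1 / real N" by (auto simp: mesh_size_def)
  then have "real_of_int (k $ a) = real_of_int (k $ a * int N) * h" for a by simp
  then show ?thesis unfolding mesh_lattice_def lattice_vec_def by (auto simp del: of_int_mult)
qed

lemma mesh_lattice_shift:
  "mesh_size h \<Longrightarrow> x \<in> mesh_lattice h \<Longrightarrow> x + lattice_vec k \<in> mesh_lattice h"
  by (intro mesh_lattice_add lattice_vec_mesh_lattice)

lemma grid_subset_mesh_lattice: "grid h \<subseteq> mesh_lattice h"
  unfolding grid_def mesh_lattice_def by (auto intro: exI[of _ "int _"])

lemma zero_in_grid: "mesh_size h \<Longrightarrow> 0 \<in> grid h"
  unfolding grid_def using mesh_size_pos by (fastforce simp: vec_eq_iff intro!: exI[of _ "\<lambda>_. 0"])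

lemma finite_grid: "mesh_size h \<Longrightarrow> finite (grid h :: (real ^ 'd::finite) set)"
proof -
  assume "mesh_size h"
  then obtain N :: nat where N: "N \<ge> 1" "h = 1 / real N" by (auto simp: mesh_size_def)
  have "grid h \<subseteq> (\<lambda>i. \<chi> a. real (i a) * h) ` (PiE (UNIV :: 'd set) (\<lambda>_. {..<N}))"
    unfolding grid_def using N by (auto simp: PiE_def)
  moreover have "finite (PiE (UNIV :: 'd set) (\<lambda>_. {..<N}))" by (intro finite_PiE) auto
  ultimately show ?thesis using finite_surj by blast
qed

definition frac_vec :: "real ^ 'd::finite \<Rightarrow> real ^ 'd" where
  "frac_vec x = (\<chi> a. frac (x $ a))"

definition floor_vec :: "real ^ 'd::finite \<Rightarrow> int ^ 'd" where
  "floor_vec x = (\<chi> a. \<lfloor>x $ a\<rfloor>)"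

lemma frac_floor_vec: "x = frac_vec x + lattice_vec (floor_vec x)"
  by (simp add: frac_vec_def floor_vec_def lattice_vec_def vec_eq_iff frac_def)

lemma frac_vec_shift [simp]: "frac_vec (x + lattice_vec k) = frac_vec x"
  by (simp add: frac_vec_def lattice_vec_def vec_eq_iff frac_def)

lemma frac_vec_grid: "mesh_size h \<Longrightarrow> x \<in> grid h \<Longrightarrow> frac_vec x = x"
proof -
  assume "mesh_size h" "x \<in> grid h"
  then obtain i :: "'a \<Rightarrow> nat" where i: "x = (\<chi> a. real (i a) * h)" "\<And>a. real (i a) < 1 / h"
    unfolding grid_def by auto
  have "0 \<le> x $ a \<and> x $ a < 1" for a
    using i mesh_size_pos[OF \<open>mesh_size h\<close>] i(2)[of a] by (simp add: field_simps)
  then show ?thesis by (simp add: frac_vec_def vec_eq_iff frac_eq)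
qed

lemma frac_vec_in_grid: "mesh_size h \<Longrightarrow> x \<in> mesh_lattice h \<Longrightarrow> frac_vec x \<in> grid h"
proof -
  assume h: "mesh_size h" and x: "x \<in> mesh_lattice h"
  have "frac_vec x = x + lattice_vec (- floor_vec x)"
    using frac_floor_vec[of x] by (simp add: lattice_vec_uminus algebra_simps)
  then have "frac_vec x \<in> mesh_lattice h" using mesh_lattice_shift[OF h x] by simp
  then obtain k :: "'a \<Rightarrow> int" where k: "\<And>a. frac_vec x $ a = real_of_int (k a) * h"
    unfolding mesh_lattice_def by (auto; metis)
  have hp: "h > 0" by (rule mesh_size_pos[OF h])
  have b: "0 \<le> real_of_int (k a) * h" "real_of_int (k a) * h < 1" for a
    using k[of a] frac_lt_1[of "x $ a"] by (simp_all add: frac_vec_def flip: k)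
  have "k a \<ge> 0" for a using b(1)[of a] hp by (simp add: zero_le_mult_iff)
  then have "frac_vec x = (\<chi> a. real (nat (k a)) * h)" "\<And>a. real (nat (k a)) < 1 / h"
    using k b(2) hp by (simp_all add: vec_eq_iff field_simps)
  then show ?thesis unfolding grid_def by (intro CollectI exI[of _ "\<lambda>a. nat (k a)"] conjI allI)
qed

lemma finite_lattice_vec_ball: "finite {l :: int ^ 'd::finite. norm (lattice_vec l) \<le> R}"
proof -
  have "{l :: int ^ 'd. norm (lattice_vec l) \<le> R} \<subseteq> (\<lambda>f. \<chi> a. f a) ` (PiE UNIV (\<lambda>_. {- \<lceil>R\<rceil>..\<lceil>R\<rceil>}))"
  proof
    fix l :: "int ^ 'd" assume "l \<in> {l. norm (lattice_vec l) \<le> R}"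
    then have "\<bar>real_of_int (l $ a)\<bar> \<le> R" for a
      using component_le_norm_cart[of "lattice_vec l" a] by (simp add: lattice_vec_def)
    then have "l $ a \<in> {- \<lceil>R\<rceil>..\<lceil>R\<rceil>}" for a
      by (simp add: abs_le_iff) (smt (verit, best) ceiling_less_iff le_less_linear less_ceiling_iff of_int_minus ceiling_le_iff le_of_int_ceiling)
    then have "l = (\<chi> a. (\<lambda>a. l $ a) a)" "(\<lambda>a. l $ a) \<in> PiE UNIV (\<lambda>_. {- \<lceil>R\<rceil>..\<lceil>R\<rceil>})"
      by (auto simp: PiE_def)
    then show "l \<in> (\<lambda>f. \<chi> a. f a) ` (PiE UNIV (\<lambda>_. {- \<lceil>R\<rceil>..\<lceil>R\<rceil>}))" by blast
  qed
  moreover have "finite (PiE (UNIV :: 'd set) (\<lambda>_. {- \<lceil>R\<rceil>..\<lceil>R\<rceil>}))" by (intro finite_PiE) auto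
  ultimately show ?thesis using finite_surj by blast
qed

text \<open>Fixed points of the discrete Lax-Oleinik operator, lifted to h Z^d; off this lattice u
  is constrained by periodicity only. The sign of c is that of the critical value, so the minimal
  discrete action is - c.\<close>

definition discrete_weak_KAM ::
  "(real ^ 'd::finite \<Rightarrow> real ^ 'd \<Rightarrow> real) \<Rightarrow> real \<Rightarrow> real \<Rightarrow> real \<Rightarrow> (real ^ 'd \<Rightarrow> real) \<Rightarrow> bool" where
  "discrete_weak_KAM L h \<tau> c u \<longleftrightarrow> periodic u \<and>
     (\<forall>x\<in>mesh_lattice h. \<forall>y\<in>mesh_lattice h. u y \<le> u x + \<tau> * (L x ((y - x) /\<^sub>R \<tau>) + c)) \<and>
     (\<forall>y\<in>mesh_lattice h. \<exists>x\<in>mesh_lattice h. u y = u x + \<tau> * (L x ((y - x) /\<^sub>R \<tau>) + c))"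

context tonelli
begin

text \<open>Superlinearity confines the shifts that do no worse than l = 0 to a bounded, hence
  finite, set. The infimum over shifts becomes a minimum, and the costs become a finite matrix on
  the grid.\<close>

lemma best_lattice_translate:
  assumes "\<tau> > 0"
  shows "\<exists>l. \<forall>l'. L x (grid_velocity \<tau> x y l) \<le> L x (grid_velocity \<tau> x y l')"
proof -
  let ?f = "\<lambda>l. L x (grid_velocity \<tau> x y l)"
  obtain C where C: "C \<ge> 0" "\<And>x v. L x v \<ge> 1 * norm v - C" using L_superlinear[of 1] by auto
  let ?S = "{l. ?f l \<le> ?f 0}"
  have "?S \<subseteq> {l. norm (lattice_vec l) \<le> \<tau> * (?f 0 + C) + norm (y - x)}"
  proof
    fix l assume "l \<in> ?S"
    then have "norm (grid_velocity \<tau> x y l) \<le> ?f 0 + C" using C(2)[of "grid_velocity \<tau> x y l" x] by simp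
    moreover have "lattice_vec l + (y - x) = \<tau> *\<^sub>R grid_velocity \<tau> x y l"
      using assms by (simp add: grid_velocity_def algebra_simps)
    ultimately have "norm (lattice_vec l + (y - x)) \<le> \<tau> * (?f 0 + C)"
      using assms by simp
    then show "l \<in> {l. norm (lattice_vec l) \<le> \<tau> * (?f 0 + C) + norm (y - x)}"
      using norm_diff_ineq[of "lattice_vec l" "y - x"] by simp
  qed
  then have fin: "finite ?S" using finite_lattice_vec_ball finite_subset by blast
  define m where "m = Min (?f ` ?S)"
  have "m \<in> ?f ` ?S" unfolding m_def using fin by (intro Min_in) auto
  then obtain l where l: "l \<in> ?S" "?f l = m" by auto
  have "?f l \<le> ?f l'" for l'
  proof (cases "l' \<in> ?S")
    case True
    then show ?thesis unfolding l(2) m_def using fin by (intro Min_le) auto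
  next
    case False
    then show ?thesis using l(1) by simp
  qed
  then show ?thesis by blast
qed

lemma discrete_weak_KAM_exists:
  assumes h: "mesh_size h" and \<tau>: "\<tau> > 0"
  obtains u c where "discrete_weak_KAM L h \<tau> c u"
proof -
  obtain l where l: "\<And>x y l'. L x (grid_velocity \<tau> x y (l x y)) \<le> L x (grid_velocity \<tau> x y l')"
    using best_lattice_translate[OF \<tau>] by metis
  define A where "A x y = \<tau> * L x (grid_velocity \<tau> x y (l x y))" for x y
  obtain w c where w: "\<And>x y. x \<in> grid h \<Longrightarrow> y \<in> grid h \<Longrightarrow> w y \<le> w x + A x y + c"
    "\<And>y. y \<in> grid h \<Longrightarrow> \<exists>x\<in>grid h. w y = w x + A x y + c"
    using min_plus_eigenvector[OF finite_grid[OF h], of A] zero_in_grid[OF h] by blast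
  define u where "u x = w (frac_vec x)" for x
  \<comment> \<open>The eigenvalue is the constant added per step of duration \<tau>, hence the
    division.\<close>
  have "discrete_weak_KAM L h \<tau> (c / \<tau>) u"
    unfolding discrete_weak_KAM_def
  proof (intro conjI ballI)
    show "periodic u" by (simp add: periodic_def u_def)
  next
    fix x y :: "real^'d" assume xy: "x \<in> mesh_lattice h" "y \<in> mesh_lattice h"
    let ?x = "frac_vec x" let ?y = "frac_vec y"
    have "u y \<le> u x + A ?x ?y + c"
      unfolding u_def using xy by (intro w frac_vec_in_grid h)
    moreover have "A ?x ?y \<le> \<tau> * L ?x (grid_velocity \<tau> ?x ?y (floor_vec y - floor_vec x))"
      unfolding A_def using \<tau> l by simp
    moreover have "grid_velocity \<tau> ?x ?y (floor_vec y - floor_vec x) = (y - x) /\<^sub>R \<tau>"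
      using frac_floor_vec[of x] frac_floor_vec[of y]
      unfolding grid_velocity_def lattice_vec_diff by (metis add_diff_eq add_diff_add diff_diff_add diff_add_eq add.commute)
    moreover have "L ?x = L x" using L_shift[of ?x "floor_vec x"] frac_floor_vec[of x] by simp
    ultimately show "u y \<le> u x + \<tau> * (L x ((y - x) /\<^sub>R \<tau>) + c / \<tau>)"
      using \<tau> by (simp add: distrib_left)
  next
    fix y :: "real^'d" assume y: "y \<in> mesh_lattice h"
    let ?y = "frac_vec y"
    obtain x where x: "x \<in> grid h" "w ?y = w x + A x ?y + c" using w(2) frac_vec_in_grid[OF h y] by blast
    \<comment> \<open>The optimal shift is realized by moving the starting point, because the lift y
      of the endpoint is prescribed.\<close>
    define x' where "x' = x + lattice_vec (floor_vec y - l x ?y)"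
    have e: "y = ?y + lattice_vec (floor_vec y)" by (rule frac_floor_vec)
    have "y - x' = (?y + lattice_vec (floor_vec y)) - x'" by (simp flip: e)
    also have "\<dots> = ?y + lattice_vec (l x ?y) - x" by (simp add: x'_def lattice_vec_diff)
    finally have "(y - x') /\<^sub>R \<tau> = grid_velocity \<tau> x ?y (l x ?y)" by (simp add: grid_velocity_def)
    moreover have "x' \<in> mesh_lattice h"
      unfolding x'_def using x(1) grid_subset_mesh_lattice by (intro mesh_lattice_shift h) auto
    moreover have "u x' = w x" by (simp add: u_def x'_def frac_vec_grid[OF h x(1)])
    moreover have "L x' = L x" by (simp add: x'_def)
    ultimately show "\<exists>x\<in>mesh_lattice h. u y = u x + \<tau> * (L x ((y - x) /\<^sub>R \<tau>) + c / \<tau>)"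
      using x(2) \<tau> by (intro bexI[of _ x']) (auto simp: u_def A_def distrib_left)
  qed
  then show ?thesis by (rule that)
qed

end

text \<open>The iteration runs over edges rather than vertices, since only the target of an edge is
  known to have a successor and only the source a predecessor.\<close>

lemma biinfinite_path:
  fixes E :: "'a \<Rightarrow> 'a \<Rightarrow> bool"
  assumes "E p q" and fwd: "\<And>p q. E p q \<Longrightarrow> \<exists>r. E q r" and bwd: "\<And>p q. E p q \<Longrightarrow> \<exists>r. E r p"
  shows "\<exists>X :: int \<Rightarrow> 'a. X 0 = p \<and> X 1 = q \<and> (\<forall>k. E (X k) (X (k + 1)))"
proof -
  define sf where "sf = (\<lambda>(p::'a, q::'a). (q, SOME r. E q r))"
  define sb where "sb = (\<lambda>(p::'a, q::'a). (SOME r. E r p, p))"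
  define F where "F n = (sf ^^ n) (p, q)" for n
  define B where "B n = (sb ^^ n) (p, q)" for n
  have F: "E (fst (F n)) (snd (F n))" for n
  proof (induction n)
    case (Suc n)
    then show ?case using someI_ex[OF fwd[OF Suc]] by (simp add: F_def sf_def split_beta)
  qed (simp add: F_def assms)
  have B: "E (fst (B n)) (snd (B n))" for n
  proof (induction n)
    case (Suc n)
    then show ?case using someI_ex[OF bwd[OF Suc]] by (simp add: B_def sb_def split_beta)
  qed (simp add: B_def assms)
  have FS: "fst (F (Suc n)) = snd (F n)" for n by (simp add: F_def sf_def split_beta)
  have BS: "snd (B (Suc n)) = fst (B n)" for n by (simp add: B_def sb_def split_beta)
  define X where "X k = (if k \<ge> 0 then fst (F (nat k)) else fst (B (nat (- k))))" for k :: int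
  have "E (X k) (X (k + 1))" for k
  proof (cases "k \<ge> 0")
    case True
    then have "nat (k + 1) = Suc (nat k)" by simp
    then show ?thesis using True F[of "nat k"] FS[of "nat k"] by (simp add: X_def)
  next
    case False
    define n where "n = nat (- k - 1)"
    have n: "k = - int (Suc n)" using False by (simp add: n_def)
    have "k + 1 = - int n" using n by simp
    \<comment> \<open>For n = 0 the index k + 1 is 0 and falls into the forward branch; both
      branches start from the edge (p, q), so they agree there.\<close>
    then have "X (k + 1) = fst (B n)" by (cases "n = 0") (auto simp: X_def F_def B_def)
    moreover have "X k = fst (B (Suc n))" using False unfolding n by (simp add: X_def del: of_nat_Suc)
    ultimately show ?thesis using B[of "Suc n"] BS[of n] by simp
  qed
  moreover have "X 0 = p" "X 1 = q" by (simp_all add: X_def F_def sf_def)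
  ultimately show ?thesis by blast
qed

section \<open>Calibration on the discrete Mather set\<close>

lemma summable_on_first_slice:
  fixes \<nu> :: "'a \<Rightarrow> 'b \<Rightarrow> 'c \<Rightarrow> real"
  assumes "(\<lambda>(x, y, l). \<nu> x y l) summable_on G \<times> G' \<times> U" "x \<in> G"
  shows "(\<lambda>(y, l). \<nu> x y l) summable_on G' \<times> U"
proof -
  let ?h = "\<lambda>(y, l). (x, y, l)"
  have "(\<lambda>(x, y, l). \<nu> x y l) summable_on ?h ` (G' \<times> U)"
    by (rule summable_on_subset_banach[OF assms(1)]) (use assms(2) in auto)
  moreover have "inj_on ?h (G' \<times> U)" by (auto simp: inj_on_def)
  ultimately show ?thesis using summable_on_reindex[of ?h "G' \<times> U" "\<lambda>(x, y, l). \<nu> x y l"]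
    by (simp add: o_def case_prod_unfold)
qed

lemma bij_betw_swap_first_two: "bij_betw (\<lambda>(x, y, l). (y, x, l)) (G \<times> G' \<times> U) (G' \<times> G \<times> U)"
  by (rule bij_betwI[where g = "\<lambda>(x, y, l). (y, x, l)"]) auto

lemma summable_on_swap_first_two:
  assumes "(\<lambda>(x, y, l). \<nu> x y l) summable_on G \<times> G' \<times> U"
  shows "(\<lambda>(y, x, l). \<nu> x y l) summable_on G' \<times> G \<times> U"
proof -
  have "(\<lambda>(x, y, l). (\<lambda>(y, x, l). \<nu> x y l) (y, x, l)) summable_on G \<times> G' \<times> U" using assms by simp
  then show ?thesis
    using summable_on_reindex_bij_betw[OF bij_betw_swap_first_two[of G G' U], of "\<lambda>(y, x, l). \<nu> x y l"]
    by (simp add: case_prod_unfold)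
qed

text \<open>Integrating a function of the first vertex only needs the first marginal. Finiteness of
  G bounds the weight, which gives the joint summability behind the iterated sum.\<close>

lemma weighted_has_sum:
  fixes \<nu> :: "'a \<Rightarrow> 'b \<Rightarrow> 'c \<Rightarrow> real"
  assumes fin: "finite G" and nonneg: "\<And>x y l. x \<in> G \<Longrightarrow> y \<in> G' \<Longrightarrow> l \<in> U \<Longrightarrow> \<nu> x y l \<ge> 0"
    and sum: "(\<lambda>(x, y, l). \<nu> x y l) summable_on G \<times> G' \<times> U"
  shows "((\<lambda>(x, y, l). w x * \<nu> x y l) has_sum (\<Sum>x\<in>G. w x * (\<Sum>\<^sub>\<infinity>(y, l)\<in>G' \<times> U. \<nu> x y l))) (G \<times> G' \<times> U)"
proof (rule has_sum_SigmaI)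
  fix x assume "x \<in> G"
  from has_sum_cmult_right[OF has_sum_infsum[OF summable_on_first_slice[OF sum this]], of "w x"]
  show "((\<lambda>y. case (x, y) of (x, y, l) \<Rightarrow> w x * \<nu> x y l) has_sum w x * (\<Sum>\<^sub>\<infinity>(y, l)\<in>G' \<times> U. \<nu> x y l)) (G' \<times> U)"
    by (simp add: case_prod_unfold)
next
  define B where "B = (\<Sum>x\<in>G. \<bar>w x\<bar>)"
  have B: "\<bar>w x\<bar> \<le> B" if "x \<in> G" for x
    unfolding B_def using fin that by (intro member_le_sum) auto
  have "(\<lambda>z. B * (case z of (x, y, l) \<Rightarrow> \<nu> x y l)) summable_on G \<times> G' \<times> U"
    using has_sum_cmult_right[OF has_sum_infsum[OF sum], of B] summable_on_def by blast
  then have "(\<lambda>z. norm (case z of (x, y, l) \<Rightarrow> w x * \<nu> x y l)) summable_on G \<times> G' \<times> U"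
    by (rule summable_on_comparison_test) (auto simp: abs_mult B nonneg intro!: mult_right_mono)
  then show "(\<lambda>(x, y, l). w x * \<nu> x y l) summable_on G \<times> G' \<times> U"
    by (rule abs_summable_summable)
qed (use fin in simp)

section \<open>Consequences of holonomy\<close>

lemma discrete_holonomic_nonneg:
  "\<mu> \<in> discrete_holonomic h \<Longrightarrow> x \<in> grid h \<Longrightarrow> y \<in> grid h \<Longrightarrow> \<mu> x y l \<ge> 0"
  by (simp add: discrete_holonomic_def)

lemma discrete_holonomic_has_sum:
  "\<mu> \<in> discrete_holonomic h \<Longrightarrow> ((\<lambda>(x, y, l). \<mu> x y l) has_sum 1) (grid h \<times> grid h \<times> UNIV)"
  by (simp add: discrete_holonomic_def)

lemma discrete_holonomic_summable:
  "\<mu> \<in> discrete_holonomic h \<Longrightarrow> (\<lambda>(x, y, l). \<mu> x y l) summable_on grid h \<times> grid h \<times> UNIV"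
  using discrete_holonomic_has_sum summable_on_def by blast

lemma discrete_holonomic_balance:
  "\<mu> \<in> discrete_holonomic h \<Longrightarrow> x \<in> grid h \<Longrightarrow>
    (\<Sum>\<^sub>\<infinity>(y, l)\<in>grid h \<times> UNIV. \<mu> x y l) = (\<Sum>\<^sub>\<infinity>(y, l)\<in>grid h \<times> UNIV. \<mu> y x l)"
  by (simp add: discrete_holonomic_def)

text \<open>The terms w x and w y integrate against the first and the second marginal, which agree.
  Differences of a vertex function are therefore invisible to the total action.\<close>

lemma discrete_holonomic_coboundary:
  assumes \<mu>: "\<mu> \<in> discrete_holonomic h" and h: "mesh_size h"
  shows "((\<lambda>(x, y, l). (w y - w x) * \<mu> x y l) has_sum 0) (grid h \<times> grid h \<times> UNIV)"
proof -
  let ?G = "grid h \<times> grid h \<times> (UNIV :: (int^'a) set)"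
  let ?m = "\<Sum>x\<in>grid h. w x * (\<Sum>\<^sub>\<infinity>(y, l)\<in>grid h \<times> UNIV. \<mu> x y l)"
  have 1: "((\<lambda>(x, y, l). w x * \<mu> x y l) has_sum ?m) ?G"
    by (intro weighted_has_sum finite_grid h discrete_holonomic_summable[OF \<mu>] discrete_holonomic_nonneg[OF \<mu>])
  have "((\<lambda>(y, x, l). w y * \<mu> x y l) has_sum (\<Sum>x\<in>grid h. w x * (\<Sum>\<^sub>\<infinity>(y, l)\<in>grid h \<times> UNIV. \<mu> y x l))) ?G"
    using weighted_has_sum[OF finite_grid[OF h] _ summable_on_swap_first_two[OF discrete_holonomic_summable[OF \<mu>]], of w]
      discrete_holonomic_nonneg[OF \<mu>] by blast
  moreover have "(\<Sum>x\<in>grid h. w x * (\<Sum>\<^sub>\<infinity>(y, l)\<in>grid h \<times> UNIV. \<mu> y x l)) = ?m"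
    by (intro sum.cong) (simp_all add: discrete_holonomic_balance[OF \<mu>])
  ultimately have "((\<lambda>(y, x, l). w y * \<mu> x y l) has_sum ?m) ?G" by simp
  then have 2: "((\<lambda>(x, y, l). w y * \<mu> x y l) has_sum ?m) ?G"
    using has_sum_reindex_bij_betw[OF bij_betw_swap_first_two[of "grid h" "grid h" UNIV], of "\<lambda>(y, x, l). w y * \<mu> x y l" ?m]
    by (simp add: case_prod_unfold)
  from has_sum_add[OF 2 has_sum_cmult_right[OF 1, of "- 1"]] show ?thesis
    by (simp add: case_prod_unfold left_diff_distrib)
qed

text \<open>Conservation of mass at a vertex: if no outgoing edge of y carried mass, the total
  incoming mass would vanish as well, against the given edge; likewise backwards at x.\<close>

lemma discrete_holonomic_successor:
  assumes \<mu>: "\<mu> \<in> discrete_holonomic h" and xy: "x \<in> grid h" "y \<in> grid h" "\<mu> x y l > 0"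
  shows "\<exists>z\<in>grid h. \<exists>m. \<mu> y z m > 0" "\<exists>z\<in>grid h. \<exists>m. \<mu> z x m > 0"
proof -
  note s = summable_on_first_slice[OF discrete_holonomic_summable[OF \<mu>]]
    summable_on_first_slice[OF summable_on_swap_first_two[OF discrete_holonomic_summable[OF \<mu>]]]
  show "\<exists>z\<in>grid h. \<exists>m. \<mu> y z m > 0"
  proof (rule ccontr)
    assume no: "\<not> ?thesis"
    have "\<mu> y z m = 0" if "z \<in> grid h" for z m
    proof -
      have "\<not> \<mu> y z m > 0" using no that by blast
      then show ?thesis using discrete_holonomic_nonneg[OF \<mu> xy(2) that, of m] by linarith
    qed
    then have "(\<Sum>\<^sub>\<infinity>(z, m)\<in>grid h \<times> UNIV. \<mu> y z m) = 0" by (intro infsum_0) auto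
    then have "(\<Sum>\<^sub>\<infinity>(z, m)\<in>grid h \<times> UNIV. \<mu> z y m) \<le> 0"
      using discrete_holonomic_balance[OF \<mu> xy(2)] by simp
    from nonneg_infsum_le_0D[OF this s(2)[OF xy(2)], of "(x, l)"] show False
      using xy discrete_holonomic_nonneg[OF \<mu>] by auto
  qed
  show "\<exists>z\<in>grid h. \<exists>m. \<mu> z x m > 0"
  proof (rule ccontr)
    assume no: "\<not> ?thesis"
    have "\<mu> z x m = 0" if "z \<in> grid h" for z m
    proof -
      have "\<not> \<mu> z x m > 0" using no that by blast
      then show ?thesis using discrete_holonomic_nonneg[OF \<mu> that xy(1), of m] by linarith
    qed
    then have "(\<Sum>\<^sub>\<infinity>(z, m)\<in>grid h \<times> UNIV. \<mu> z x m) = 0" by (intro infsum_0) auto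
    then have "(\<Sum>\<^sub>\<infinity>(z, m)\<in>grid h \<times> UNIV. \<mu> x z m) \<le> 0"
      using discrete_holonomic_balance[OF \<mu> xy(1)] by simp
    from nonneg_infsum_le_0D[OF this s(1)[OF xy(1)], of "(y, l)"] show False
      using xy discrete_holonomic_nonneg[OF \<mu>] by auto
  qed
qed

text \<open>A nonempty invariant subset of least cardinality cannot be shrunk by f, so f permutes
  it.\<close>

lemma finite_invariant_bij:
  assumes "finite G" "G \<noteq> {}" "f ` G \<subseteq> G"
  obtains S where "S \<subseteq> G" "S \<noteq> {}" "bij_betw f S S"
proof -
  define P where "P S \<longleftrightarrow> S \<subseteq> G \<and> S \<noteq> {} \<and> f ` S \<subseteq> S" for S
  have "P G" using assms by (simp add: P_def)
  then obtain S where S: "P S" "\<And>S'. P S' \<Longrightarrow> card S \<le> card S'"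
    using ex_has_least_nat[of P G card] by blast
  have fin: "finite S" using S(1) assms(1) finite_subset by (auto simp: P_def)
  have "P (f ` S)" using S(1) by (auto simp: P_def)
  then have "card S \<le> card (f ` S)" by (rule S(2))
  then have "f ` S = S" using S(1) fin by (metis P_def card_seteq)
  then have "bij_betw f S S" using fin by (simp add: bij_betw_def eq_card_imp_inj_on)
  with S(1) show ?thesis by (intro that[of S]) (auto simp: P_def)
qed

context tonelli
begin

text \<open>Choosing an optimal predecessor f y of each grid point y gives a self-map of a finite
  set. On a subset permuted by f, equal weights on the edges from f y to y are balanced at every
  vertex. These edges are tight, and the values of u cancel in the sum, which leaves the action -
  c.\<close>

lemma holonomic_measure_of_critical_action:
  assumes h: "mesh_size h" and \<tau>: "\<tau> > 0" and u: "discrete_weak_KAM L h \<tau> c u"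
  obtains \<nu> where "\<nu> \<in> discrete_holonomic h" "finite_discrete_action L h \<tau> \<nu>"
    "discrete_action L h \<tau> \<nu> = - c"
proof -
  have "\<exists>x l. x \<in> grid h \<and> u y = u x + \<tau> * (L x (grid_velocity \<tau> x y l) + c)" if y: "y \<in> grid h" for y
  proof -
    have "y \<in> mesh_lattice h" using y grid_subset_mesh_lattice by blast
    then obtain x where x: "x \<in> mesh_lattice h" "u y = u x + \<tau> * (L x ((y - x) /\<^sub>R \<tau>) + c)"
      using u unfolding discrete_weak_KAM_def by blast
    \<comment> \<open>The predecessor is folded into the unit cell, and the translation is recorded
      as the shift of the edge.\<close>
    define x' where "x' = frac_vec x"
    have e: "x = x' + lattice_vec (floor_vec x)" unfolding x'_def by (rule frac_floor_vec)
    have "u x = u x'" "L x = L x'"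
      using u periodicD[of u x' "floor_vec x"] L_shift[of x' "floor_vec x"] e
      by (auto simp: discrete_weak_KAM_def)
    moreover have "y - x = y + lattice_vec (- floor_vec x) - x'"
    proof -
      have "y - x = y - (x' + lattice_vec (floor_vec x))" by (simp flip: e)
      then show ?thesis by (simp add: lattice_vec_uminus)
    qed
    ultimately have "u y = u x' + \<tau> * (L x' (grid_velocity \<tau> x' y (- floor_vec x)) + c)"
      using x(2) unfolding grid_velocity_def by (simp only:)
    then show ?thesis using frac_vec_in_grid[OF h x(1)] unfolding x'_def by blast
  qed
  then obtain f l where f: "\<And>y. y \<in> grid h \<Longrightarrow> f y \<in> grid h"
    "\<And>y. y \<in> grid h \<Longrightarrow> u y = u (f y) + \<tau> * (L (f y) (grid_velocity \<tau> (f y) y (l y)) + c)"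
    by metis
  obtain S where S: "S \<subseteq> grid h" "S \<noteq> {}" "bij_betw f S S"
    using finite_invariant_bij[OF finite_grid[OF h], of f] zero_in_grid[OF h] f(1) by blast
  have fin: "finite S" using S(1) finite_grid[OF h] finite_subset by blast
  define n where "n = real (card S)"
  have n: "n > 0" using S(2) fin by (simp add: n_def card_gt_0_iff)
  define \<nu> where "\<nu> x y l' = (if y \<in> S \<and> x = f y \<and> l' = l y then 1 / n else 0)" for x y l'
  have sum: "((\<lambda>(x, y, l). F x y l * \<nu> x y l) has_sum (\<Sum>y\<in>S. F (f y) y (l y)) / n) (grid h \<times> grid h \<times> UNIV)"
    for F :: "real^'d \<Rightarrow> real^'d \<Rightarrow> int^'d \<Rightarrow> real"
  proof (rule has_sum_finite_neutralI)
    let ?h = "\<lambda>y. (f y, y, l y)"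
    have inj: "inj_on ?h S" by (auto simp: inj_on_def)
    show "finite (?h ` S)" using fin by simp
    show "?h ` S \<subseteq> grid h \<times> grid h \<times> UNIV" using S(1) f(1) by auto
    show "(case z of (x, y, l) \<Rightarrow> F x y l * \<nu> x y l) = 0" if "z \<in> grid h \<times> grid h \<times> UNIV - ?h ` S" for z
      using that by (auto simp: \<nu>_def)
    show "(\<Sum>y\<in>S. F (f y) y (l y)) / n = (\<Sum>z\<in>?h ` S. case z of (x, y, l) \<Rightarrow> F x y l * \<nu> x y l)"
      by (simp add: sum.reindex[OF inj] sum_divide_distrib \<nu>_def)
  qed
  have nonneg: "\<nu> x y l' \<ge> 0" for x y l' using n by (simp add: \<nu>_def)
  have out: "(\<Sum>\<^sub>\<infinity>(y, l)\<in>grid h \<times> UNIV. \<nu> x y l) = (if x \<in> S then 1 / n else 0)" for x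
  proof (cases "x \<in> S")
    case True
    then have "x \<in> f ` S" using bij_betw_imp_surj_on[OF S(3)] by simp
    then obtain y where y: "y \<in> S" "f y = x" by (elim imageE) simp
    have "y \<in> grid h" using y S(1) by blast
    have "((\<lambda>(y, l). \<nu> x y l) has_sum 1 / n) (grid h \<times> UNIV)"
    proof (rule has_sum_finite_neutralI[of "{(y, l y)}"])
      show "(case z of (y, l) \<Rightarrow> \<nu> x y l) = 0" if "z \<in> grid h \<times> UNIV - {(y, l y)}" for z
      proof -
        have "a = y" if "a \<in> S" "f a = x" for a
          using inj_onD[OF bij_betw_imp_inj_on[OF S(3)], of a y] that y by simp
        then show ?thesis using that by (auto simp: \<nu>_def split: if_splits)
      qed
    qed (simp_all add: \<nu>_def y \<open>y \<in> grid h\<close>)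
    then show ?thesis using True by (simp add: infsumI)
  next
    case False
    then have "\<nu> x y l' = 0" for y l' using bij_betwE[OF S(3)] by (auto simp: \<nu>_def)
    then show ?thesis using False by (simp add: case_prod_unfold)
  qed
  have inn: "(\<Sum>\<^sub>\<infinity>(y, l)\<in>grid h \<times> UNIV. \<nu> y x l) = (if x \<in> S then 1 / n else 0)" for x
  proof (cases "x \<in> S")
    case True
    have "((\<lambda>(y, l). \<nu> y x l) has_sum 1 / n) (grid h \<times> UNIV)"
    proof (rule has_sum_finite_neutralI[of "{(f x, l x)}"])
      show "(case z of (y, l) \<Rightarrow> \<nu> y x l) = 0" if "z \<in> grid h \<times> UNIV - {(f x, l x)}" for z
        using that by (auto simp: \<nu>_def split: if_splits)
    qed (use True S(1) f(1) in \<open>auto simp: \<nu>_def\<close>)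
    then show ?thesis using True by (simp add: infsumI)
  next
    case False
    then have "\<nu> y x l' = 0" for y l' by (auto simp: \<nu>_def)
    then show ?thesis using False by (simp add: case_prod_unfold)
  qed
  have "(\<Sum>y\<in>S. L (f y) (grid_velocity \<tau> (f y) y (l y))) = (\<Sum>y\<in>S. (u y - u (f y)) / \<tau> - c)"
  proof (rule sum.cong)
    fix y assume "y \<in> S"
    then show "L (f y) (grid_velocity \<tau> (f y) y (l y)) = (u y - u (f y)) / \<tau> - c"
      using f(2)[of y] S(1) \<tau> by auto
  qed simp
  also have "\<dots> = ((\<Sum>y\<in>S. u y) - (\<Sum>y\<in>S. u (f y))) / \<tau> - n * c"
    by (simp add: sum_subtractf n_def flip: sum_divide_distrib)
  also have "(\<Sum>y\<in>S. u (f y)) = (\<Sum>y\<in>S. u y)" by (rule sum.reindex_bij_betw[OF S(3)])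
  finally have act: "((\<lambda>(x, y, l). L x (grid_velocity \<tau> x y l) * \<nu> x y l) has_sum - c)
      (grid h \<times> grid h \<times> UNIV)"
    using sum[of "\<lambda>x y l. L x (grid_velocity \<tau> x y l)"] n by simp
  have "((\<lambda>(x, y, l). \<nu> x y l) has_sum 1) (grid h \<times> grid h \<times> UNIV)"
    using sum[of "\<lambda>x y l. 1"] n by (simp add: n_def)
  then have "\<nu> \<in> discrete_holonomic h"
    unfolding discrete_holonomic_def using out inn nonneg by simp
  then show ?thesis
    using that act unfolding finite_discrete_action_def discrete_action_def
    by (metis (no_types, lifting) has_sum_imp_summable infsumI)
qed

text \<open>The defect D of the discrete weak KAM inequality is nonnegative, and its integral is the
  action plus c, since the coboundary of u integrates to 0. Comparison with the measure of action -
  c makes this integral \<le> 0, so D vanishes wherever \<mu> has mass.\<close>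

lemma discrete_mather_tight:
  assumes h: "mesh_size h" and \<tau>: "\<tau> > 0" and u: "discrete_weak_KAM L h \<tau> c u"
    and \<mu>: "discrete_mather_measure L h \<tau> \<mu>" and xy: "x \<in> grid h" "y \<in> grid h" "\<mu> x y l > 0"
  shows "u y = u x + \<tau> * (L x (grid_velocity \<tau> x y l) + c)"
proof -
  let ?G = "grid h \<times> grid h \<times> (UNIV :: (int^'d) set)"
  have hol: "\<mu> \<in> discrete_holonomic h" using \<mu> by (simp add: discrete_mather_measure_def)
  obtain \<nu> where \<nu>: "\<nu> \<in> discrete_holonomic h" "finite_discrete_action L h \<tau> \<nu>"
    "discrete_action L h \<tau> \<nu> = - c" by (rule holonomic_measure_of_critical_action[OF h \<tau> u])
  have le: "discrete_action L h \<tau> \<mu> \<le> - c" using \<mu> \<nu> unfolding discrete_mather_measure_def by fastforce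
  have act: "((\<lambda>(x, y, l). L x (grid_velocity \<tau> x y l) * \<mu> x y l) has_sum discrete_action L h \<tau> \<mu>) ?G"
    using \<mu> unfolding discrete_mather_measure_def finite_discrete_action_def discrete_action_def by simp
  define D where "D x y l = L x (grid_velocity \<tau> x y l) + c - (u y - u x) / \<tau>" for x y l
  have D: "D x y l \<ge> 0" if "x \<in> grid h" "y \<in> grid h" for x y l
  proof -
    have "x \<in> mesh_lattice h" "y + lattice_vec l \<in> mesh_lattice h"
      using that grid_subset_mesh_lattice mesh_lattice_shift[OF h] by blast+
    then have "u (y + lattice_vec l) \<le> u x + \<tau> * (L x ((y + lattice_vec l - x) /\<^sub>R \<tau>) + c)"
      using u unfolding discrete_weak_KAM_def by blast
    then show ?thesis
      using u \<tau> periodicD[of u y l] by (simp add: D_def grid_velocity_def discrete_weak_KAM_def field_simps)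
  qed
  have "((\<lambda>(x, y, l). D x y l * \<mu> x y l) has_sum discrete_action L h \<tau> \<mu> + c * 1 + (- 1 / \<tau>) * 0) ?G"
    using has_sum_add[OF has_sum_add[OF act has_sum_cmult_right[OF discrete_holonomic_has_sum[OF hol], of c]]
        has_sum_cmult_right[OF discrete_holonomic_coboundary[OF hol h, of u], of "- 1 / \<tau>"]]
    by (simp add: D_def case_prod_unfold algebra_simps diff_divide_distrib)
  then have "(case (x, y, l) of (x, y, l) \<Rightarrow> D x y l * \<mu> x y l) = 0"
    by (rule nonneg_has_sum_le_0D)
      (use le xy in \<open>auto intro!: mult_nonneg_nonneg D discrete_holonomic_nonneg[OF hol]\<close>)
  then have "D x y l = 0" using xy(3) by simp
  then show ?thesis using \<tau> by (simp add: D_def field_simps)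
qed

lemma discrete_mather_path:
  assumes h: "mesh_size h" and \<tau>: "\<tau> > 0" and u: "discrete_weak_KAM L h \<tau> c u"
    and z: "(x, v) \<in> periodize (\<Union>\<mu>\<in>{\<mu>. discrete_mather_measure L h \<tau> \<mu>}.
       {(x, grid_velocity \<tau> x y l) | x y l. x \<in> grid h \<and> y \<in> grid h \<and> \<mu> x y l > 0})"
  obtains X :: "int \<Rightarrow> real^'d" where "X 0 = x" "(X 1 - X 0) /\<^sub>R \<tau> = v" "\<And>k. X k \<in> mesh_lattice h"
    "\<And>k. u (X (k + 1)) = u (X k) + \<tau> * (L (X k) ((X (k + 1) - X k) /\<^sub>R \<tau>) + c)"
proof -
  obtain \<mu> x0 y0 k l where \<mu>: "discrete_mather_measure L h \<tau> \<mu>" and g: "x0 \<in> grid h" "y0 \<in> grid h" "\<mu> x0 y0 l > 0"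
    and xv: "x = x0 + lattice_vec k" "v = grid_velocity \<tau> x0 y0 l"
    using z unfolding periodize_def by blast
  have hol: "\<mu> \<in> discrete_holonomic h" using \<mu> by (simp add: discrete_mather_measure_def)
  \<comment> \<open>All integer translates of the supported edges: the target of a lifted edge
    carries the shift l + k, and the next edge has to start there.\<close>
  define E where "E p q \<longleftrightarrow> (\<exists>x y l k. x \<in> grid h \<and> y \<in> grid h \<and> \<mu> x y l > 0 \<and>
      p = x + lattice_vec k \<and> q = y + lattice_vec l + lattice_vec k)" for p q
  have E_I: "E (x + lattice_vec k) (y + lattice_vec l + lattice_vec k)"
    if "x \<in> grid h" "y \<in> grid h" "\<mu> x y l > 0" for x y l k
    unfolding E_def using that by blast
  have fwd: "\<exists>r. E q r" if E: "E p q" for p q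
  proof -
    obtain x y l k where *: "x \<in> grid h" "y \<in> grid h" "\<mu> x y l > 0" "q = y + lattice_vec l + lattice_vec k"
      using E unfolding E_def by blast
    obtain z m where "z \<in> grid h" "\<mu> y z m > 0" using discrete_holonomic_successor(1)[OF hol *(1-3)] by blast
    from E_I[OF *(2) this, of "l + k"] have "E q (z + lattice_vec m + lattice_vec (l + k))"
      by (simp add: *(4) lattice_vec_add add.assoc)
    then show ?thesis by blast
  qed
  have bwd: "\<exists>r. E r p" if E: "E p q" for p q
  proof -
    obtain x y l k where *: "x \<in> grid h" "y \<in> grid h" "\<mu> x y l > 0" "p = x + lattice_vec k"
      using E unfolding E_def by blast
    obtain z m where "z \<in> grid h" "\<mu> z x m > 0" using discrete_holonomic_successor(2)[OF hol *(1-3)] by blast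
    \<comment> \<open>The shift m of the incoming edge is subtracted so that its target is exactly
      p.\<close>
    from E_I[OF this(1) *(1) this(2), of "k - m"] have "E (z + lattice_vec (k - m)) p"
      by (simp add: *(4) lattice_vec_diff)
    then show ?thesis by blast
  qed
  have "E x (y0 + lattice_vec l + lattice_vec k)" using E_I[OF g] xv(1) by simp
  then have "\<exists>X. X 0 = x \<and> X 1 = y0 + lattice_vec l + lattice_vec k \<and> (\<forall>k::int. E (X k) (X (k + 1)))"
  proof (rule biinfinite_path[of E])
    show "\<exists>r. E q r" if "E p q" for p q by (rule fwd[OF that])
    show "\<exists>r. E r p" if "E p q" for p q by (rule bwd[OF that])
  qed
  then obtain X where X: "X 0 = x" "X 1 = y0 + lattice_vec l + lattice_vec k" "\<And>k::int. E (X k) (X (k + 1))"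
    by blast
  have E_tight: "p \<in> mesh_lattice h \<and> u q = u p + \<tau> * (L p ((q - p) /\<^sub>R \<tau>) + c)" if E: "E p q" for p q
  proof -
    obtain x y l k where *: "x \<in> grid h" "y \<in> grid h" "\<mu> x y l > 0" "p = x + lattice_vec k"
      "q = y + lattice_vec l + lattice_vec k"
      using E unfolding E_def by blast
    have "u q = u y" "u p = u x"
      using u periodicD[of u] by (simp_all add: * discrete_weak_KAM_def)
    moreover have "(q - p) /\<^sub>R \<tau> = grid_velocity \<tau> x y l" by (simp add: * grid_velocity_def)
    ultimately show ?thesis
      using discrete_mather_tight[OF h \<tau> u \<mu> *(1-3)] *(1) grid_subset_mesh_lattice mesh_lattice_shift[OF h]
      by (auto simp: *(4))
  qed
  show ?thesis
  proof (rule that[of X])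
    show "(X 1 - X 0) /\<^sub>R \<tau> = v" by (simp add: X xv grid_velocity_def)
  qed (use X(1) E_tight[OF X(3)] in blast)+
qed

end

section \<open>Uniform estimates\<close>

text \<open>Composition with this rounding extends a function from h Z^d to the whole space, which
  lets functions on different meshes be compared.\<close>

definition round_mesh :: "real \<Rightarrow> real ^ 'd::finite \<Rightarrow> real ^ 'd" where
  "round_mesh h x = (\<chi> a. real_of_int \<lfloor>x $ a / h\<rfloor> * h)"

lemma round_mesh_in: "round_mesh h x \<in> mesh_lattice h"
  by (auto simp: round_mesh_def mesh_lattice_def)

lemma round_mesh_id: "h > 0 \<Longrightarrow> x \<in> mesh_lattice h \<Longrightarrow> round_mesh h x = x"
proof -
  assume h: "h > 0" and "x \<in> mesh_lattice h"
  then have "\<exists>k::int. x $ a = real_of_int k * h" for a by (simp add: mesh_lattice_def)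
  then have "real_of_int \<lfloor>x $ a / h\<rfloor> * h = x $ a" for a
  proof -
    obtain k :: int where "x $ a = real_of_int k * h" using \<open>\<And>a. \<exists>k::int. x $ a = real_of_int k * h\<close> by blast
    then show ?thesis using h by simp
  qed
  then show ?thesis by (simp add: round_mesh_def vec_eq_iff)
qed

lemma norm_round_mesh:
  fixes x :: "real ^ 'd::finite" and h :: real
  assumes "h > 0" shows "norm (round_mesh h x - x) \<le> CARD('d) * h"
proof (rule norm_le_card_mult)
  fix a
  have "x $ a / h < real_of_int \<lfloor>x $ a / h\<rfloor> + 1" by linarith
  then have "x $ a \<le> real_of_int \<lfloor>x $ a / h\<rfloor> * h + h"
    using assms by (simp add: field_simps)
  moreover have "real_of_int \<lfloor>x $ a / h\<rfloor> * h \<le> x $ a"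
    using of_int_floor_le[of "x $ a / h"] unfolding pos_le_divide_eq[OF assms] .
  ultimately show "\<bar>(round_mesh h x - x) $ a\<bar> \<le> h" by (simp add: round_mesh_def)
qed

lemma round_mesh_shift:
  assumes "mesh_size h" shows "round_mesh h (x + lattice_vec k) = round_mesh h x + lattice_vec k"
proof -
  obtain N :: nat where N: "N \<ge> 1" "h = 1 / real N" using assms by (auto simp: mesh_size_def)
  have "\<lfloor>(x $ a + real_of_int (k $ a)) / h\<rfloor> = \<lfloor>x $ a / h\<rfloor> + k $ a * int N" for a
  proof -
    have "(x $ a + real_of_int (k $ a)) / h = x $ a / h + real_of_int (k $ a * int N)"
      using N by (simp add: algebra_simps)
    then show ?thesis by (simp only: floor_add_int)
  qed
  then show ?thesis using N by (simp add: round_mesh_def lattice_vec_def vec_eq_iff algebra_simps)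
qed

section \<open>Tight steps and time sampling of integer paths\<close>

definition tight_step ::
  "(real ^ 'd::finite \<Rightarrow> real ^ 'd \<Rightarrow> real) \<Rightarrow> real \<Rightarrow> real \<Rightarrow> (real ^ 'd \<Rightarrow> real) \<Rightarrow> real ^ 'd \<Rightarrow> real ^ 'd \<Rightarrow> bool" where
  "tight_step L \<tau> c u x y \<longleftrightarrow> u y = u x + \<tau> * (L x ((y - x) /\<^sub>R \<tau>) + c)"

lemma discrete_weak_KAM_le:
  "discrete_weak_KAM L h \<tau> c u \<Longrightarrow> x \<in> mesh_lattice h \<Longrightarrow> y \<in> mesh_lattice h \<Longrightarrow>
    u y \<le> u x + \<tau> * (L x ((y - x) /\<^sub>R \<tau>) + c)"
  by (simp add: discrete_weak_KAM_def)

lemma discrete_weak_KAM_tight: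
  assumes "discrete_weak_KAM L h \<tau> c u" "y \<in> mesh_lattice h"
  obtains x where "x \<in> mesh_lattice h" "tight_step L \<tau> c u x y"
  using assms unfolding discrete_weak_KAM_def tight_step_def by blast

lemma discrete_weak_KAM_periodic: "discrete_weak_KAM L h \<tau> c u \<Longrightarrow> periodic u"
  by (simp add: discrete_weak_KAM_def)

lemma int_path_lipschitz:
  fixes F :: "int \<Rightarrow> 'a::real_normed_vector"
  assumes "\<And>k. norm (F (k + 1) - F k) \<le> b"
  shows "norm (F j - F i) \<le> b * \<bar>real_of_int (j - i)\<bar>"
proof -
  have *: "norm (F j - F i) \<le> b * real_of_int (j - i)" if "i \<le> j" for i j
    using increment_sum_bound[of F 1 "\<lambda>k. F (k + 1) - F k" i j 0 b] assms that by (simp add: mult.commute)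
  show ?thesis
  proof (cases "i \<le> j")
    case True
    then show ?thesis using *[OF True] by simp
  next
    case False
    then show ?thesis using *[of j i] by (simp add: norm_minus_commute)
  qed
qed

text \<open>The extra \<tau> is the rounding error of the floors; it becomes the vanishing term in
  the approximate Lipschitz bounds.\<close>

lemma floor_time_diff:
  assumes "\<tau> > (0::real)" shows "\<tau> * \<bar>real_of_int (\<lfloor>t / \<tau>\<rfloor> - \<lfloor>s / \<tau>\<rfloor>)\<bar> \<le> \<bar>t - s\<bar> + \<tau>"
proof -
  have "\<bar>real_of_int (\<lfloor>t / \<tau>\<rfloor> - \<lfloor>s / \<tau>\<rfloor>)\<bar> \<le> \<bar>t / \<tau> - s / \<tau>\<bar> + 1" by linarith
  from mult_left_mono[OF this, of \<tau>]
  have "\<tau> * \<bar>real_of_int (\<lfloor>t / \<tau>\<rfloor> - \<lfloor>s / \<tau>\<rfloor>)\<bar> \<le> \<tau> * \<bar>t / \<tau> - s / \<tau>\<bar> + \<tau>"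
    using assms by (simp only: distrib_left mult_1_right)
  moreover have "\<tau> * \<bar>t / \<tau> - s / \<tau>\<bar> = \<bar>t - s\<bar>"
    using assms abs_mult[of \<tau> "t / \<tau> - s / \<tau>"] by (simp add: right_diff_distrib)
  ultimately show ?thesis by simp
qed

context tonelli
begin

text \<open>Staying at the origin forces L 0 0 + c \<ge> 0. Into a minimum point of u the tight step
  has L + c \<le> 0, while L is bounded below.\<close>

lemma discrete_critical_value_bounded:
  obtains B where "B \<ge> 0"
    "\<And>h \<tau> c u. mesh_size h \<Longrightarrow> \<tau> > 0 \<Longrightarrow> discrete_weak_KAM L h \<tau> c u \<Longrightarrow> \<bar>c\<bar> \<le> B"
proof -
  obtain C where C: "C \<ge> 0" "\<And>x v. L x v \<ge> 0 * norm v - C" using L_superlinear[of 0] by auto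
  have "\<bar>c\<bar> \<le> C + \<bar>L 0 0\<bar>" if h: "mesh_size h" and \<tau>: "\<tau> > 0" and u: "discrete_weak_KAM L h \<tau> c u" for h \<tau> c u
  proof -
    have 0: "0 \<in> grid h" "(0::real^'d) \<in> mesh_lattice h"
      using zero_in_grid[OF h] grid_subset_mesh_lattice by auto
    have "0 \<le> \<tau> * (L 0 0 + c)" using discrete_weak_KAM_le[OF u 0(2) 0(2)] by simp
    then have lower: "L 0 0 + c \<ge> 0" using \<tau> by (simp add: zero_le_mult_iff)
    define m where "m = Min (u ` grid h)"
    have "m \<in> u ` grid h" unfolding m_def using finite_grid[OF h] 0 by (intro Min_in) auto
    then obtain y where y: "y \<in> grid h" "u y = m" by auto
    have min: "u y \<le> u x" if "x \<in> mesh_lattice h" for x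
    proof -
      have "u x = u (frac_vec x)"
        using frac_floor_vec[of x] periodicD[OF discrete_weak_KAM_periodic[OF u], of "frac_vec x" "floor_vec x"] by simp
      moreover have "m \<le> u (frac_vec x)"
        unfolding m_def by (intro Min_le finite_imageI imageI finite_grid[OF h] frac_vec_in_grid[OF h that])
      ultimately show ?thesis by (simp add: y(2))
    qed
    have "y \<in> mesh_lattice h" using y grid_subset_mesh_lattice by blast
    then obtain x where x: "x \<in> mesh_lattice h" "tight_step L \<tau> c u x y"
      by (rule discrete_weak_KAM_tight[OF u])
    have "\<tau> * (L x ((y - x) /\<^sub>R \<tau>) + c) \<le> 0"
      using x(2) min[OF x(1)] by (simp add: tight_step_def)
    then have "L x ((y - x) /\<^sub>R \<tau>) + c \<le> 0" using \<tau> by (simp add: mult_le_0_iff)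
    then show ?thesis using C(2)[of "(y - x) /\<^sub>R \<tau>" x] lower C(1) abs_ge_self[of "L 0 0"] abs_ge_zero[of "L 0 0"]
      by (intro abs_leI) linarith+
  qed
  then show ?thesis using that[of "C + \<bar>L 0 0\<bar>"] C(1) by simp
qed

text \<open>The segment from x to y is cut into about |y - x| / \<tau> pieces whose endpoints are
  rounded to the mesh. As h = O(\<tau>), each piece has bounded velocity and costs at most a
  constant times \<tau>.\<close>

lemma discrete_weak_KAM_approx_lipschitz:
  assumes "C \<ge> 0"
  obtains K where "K \<ge> 0"
    "\<And>h \<tau> c u x y. mesh_size h \<Longrightarrow> 0 < \<tau> \<Longrightarrow> \<tau> \<le> 1 \<Longrightarrow> h \<le> C * \<tau>\<^sup>2 \<Longrightarrow> discrete_weak_KAM L h \<tau> c u \<Longrightarrow>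
      x \<in> mesh_lattice h \<Longrightarrow> y \<in> mesh_lattice h \<Longrightarrow> u y - u x \<le> K * (norm (y - x) + \<tau>)"
proof -
  let ?d = "real CARD('d)"
  obtain B where B: "B \<ge> 0"
    "\<And>h \<tau> c u. mesh_size h \<Longrightarrow> \<tau> > 0 \<Longrightarrow> discrete_weak_KAM L h \<tau> c u \<Longrightarrow> \<bar>c\<bar> \<le> B"
    using discrete_critical_value_bounded by blast
  obtain BL where BL: "BL \<ge> 0" "\<And>x v. norm v \<le> 1 + 2 * ?d * C \<Longrightarrow> \<bar>L x v\<bar> \<le> BL"
    using L_bounded[of "1 + 2 * ?d * C"] by blast
  have "u y - u x \<le> (BL + B) * (norm (y - x) + \<tau>)"
    if h: "mesh_size h" and \<tau>: "0 < \<tau>" "\<tau> \<le> 1" and hC: "h \<le> C * \<tau>\<^sup>2" and u: "discrete_weak_KAM L h \<tau> c u"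
      and xy: "x \<in> mesh_lattice h" "y \<in> mesh_lattice h" for h \<tau> c u x y
  proof -
    have hp: "h > 0" by (rule mesh_size_pos[OF h])
    have hC': "h \<le> C * \<tau>"
      using hC mult_left_mono[of "\<tau>\<^sup>2" \<tau> C] assms \<tau> by (simp add: power2_eq_square mult_left_le)
    have step: "u q \<le> u p + \<tau> * (BL + B)"
      if "p \<in> mesh_lattice h" "q \<in> mesh_lattice h" "norm (q - p) \<le> (1 + 2 * ?d * C) * \<tau>" for p q
    proof -
      have "norm ((q - p) /\<^sub>R \<tau>) = norm (q - p) / \<tau>" using \<tau> by (simp add: divide_inverse mult.commute)
      then have "norm ((q - p) /\<^sub>R \<tau>) \<le> 1 + 2 * ?d * C" using that(3) \<tau> by (simp add: pos_divide_le_eq)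
      then have "L p ((q - p) /\<^sub>R \<tau>) + c \<le> BL + B" using BL(2)[of _ p] B(2)[OF h \<tau>(1) u] by (simp add: abs_le_iff add_mono)
      from mult_left_mono[OF this less_imp_le[OF \<tau>(1)]] show ?thesis
        using discrete_weak_KAM_le[OF u that(1,2)] by linarith
    qed
    define D where "D = norm (y - x)"
    \<comment> \<open>At least one step is taken, even for x = y; since m \<tau> \<le> D + \<tau>,
      this accounts for the summand \<tau> in the bound.\<close>
    define m where "m = nat \<lfloor>D / \<tau>\<rfloor> + 1"
    have D: "D \<ge> 0" by (simp add: D_def)
    then have m: "real m \<le> D / \<tau> + 1" "D / \<tau> \<le> real m" "m > 0" using \<tau> by (simp_all add: m_def; linarith)+
    define z where "z j = round_mesh h (x + (real j / real m) *\<^sub>R (y - x))" for j :: nat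
    have z: "z j \<in> mesh_lattice h" for j by (simp add: z_def round_mesh_in)
    have zd: "norm (z (Suc j) - z j) \<le> (1 + 2 * ?d * C) * \<tau>" for j
    proof -
      let ?p = "\<lambda>j. x + (real j / real m) *\<^sub>R (y - x)"
      have "z (Suc j) - z j = (z (Suc j) - ?p (Suc j)) + (1 / real m) *\<^sub>R (y - x) - (z j - ?p j)"
        by (simp add: algebra_simps add_divide_distrib)
      also have "norm \<dots> \<le> norm (z (Suc j) - ?p (Suc j)) + norm ((1 / real m) *\<^sub>R (y - x)) + norm (z j - ?p j)"
        by (intro order_trans[OF norm_triangle_ineq4] add_right_mono norm_triangle_ineq)
      also have "\<dots> \<le> ?d * h + \<tau> + ?d * h"
      proof (intro add_mono)
        show "norm ((1 / real m) *\<^sub>R (y - x)) \<le> \<tau>"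
          unfolding norm_scaleR D_def[symmetric] using m \<tau> by (simp add: field_simps)
      qed (auto simp: z_def intro!: norm_round_mesh[OF hp])
      also have "\<dots> \<le> (1 + 2 * ?d * C) * \<tau>"
        using mult_left_mono[OF hC', of ?d] by (simp add: algebra_simps)
      finally show ?thesis .
    qed
    have "u (z j) \<le> u x + real j * (\<tau> * (BL + B))" for j
    proof (induction j)
      case 0
      then show ?case by (simp add: z_def round_mesh_id[OF hp xy(1)])
    next
      case (Suc j)
      then show ?case using step[OF z z zd, of j] by (simp add: distrib_right)
    qed
    from this[of m] have "u y - u x \<le> (real m * \<tau>) * (BL + B)"
      using m(3) by (simp add: z_def round_mesh_id[OF hp xy(2)] mult.assoc)
    also have "\<dots> \<le> (D + \<tau>) * (BL + B)"
      using m(1) \<tau>(1) BL(1) B(1) by (intro mult_right_mono) (auto simp: field_simps)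
    finally show ?thesis by (simp add: D_def mult.commute)
  qed
  then show ?thesis using that[of "BL + B"] BL(1) B(1) by simp
qed

text \<open>A tight step increases u by \<tau> (L + c), while u grows with slope at most K up to an
  error \<tau>. Superlinearity of L with slope K + 1 then bounds the velocity.\<close>

lemma tight_velocity_bounded:
  assumes "C \<ge> 0"
  obtains R where "R > 0"
    "\<And>h \<tau> c u x y. mesh_size h \<Longrightarrow> 0 < \<tau> \<Longrightarrow> \<tau> \<le> 1 \<Longrightarrow> h \<le> C * \<tau>\<^sup>2 \<Longrightarrow> discrete_weak_KAM L h \<tau> c u \<Longrightarrow>
      x \<in> mesh_lattice h \<Longrightarrow> y \<in> mesh_lattice h \<Longrightarrow> tight_step L \<tau> c u x y \<Longrightarrow> norm ((y - x) /\<^sub>R \<tau>) \<le> R"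
proof -
  obtain B where B: "B \<ge> 0"
    "\<And>h \<tau> c u. mesh_size h \<Longrightarrow> \<tau> > 0 \<Longrightarrow> discrete_weak_KAM L h \<tau> c u \<Longrightarrow> \<bar>c\<bar> \<le> B"
    using discrete_critical_value_bounded by blast
  obtain K where K: "K \<ge> 0"
    "\<And>h \<tau> c u x y. mesh_size h \<Longrightarrow> 0 < \<tau> \<Longrightarrow> \<tau> \<le> 1 \<Longrightarrow> h \<le> C * \<tau>\<^sup>2 \<Longrightarrow> discrete_weak_KAM L h \<tau> c u \<Longrightarrow>
      x \<in> mesh_lattice h \<Longrightarrow> y \<in> mesh_lattice h \<Longrightarrow> u y - u x \<le> K * (norm (y - x) + \<tau>)"
    using discrete_weak_KAM_approx_lipschitz[OF assms] by blast
  obtain C1 where C1: "C1 \<ge> 0" "\<And>x v. L x v \<ge> (K + 1) * norm v - C1"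
    using L_superlinear[of "K + 1"] K(1) by auto
  have "norm ((y - x) /\<^sub>R \<tau>) \<le> K + C1 + B + 1"
    if h: "mesh_size h" and \<tau>: "0 < \<tau>" "\<tau> \<le> 1" and hC: "h \<le> C * \<tau>\<^sup>2" and u: "discrete_weak_KAM L h \<tau> c u"
      and xy: "x \<in> mesh_lattice h" "y \<in> mesh_lattice h" and t: "tight_step L \<tau> c u x y" for h \<tau> c u x y
  proof -
    define V where "V = (y - x) /\<^sub>R \<tau>"
    have "norm (y - x) = \<tau> * norm V" using \<tau> by (simp add: V_def)
    then have "\<tau> * (L x V + c) \<le> \<tau> * (K * (norm V + 1))"
      using K(2)[OF h \<tau> hC u xy] t by (simp add: tight_step_def V_def algebra_simps)
    then have "L x V + c \<le> K * (norm V + 1)" using \<tau> by simp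
    then show ?thesis
      using C1(2)[of V x] B(2)[OF h \<tau>(1) u] unfolding V_def[symmetric] by (simp add: algebra_simps abs_le_iff)
  qed
  then show ?thesis using that[of "K + C1 + B + 1"] K(1) C1(1) B(1) by (simp add: add_nonneg_pos)
qed

text \<open>Discrete Euler--Lagrange inequality: an interior point of a calibrated chain minimizes the
  two-step action among grid points.  Moving it by \<open>\<plusminus>h\<close> along an axis changes the velocities by
  \<open>h / \<tau>\<close>, so the second order error is \<open>O(h\<^sup>2 / \<tau>\<^sup>2)\<close> against a first order term of size
  \<open>h / \<tau>\<close>; this is where \<open>h = O(\<tau>\<^sup>2)\<close> is needed.\<close>

lemma tight_velocity_lipschitz:
  assumes C: "C > 0"
  obtains B \<tau>0 where "B > 0" "\<tau>0 > 0"
    "\<And>h \<tau> c u x y z. mesh_size h \<Longrightarrow> 0 < \<tau> \<Longrightarrow> \<tau> \<le> \<tau>0 \<Longrightarrow> h \<le> C * \<tau>\<^sup>2 \<Longrightarrow> discrete_weak_KAM L h \<tau> c u \<Longrightarrow>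
      x \<in> mesh_lattice h \<Longrightarrow> y \<in> mesh_lattice h \<Longrightarrow> z \<in> mesh_lattice h \<Longrightarrow>
      tight_step L \<tau> c u x y \<Longrightarrow> tight_step L \<tau> c u y z \<Longrightarrow>
      norm ((z - y) /\<^sub>R \<tau> - (y - x) /\<^sub>R \<tau>) \<le> B * \<tau>"
proof -
  let ?d = "real CARD('d)"
  obtain R where R: "R > 0"
    "\<And>h \<tau> c u x y. mesh_size h \<Longrightarrow> 0 < \<tau> \<Longrightarrow> \<tau> \<le> 1 \<Longrightarrow> h \<le> C * \<tau>\<^sup>2 \<Longrightarrow> discrete_weak_KAM L h \<tau> c u \<Longrightarrow>
      x \<in> mesh_lattice h \<Longrightarrow> y \<in> mesh_lattice h \<Longrightarrow> tight_step L \<tau> c u x y \<Longrightarrow> norm ((y - x) /\<^sub>R \<tau>) \<le> R"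
    using tight_velocity_bounded[of C] C by (metis less_imp_le)
  obtain B1 where B1: "B1 > 0"
    "\<And>x v p e \<eta>. opt x v p \<Longrightarrow> norm v \<le> R \<Longrightarrow> norm e \<le> 1 \<Longrightarrow> norm \<eta> \<le> 1 \<Longrightarrow>
       L (x + e) (v + \<eta>) \<le> L x v + p \<bullet> \<eta> + B1 * ((norm \<eta>)\<^sup>2 + norm e)"
    using L_upper_expansion by blast
  obtain B2 where B2: "B2 > 0"
    "\<And>x v p x' v' p'. opt x v p \<Longrightarrow> opt x' v' p' \<Longrightarrow> norm v \<le> R \<Longrightarrow> norm v' \<le> R \<Longrightarrow>
       norm (x' - x) \<le> 1 \<Longrightarrow> norm (v' - v) \<le> B2 * (norm (x' - x) + norm (p' - p))"
    using velocity_lipschitz by blast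
  \<comment> \<open>The summand 2 C comes from the squared velocity changes of the two adjacent
    steps, the summand 1 from the displaced base point.\<close>
  define M where "M = B1 * (2 * C + 1)"
  \<comment> \<open>R \<tau> \<le> 1 keeps consecutive points within the distance allowed by
    \<open>velocity_lipschitz\<close>; C \<tau> \<le> 1 keeps the velocity change h / \<tau> within
    the range of \<open>L_upper_expansion\<close>.\<close>
  define \<tau>0 where "\<tau>0 = min 1 (min (1 / R) (1 / C))"
  have M: "M > 0" using B1(1) C by (simp add: M_def)
  have main: "norm ((z - y) /\<^sub>R \<tau> - (y - x) /\<^sub>R \<tau>) \<le> (B2 * (R + ?d * M)) * \<tau>"
    if h: "mesh_size h" and \<tau>: "0 < \<tau>" "\<tau> \<le> \<tau>0" and hC: "h \<le> C * \<tau>\<^sup>2" and u: "discrete_weak_KAM L h \<tau> c u"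
      and xyz: "x \<in> mesh_lattice h" "y \<in> mesh_lattice h" "z \<in> mesh_lattice h"
      and t: "tight_step L \<tau> c u x y" "tight_step L \<tau> c u y z" for h \<tau> c u x y z
  proof -
    have \<tau>1: "\<tau> \<le> 1" "\<tau> * R \<le> 1" "C * \<tau> \<le> 1"
      using \<tau> R(1) C by (auto simp: \<tau>0_def field_simps)
    have hp: "h > 0" "h \<le> 1" using h by (auto simp: mesh_size_def)
    have hC1: "h / \<tau> \<le> C * \<tau>" using hC \<tau> by (simp add: field_simps power2_eq_square)
    define v where "v = (y - x) /\<^sub>R \<tau>"
    define w where "w = (z - y) /\<^sub>R \<tau>"
    have vw: "norm v \<le> R" "norm w \<le> R"
      unfolding v_def w_def using R(2)[OF h \<tau>(1) \<tau>1(1) hC u] xyz t by blast+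
    obtain p where p: "opt x v p" by (rule opt_exists)
    obtain q where q: "opt y w q" by (rule opt_exists)
    \<comment> \<open>Both signs are admissible displacements of y, so the one-sided expansion gives
      a two-sided bound on every component of the momentum jump.\<close>
    have pert: "(q - p) \<bullet> (\<sigma> *\<^sub>R axis a 1) \<le> M * \<tau>" if \<sigma>: "\<sigma> = 1 \<or> \<sigma> = -1" for \<sigma> a
    proof -
      define e :: "real^'d" where "e = (\<sigma> * h) *\<^sub>R axis a 1"
      define \<eta> where "\<eta> = e /\<^sub>R \<tau>"
      have ne: "norm e = h" "norm \<eta> = h / \<tau>"
        using \<sigma> hp \<tau>(1) by (auto simp: e_def \<eta>_def norm_axis_1 divide_inverse)
      have e: "e \<in> mesh_lattice h"
      proof -
        have "\<exists>k::int. e $ b = real_of_int k * h" for b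
          using \<sigma> by (cases "b = a")
            (auto simp: e_def axis_def intro: exI[of _ "1::int"] exI[of _ "-1::int"] exI[of _ "0::int"])
        then show ?thesis by (simp add: mesh_lattice_def)
      qed
      have y': "y + e \<in> mesh_lattice h" by (rule mesh_lattice_add[OF xyz(2) e])
      have "u z \<le> u (y + e) + \<tau> * (L (y + e) ((z - (y + e)) /\<^sub>R \<tau>) + c)"
        "u (y + e) \<le> u x + \<tau> * (L x ((y + e - x) /\<^sub>R \<tau>) + c)"
        by (rule discrete_weak_KAM_le[OF u] xyz y')+
      moreover have "(z - (y + e)) /\<^sub>R \<tau> = w + - \<eta>" "(y + e - x) /\<^sub>R \<tau> = v + \<eta>"
        by (simp_all add: w_def v_def \<eta>_def algebra_simps)
      ultimately have "\<tau> * (L y w + L x v) \<le> \<tau> * (L (y + e) (w + - \<eta>) + L x (v + \<eta>))"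
        using t by (simp add: tight_step_def v_def w_def algebra_simps)
      then have "L y w + L x v \<le> L (y + e) (w + - \<eta>) + L x (v + \<eta>)" using \<tau>(1) by simp
      \<comment> \<open>L is evaluated at the starting point of a step, so only the second step pays
        for the displaced base point.\<close>
      moreover have "L (y + e) (w + - \<eta>) \<le> L y w + q \<bullet> (- \<eta>) + B1 * ((h / \<tau>)\<^sup>2 + h)"
        using B1(2)[OF q vw(2), of e "- \<eta>"] ne hp hC1 \<tau>1 by simp
      moreover have "L x (v + \<eta>) \<le> L x v + p \<bullet> \<eta> + B1 * (h / \<tau>)\<^sup>2"
        using B1(2)[OF p vw(1), of 0 \<eta>] ne hC1 \<tau>1 by simp
      ultimately have "(q - p) \<bullet> \<eta> \<le> B1 * (2 * (h / \<tau>)\<^sup>2 + h)"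
        by (simp add: inner_diff_left algebra_simps)
      also have "\<dots> = (h / \<tau>) * (B1 * (2 * (h / \<tau>) + \<tau>))"
        using \<tau>(1) by (simp add: power2_eq_square field_simps)
      also have "(q - p) \<bullet> \<eta> = (h / \<tau>) * ((q - p) \<bullet> (\<sigma> *\<^sub>R axis a 1))"
        by (simp add: \<eta>_def e_def field_simps)
      finally have "(q - p) \<bullet> (\<sigma> *\<^sub>R axis a 1) \<le> B1 * (2 * (h / \<tau>) + \<tau>)"
        by (rule mult_left_le_imp_le) (use hp \<tau>(1) in simp)
      also have "\<dots> \<le> B1 * (2 * (C * \<tau>) + \<tau>)"
        using hC1 B1(1) by (intro mult_left_mono add_mono) auto
      also have "\<dots> = M * \<tau>" by (simp add: M_def algebra_simps)
      finally show ?thesis .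
    qed
    have "norm (q - p) \<le> ?d * (M * \<tau>)"
    proof (rule norm_le_card_mult)
      fix a
      show "\<bar>(q - p) $ a\<bar> \<le> M * \<tau>"
        using pert[of 1 a] pert[of "-1" a] by (simp add: inner_axis abs_le_iff)
    qed
    moreover have "norm (y - x) \<le> R * \<tau>"
    proof -
      have "norm (y - x) = norm v * \<tau>" using \<tau>(1) by (simp add: v_def)
      then show ?thesis using mult_right_mono[OF vw(1), of \<tau>] \<tau>(1) by simp
    qed
    moreover have "norm (y - x) \<le> 1" using calculation(2) \<tau>1(2) by (simp add: mult.commute)
    then have "norm (w - v) \<le> B2 * (norm (y - x) + norm (q - p))"
      by (rule B2(2)[OF p q vw])
    ultimately have "norm (w - v) \<le> B2 * (R * \<tau> + ?d * (M * \<tau>))"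
      using B2(1) by (meson add_mono less_imp_le mult_left_mono order_trans)
    then show ?thesis by (simp add: v_def w_def algebra_simps)
  qed
  show ?thesis
  proof (rule that[OF _ _ main])
    show "B2 * (R + ?d * M) > 0" using B2(1) R(1) M by (simp add: add_pos_nonneg)
    show "\<tau>0 > 0" using R(1) C by (simp add: \<tau>0_def)
  qed
qed

end

section \<open>Limits of discrete weak KAM solutions\<close>

lemma gradient_mean_value:
  fixes f :: "'a::real_inner \<Rightarrow> real"
  assumes "\<And>x. (f has_derivative (\<lambda>w. g x \<bullet> w)) (at x)"
  obtains \<xi> where "f y - f x = g \<xi> \<bullet> (y - x)" "norm (\<xi> - x) \<le> norm (y - x)"
proof -
  have d: "((\<lambda>t. f (x + t *\<^sub>R (y - x))) has_real_derivative g (x + t *\<^sub>R (y - x)) \<bullet> (y - x)) (at t)" for t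
  proof -
    have "((\<lambda>t. x + t *\<^sub>R (y - x)) has_derivative (\<lambda>s. s *\<^sub>R (y - x))) (at t)"
      by (auto intro!: derivative_eq_intros)
    from has_derivative_compose[OF this assms] show ?thesis
      by (simp add: has_field_derivative_def mult.commute[of _ "_ \<bullet> _"])
  qed
  obtain t where t: "0 < t" "t < 1" "f (x + 1 *\<^sub>R (y - x)) - f (x + 0 *\<^sub>R (y - x))
      = (1 - 0) * (g (x + t *\<^sub>R (y - x)) \<bullet> (y - x))"
    using MVT2[of 0 1 "\<lambda>t. f (x + t *\<^sub>R (y - x))" "\<lambda>t. g (x + t *\<^sub>R (y - x)) \<bullet> (y - x)",
        OF zero_less_one d] by blast
  show ?thesis
  proof (rule that)
    show "f y - f x = g (x + t *\<^sub>R (y - x)) \<bullet> (y - x)" using t(3) by simp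
    show "norm (x + t *\<^sub>R (y - x) - x) \<le> norm (y - x)" using t(1,2) by (simp add: mult_left_le_one_le)
  qed
qed

section \<open>Convergence of meshes and of maximizers over them\<close>

lemma mesh_sizes_tendsto_0:
  assumes "\<And>n. mesh_size (h n)" "\<tau> \<longlonglongrightarrow> 0" "\<And>n. h n \<le> C * (\<tau> n)\<^sup>2"
  shows "h \<longlonglongrightarrow> 0"
proof (rule tendsto_sandwich[OF always_eventually always_eventually tendsto_const])
  show "\<forall>n. 0 \<le> h n" using mesh_size_pos[OF assms(1)] less_imp_le by blast
  show "\<forall>n. h n \<le> C * (\<tau> n)\<^sup>2" using assms(3) by blast
  show "(\<lambda>n. C * (\<tau> n)\<^sup>2) \<longlonglongrightarrow> 0"
    using tendsto_mult[OF tendsto_const[of C] tendsto_power[OF assms(2), of 2]] by simp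
qed

lemma finite_mesh_lattice_cball:
  fixes x0 :: "real ^ 'd::finite"
  assumes "mesh_size h" shows "finite (mesh_lattice h \<inter> cball x0 r)"
proof -
  have hp: "h > 0" by (rule mesh_size_pos[OF assms])
  have "mesh_lattice h \<inter> cball x0 r \<subseteq>
      (\<lambda>k. h *\<^sub>R lattice_vec k) ` {k. norm (lattice_vec k :: real ^ 'd) \<le> (norm x0 + r) / h}"
  proof
    fix x assume x: "x \<in> mesh_lattice h \<inter> cball x0 r"
    then have "\<forall>a. \<exists>k::int. x $ a = real_of_int k * h" by (simp add: mesh_lattice_def)
    then obtain k :: "'d \<Rightarrow> int" where "\<And>a. x $ a = real_of_int (k a) * h" by metis
    then have k: "x = h *\<^sub>R lattice_vec (\<chi> a. k a)" by (simp add: lattice_vec_def vec_eq_iff mult.commute)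
    have "norm x \<le> norm x0 + r"
      using x norm_triangle_sub[of x x0] by (simp add: dist_norm norm_minus_commute)
    then have "norm (lattice_vec (\<chi> a. k a) :: real ^ 'd) \<le> (norm x0 + r) / h"
      using hp by (subst (asm) k) (simp add: pos_le_divide_eq mult.commute)
    then show "x \<in> (\<lambda>k. h *\<^sub>R lattice_vec k) ` {k. norm (lattice_vec k :: real ^ 'd) \<le> (norm x0 + r) / h}"
      using k by blast
  qed
  then show ?thesis using finite_surj[OF finite_lattice_vec_ball] by blast
qed

lemma cconv_round_mesh:
  assumes "cconv (\<lambda>n x. w n (round_mesh (h n) x)) W" "\<And>n. h n > 0" "\<And>n. z n \<in> mesh_lattice (h n)" "z \<longlonglongrightarrow> z0"
  shows "(\<lambda>n. w n (z n)) \<longlonglongrightarrow> W z0"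
  using cconvD[OF assms(1,4)] round_mesh_id[OF assms(2,3)] by simp

lemma tendsto_round_mesh:
  fixes x :: "nat \<Rightarrow> real ^ 'd::finite"
  assumes "\<And>n. h n > 0" "h \<longlonglongrightarrow> 0" "x \<longlonglongrightarrow> x0"
  shows "(\<lambda>n. round_mesh (h n) (x n)) \<longlonglongrightarrow> x0"
proof -
  have "(\<lambda>n. round_mesh (h n) (x n) - x n) \<longlonglongrightarrow> 0"
  proof (rule Lim_null_comparison)
    show "\<forall>\<^sub>F n in sequentially. norm (round_mesh (h n) (x n) - x n) \<le> CARD('d) * h n"
      by (intro always_eventually allI norm_round_mesh assms)
    show "(\<lambda>n. CARD('d) * h n) \<longlonglongrightarrow> 0" using tendsto_mult_right_zero[OF assms(2)] by simp
  qed
  from tendsto_add[OF this assms(3)] show ?thesis by simp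
qed

text \<open>The quadratic term makes the maximum strict, so maximizers over the meshes converge.\<close>

lemma mesh_maximizers:
  fixes W :: "real ^ 'd::finite \<Rightarrow> real"
  assumes h: "\<And>n. mesh_size (h n)" "h \<longlonglongrightarrow> 0"
    and conv: "cconv (\<lambda>n x. w n (round_mesh (h n) x)) W"
    and \<psi>: "continuous_on UNIV \<psi>"
    and r: "r > 0" "\<And>y. y \<in> cball x0 r \<Longrightarrow> W y - \<psi> y \<le> W x0 - \<psi> x0"
  obtains s y where "strict_mono (s :: nat \<Rightarrow> nat)" "y \<longlonglongrightarrow> x0" "\<And>n. y n \<in> mesh_lattice (h (s n))"
    "\<And>n z. z \<in> mesh_lattice (h (s n)) \<Longrightarrow> z \<in> cball x0 r \<Longrightarrow>
       w (s n) z - (\<psi> z + (norm (z - x0))\<^sup>2) \<le> w (s n) (y n) - (\<psi> (y n) + (norm (y n - x0))\<^sup>2)"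
proof -
  have hp: "h n > 0" for n by (rule mesh_size_pos[OF h(1)])
  define x where "x n = round_mesh (h n) x0" for n
  have x: "x \<longlonglongrightarrow> x0" "x n \<in> mesh_lattice (h n)" for n
    unfolding x_def [abs_def] by (intro tendsto_round_mesh hp h tendsto_const) (simp add: round_mesh_in)
  have "\<forall>\<^sub>F n in sequentially. dist (x n) x0 < r" using tendstoD[OF x(1) r(1)] .
  \<comment> \<open>For the first indices the mesh may miss the ball; they are dropped, whence the
    shift by N below.\<close>
  then obtain N where "\<forall>n\<ge>N. dist (x n) x0 < r" unfolding eventually_sequentially by blast
  then have N: "\<And>n. n \<ge> N \<Longrightarrow> x n \<in> cball x0 r" by (simp add: dist_commute less_imp_le)
  let ?f = "\<lambda>n z. w n z - (\<psi> z + (norm (z - x0))\<^sup>2)"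
  have "\<exists>y \<in> mesh_lattice (h n) \<inter> cball x0 r. \<forall>z \<in> mesh_lattice (h n) \<inter> cball x0 r. ?f n z \<le> ?f n y"
    if "n \<ge> N" for n
  proof -
    let ?S = "mesh_lattice (h n) \<inter> cball x0 r"
    have fin: "finite (?f n ` ?S)" by (intro finite_imageI finite_mesh_lattice_cball h)
    have "?f n ` ?S \<noteq> {}" using x(2)[of n] N[OF that] by blast
    then have "Max (?f n ` ?S) \<in> ?f n ` ?S" using fin by (rule Max_in[rotated])
    then obtain y where y: "y \<in> ?S" "Max (?f n ` ?S) = ?f n y" by (elim imageE)
    have "?f n z \<le> ?f n y" if "z \<in> ?S" for z
      unfolding y(2)[symmetric] using fin by (rule Max_ge) (rule imageI[OF that])
    then show ?thesis using y(1) by (intro bexI[of _ y]) auto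
  qed
  then have "\<forall>n. \<exists>y. y \<in> mesh_lattice (h (n + N)) \<inter> cball x0 r \<and>
      (\<forall>z \<in> mesh_lattice (h (n + N)) \<inter> cball x0 r. ?f (n + N) z \<le> ?f (n + N) y)"
    by (meson le_add2)
  then obtain y where y: "\<And>n. y n \<in> mesh_lattice (h (n + N)) \<inter> cball x0 r"
    "\<And>n z. z \<in> mesh_lattice (h (n + N)) \<inter> cball x0 r \<Longrightarrow> ?f (n + N) z \<le> ?f (n + N) (y n)"
    by metis
  have mem: "\<forall>n. y n \<in> cball x0 r" using y(1) by blast
  obtain l q where l: "l \<in> cball x0 r" "strict_mono q" "(y \<circ> q) \<longlonglongrightarrow> l"
    by (rule seq_compactE[OF compact_imp_seq_compact[OF compact_cball[of x0 r]] mem])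
  define s where "s n = q n + N" for n
  have s: "strict_mono s" using l(2) by (simp add: s_def strict_mono_def)
  have yq: "(\<lambda>n. y (q n)) \<longlonglongrightarrow> l" using l(3) by (simp add: o_def)
  have convs: "cconv (\<lambda>n x. w (s n) (round_mesh (h (s n)) x)) W" by (rule cconv_subseq[OF conv s])
  have \<psi>': "(\<lambda>n. \<psi> (z n)) \<longlonglongrightarrow> \<psi> z0" if "z \<longlonglongrightarrow> z0" for z z0
    by (rule continuous_on_tendsto_compose[OF \<psi> that]) auto
  \<comment> \<open>The maximizers are compared with the rounded points x n, which tend to x0; the
    quadratic term then forces l = x0.\<close>
  have "W x0 - (\<psi> x0 + (norm (x0 - x0))\<^sup>2) \<le> W l - (\<psi> l + (norm (l - x0))\<^sup>2)"
  proof (rule LIMSEQ_le)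
    have xs: "(\<lambda>n. x (s n)) \<longlonglongrightarrow> x0" using LIMSEQ_subseq_LIMSEQ[OF x(1) s] by (simp add: o_def)
    show "(\<lambda>n. ?f (s n) (x (s n))) \<longlonglongrightarrow> W x0 - (\<psi> x0 + (norm (x0 - x0))\<^sup>2)"
      by (intro tendsto_intros cconv_round_mesh[OF convs hp x(2) xs] \<psi>' xs)
    show "(\<lambda>n. ?f (s n) (y (q n))) \<longlonglongrightarrow> W l - (\<psi> l + (norm (l - x0))\<^sup>2)"
      using y(1) by (intro tendsto_intros cconv_round_mesh[OF convs hp _ yq] \<psi>' yq) (auto simp: s_def)
    show "\<exists>M. \<forall>n\<ge>M. ?f (s n) (x (s n)) \<le> ?f (s n) (y (q n))"
    proof (intro exI allI impI)
      fix n
      have "x (s n) \<in> mesh_lattice (h (s n)) \<inter> cball x0 r" using x(2) N[of "s n"] by (simp add: s_def)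
      then show "?f (s n) (x (s n)) \<le> ?f (s n) (y (q n))" using y(2)[of "x (s n)" "q n"] by (simp add: s_def)
    qed
  qed
  moreover have "(norm (x0 - x0))\<^sup>2 = 0" by simp
  ultimately have "(norm (l - x0))\<^sup>2 \<le> 0" using r(2)[OF l(1)] by linarith
  then have "l = x0" by simp
  then show ?thesis
    using that[of s "\<lambda>n. y (q n)"] s yq y by (simp add: s_def)
qed

lemma nhds_max_cball:
  fixes f :: "'a::metric_space \<Rightarrow> real"
  assumes "\<forall>\<^sub>F y in nhds x. f y \<le> b"
  shows "\<exists>r>0. \<forall>y\<in>cball x r. f y \<le> b"
proof -
  obtain d where d: "d > 0" "\<And>y. dist y x < d \<Longrightarrow> f y \<le> b"
    using assms unfolding eventually_nhds_metric by blast
  show ?thesis using d by (intro exI[of _ "d / 2"]) (auto simp: dist_commute)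
qed

lemma norm_square_has_derivative:
  "((\<lambda>y. \<sigma> * (norm (y - x0))\<^sup>2) has_derivative (\<lambda>w. ((2 * \<sigma>) *\<^sub>R (x - x0)) \<bullet> w)) (at x)"
  unfolding power2_norm_eq_inner
  by (auto intro!: derivative_eq_intros simp: inner_commute algebra_simps)

lemma test_function_continuous:
  assumes "test_function \<phi> g" shows "continuous_on UNIV g" "continuous_on UNIV \<phi>"
proof -
  show "continuous_on UNIV g" using assms by (simp add: test_function_def)
  have "(\<phi> has_derivative (\<lambda>w. g x \<bullet> w)) (at x)" for x using assms by (simp add: test_function_def)
  from has_derivative_continuous_on[OF this] show "continuous_on UNIV \<phi>" .
qed

context tonelli
begin

text \<open>For the subsolution test the inequality is free in the starting point, so a step is
  chosen whose velocity tends to the v conjugate to g x0; then g x0 . v - L x0 v equals H x0 (g x0).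
  For the supersolution test the tight step dictates a velocity that is merely bounded, and
  Fenchel's inequality eliminates it before the limit.\<close>

lemma discrete_limit_is_viscosity_solution:
  assumes h: "\<And>n. mesh_size (h n)" and \<tau>: "\<And>n. 0 < \<tau> n" "\<And>n. \<tau> n \<le> 1" "\<tau> \<longlonglongrightarrow> 0"
    and hC: "\<And>n. h n \<le> C * (\<tau> n)\<^sup>2" and C: "C > 0"
    and u: "\<And>n. discrete_weak_KAM L (h n) (\<tau> n) (c n) (u n)"
    and c: "c \<longlonglongrightarrow> c0"
    and conv: "cconv (\<lambda>n x. u n (round_mesh (h n) x)) U"
  shows "viscosity_solution H c0 U"
proof -
  have hp: "h n > 0" for n by (rule mesh_size_pos[OF h])
  have h0: "h \<longlonglongrightarrow> 0" by (rule mesh_sizes_tendsto_0[OF h \<tau>(3) hC])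
  obtain R where R: "R > 0"
    "\<And>n x y. x \<in> mesh_lattice (h n) \<Longrightarrow> y \<in> mesh_lattice (h n) \<Longrightarrow> tight_step L (\<tau> n) (c n) (u n) x y \<Longrightarrow>
      norm ((y - x) /\<^sub>R \<tau> n) \<le> R"
    using tight_velocity_bounded[of C] C h \<tau> hC u by (metis less_imp_le)
  have contU: "continuous_on UNIV U" by (rule cconv_continuous_on[OF conv])
  have perU: "periodic U"
    unfolding periodic_def
  proof (intro allI)
    fix x k
    have "u n (round_mesh (h n) (x + lattice_vec k)) = u n (round_mesh (h n) x)" for n
      by (simp add: round_mesh_shift[OF h] periodicD[OF discrete_weak_KAM_periodic[OF u]])
    then show "U (x + lattice_vec k) = U x"
      using cconvD[OF conv tendsto_const[of "x + lattice_vec k"]] cconvD[OF conv tendsto_const[of x]]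
        LIMSEQ_unique by fastforce
  qed
  \<comment> \<open>The quadratic term of \<open>mesh_maximizers\<close> enters with \<sigma> = 1 at
    maxima and \<sigma> = -1 at minima; its gradient vanishes in the limit because \<xi> tends to
    x0.\<close>
  have MVT: "\<exists>\<xi>. (\<phi> y + \<sigma> * (norm (y - x0))\<^sup>2) - (\<phi> x + \<sigma> * (norm (x - x0))\<^sup>2)
      = (g \<xi> + (2 * \<sigma>) *\<^sub>R (\<xi> - x0)) \<bullet> (y - x) \<and> norm (\<xi> - x) \<le> norm (y - x)"
    if "test_function \<phi> g" for \<phi> g \<sigma> x0 x y
  proof -
    have "((\<lambda>y. \<phi> y + \<sigma> * (norm (y - x0))\<^sup>2) has_derivative
        (\<lambda>w. (g x + (2 * \<sigma>) *\<^sub>R (x - x0)) \<bullet> w)) (at x)" for x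
      using has_derivative_add[OF _ norm_square_has_derivative, of \<phi> "\<lambda>w. g x \<bullet> w" x \<sigma> x0] that
      by (simp add: test_function_def inner_add_left)
    from gradient_mean_value[OF this] show ?thesis by metis
  qed
  have sub: "H x0 (g x0) \<le> c0"
    if \<phi>: "test_function \<phi> g" and max: "\<forall>\<^sub>F y in nhds x0. U y - \<phi> y \<le> U x0 - \<phi> x0" for \<phi> g x0
  proof -
    have cont: "continuous_on UNIV g" "continuous_on UNIV \<phi>"
      using test_function_continuous[OF \<phi>] by auto
    from nhds_max_cball[OF max]
    obtain r where r: "r > 0" "\<And>y. y \<in> cball x0 r \<Longrightarrow> U y - \<phi> y \<le> U x0 - \<phi> x0" by blast
    obtain s y where s: "strict_mono (s :: nat \<Rightarrow> nat)" and y: "y \<longlonglongrightarrow> x0" "\<And>n. y n \<in> mesh_lattice (h (s n))"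
      "\<And>n z. z \<in> mesh_lattice (h (s n)) \<Longrightarrow> z \<in> cball x0 r \<Longrightarrow>
       u (s n) z - (\<phi> z + (norm (z - x0))\<^sup>2) \<le> u (s n) (y n) - (\<phi> (y n) + (norm (y n - x0))\<^sup>2)"
      by (rule mesh_maximizers[OF h h0 conv cont(2) r]) blast+
    have \<tau>s: "(\<lambda>n. \<tau> (s n)) \<longlonglongrightarrow> 0" and cs: "(\<lambda>n. c (s n)) \<longlonglongrightarrow> c0" and hs: "(\<lambda>n. h (s n)) \<longlonglongrightarrow> 0"
      using LIMSEQ_subseq_LIMSEQ[OF _ s] \<tau>(3) c h0 by (auto simp: o_def)
    obtain v where v: "opt x0 v (g x0)" by (rule opt_exists_velocity)
    \<comment> \<open>The predecessor with velocity v, rounded to the mesh; the resulting velocity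
      error is of order h / \<tau>, hence at most of order \<tau>.\<close>
    define x where "x n = round_mesh (h (s n)) (y n - \<tau> (s n) *\<^sub>R v)" for n
    define V where "V n = (y n - x n) /\<^sub>R \<tau> (s n)" for n
    have x: "x \<longlonglongrightarrow> x0"
    proof -
      have "(\<lambda>n. y n - \<tau> (s n) *\<^sub>R v) \<longlonglongrightarrow> x0 - 0 *\<^sub>R v" by (intro tendsto_intros y \<tau>s)
      then show ?thesis unfolding x_def [abs_def] by (intro tendsto_round_mesh hp hs) simp
    qed
    have xm: "x n \<in> mesh_lattice (h (s n))" for n by (simp add: x_def round_mesh_in)
    have V: "V \<longlonglongrightarrow> v"
    proof -
      have "(\<lambda>n. V n - v) \<longlonglongrightarrow> 0"
      proof (rule Lim_null_comparison[OF always_eventually])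
        show "\<forall>n. norm (V n - v) \<le> CARD('d) * C * \<tau> (s n)"
        proof
          fix n
          let ?t = "\<tau> (s n)"
          have "V n - v = - (x n - (y n - ?t *\<^sub>R v)) /\<^sub>R ?t"
            using \<tau>(1)[of "s n"] by (simp add: V_def algebra_simps)
          then have "norm (V n - v) = norm (x n - (y n - ?t *\<^sub>R v)) / ?t"
            using \<tau>(1)[of "s n"] by (simp only: norm_scaleR norm_minus_cancel) (simp add: divide_inverse mult.commute)
          also have "\<dots> \<le> (CARD('d) * (C * ?t\<^sup>2)) / ?t"
            using order_trans[OF norm_round_mesh[OF hp] mult_left_mono[OF hC], of "s n" "y n - ?t *\<^sub>R v"] \<tau>(1)[of "s n"]
            by (intro divide_right_mono) (auto simp: x_def)
          also have "\<dots> = CARD('d) * C * ?t" using \<tau>(1)[of "s n"] by (simp add: power2_eq_square)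
          finally show "norm (V n - v) \<le> CARD('d) * C * ?t" .
        qed
        show "(\<lambda>n. CARD('d) * C * \<tau> (s n)) \<longlonglongrightarrow> 0" by (rule tendsto_mult_right_zero[OF \<tau>s])
      qed
      then show ?thesis by (simp add: LIM_zero_iff)
    qed
    have "\<forall>n. \<exists>z. (\<phi> (y n) + 1 * (norm (y n - x0))\<^sup>2) - (\<phi> (x n) + 1 * (norm (x n - x0))\<^sup>2)
      = (g z + (2 * 1) *\<^sub>R (z - x0)) \<bullet> (y n - x n) \<and> norm (z - x n) \<le> norm (y n - x n)"
      by (intro allI MVT \<phi>)
    from choice[OF this] obtain \<xi> where \<xi>: "\<And>n. (\<phi> (y n) + 1 * (norm (y n - x0))\<^sup>2) - (\<phi> (x n) + 1 * (norm (x n - x0))\<^sup>2)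
      = (g (\<xi> n) + (2 * 1) *\<^sub>R (\<xi> n - x0)) \<bullet> (y n - x n)"
      "\<And>n. norm (\<xi> n - x n) \<le> norm (y n - x n)" by (elim exE) simp
    have "\<xi> \<longlonglongrightarrow> x0"
    proof -
      have "(\<lambda>n. norm (y n - x n)) \<longlonglongrightarrow> 0" using tendsto_norm[OF tendsto_diff[OF y(1) x]] by simp
      from Lim_null_comparison[OF always_eventually this, of "\<lambda>n. \<xi> n - x n"] \<xi>(2)
      have "(\<lambda>n. \<xi> n - x n) \<longlonglongrightarrow> 0" by simp
      from tendsto_add[OF this x] show ?thesis by simp
    qed
    have "g x0 \<bullet> v \<le> L x0 v + c0"
    proof (rule tendsto_le[OF sequentially_bot])
      show "(\<lambda>n. L (x n) (V n) + c (s n)) \<longlonglongrightarrow> L x0 v + c0" by (intro tendsto_add tendsto_L x V cs)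
      have "(\<lambda>n. (g (\<xi> n) + (2 * 1) *\<^sub>R (\<xi> n - x0)) \<bullet> V n) \<longlonglongrightarrow> (g x0 + (2 * 1) *\<^sub>R (x0 - x0)) \<bullet> v"
        by (intro tendsto_intros V \<open>\<xi> \<longlonglongrightarrow> x0\<close> continuous_on_tendsto_compose[OF cont(1)]) auto
      then show "(\<lambda>n. (g (\<xi> n) + (2 * 1) *\<^sub>R (\<xi> n - x0)) \<bullet> V n) \<longlonglongrightarrow> g x0 \<bullet> v" by simp
      have "\<forall>\<^sub>F n in sequentially. x n \<in> cball x0 r"
        using tendstoD[OF x r(1)] by eventually_elim (simp add: dist_commute)
      then show "\<forall>\<^sub>F n in sequentially. (g (\<xi> n) + (2 * 1) *\<^sub>R (\<xi> n - x0)) \<bullet> V n \<le> L (x n) (V n) + c (s n)"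
      proof eventually_elim
        case (elim n)
        have "y n - x n = \<tau> (s n) *\<^sub>R V n" using \<tau>(1)[of "s n"] by (simp add: V_def)
        then have "\<tau> (s n) * ((g (\<xi> n) + (2 * 1) *\<^sub>R (\<xi> n - x0)) \<bullet> V n)
            = (\<phi> (y n) + 1 * (norm (y n - x0))\<^sup>2) - (\<phi> (x n) + 1 * (norm (x n - x0))\<^sup>2)"
          using \<xi>(1)[of n] by simp
        also have "\<dots> \<le> u (s n) (y n) - u (s n) (x n)" using y(3)[OF xm elim] by simp
        also have "\<dots> \<le> \<tau> (s n) * (L (x n) (V n) + c (s n))"
          using discrete_weak_KAM_le[OF u xm y(2), of n] by (simp add: V_def)
        finally show ?case using \<tau>(1)[of "s n"] by simp
      qed
    qed
    then show ?thesis using opt_L[OF v] by simp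
  qed
  have super: "H x0 (g x0) \<ge> c0"
    if \<phi>: "test_function \<phi> g" and min: "\<forall>\<^sub>F y in nhds x0. U y - \<phi> y \<ge> U x0 - \<phi> x0" for \<phi> g x0
  proof -
    have cont: "continuous_on UNIV g" "continuous_on UNIV \<phi>"
      using test_function_continuous[OF \<phi>] by auto
    have "\<forall>\<^sub>F y in nhds x0. (- U y) - (- \<phi> y) \<le> (- U x0) - (- \<phi> x0)"
      using min by eventually_elim simp
    from nhds_max_cball[OF this]
    obtain r where r: "r > 0" "\<And>y. y \<in> cball x0 r \<Longrightarrow> (- U y) - (- \<phi> y) \<le> (- U x0) - (- \<phi> x0)"
      by blast
    \<comment> \<open>Minima of U - \<phi> are maxima of the negatives, so the lemma on maximizers
      applies again.\<close>
    have conv': "cconv (\<lambda>n x. - u n (round_mesh (h n) x)) (\<lambda>x. - U x)"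
      using conv unfolding cconv_def by (auto intro: tendsto_minus)
    obtain s y where s: "strict_mono (s :: nat \<Rightarrow> nat)" and y: "y \<longlonglongrightarrow> x0" "\<And>n. y n \<in> mesh_lattice (h (s n))"
      "\<And>n z. z \<in> mesh_lattice (h (s n)) \<Longrightarrow> z \<in> cball x0 r \<Longrightarrow>
       - u (s n) z - (- \<phi> z + (norm (z - x0))\<^sup>2) \<le> - u (s n) (y n) - (- \<phi> (y n) + (norm (y n - x0))\<^sup>2)"
      by (rule mesh_maximizers[OF h h0 conv' continuous_on_minus[OF cont(2)] r]) blast+
    have \<tau>s: "(\<lambda>n. \<tau> (s n)) \<longlonglongrightarrow> 0" and cs: "(\<lambda>n. c (s n)) \<longlonglongrightarrow> c0"
      using LIMSEQ_subseq_LIMSEQ[OF _ s] \<tau>(3) c by (auto simp: o_def)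
    have "\<forall>n. \<exists>x. x \<in> mesh_lattice (h (s n)) \<and> tight_step L (\<tau> (s n)) (c (s n)) (u (s n)) x (y n)"
      using discrete_weak_KAM_tight[OF u y(2)] by blast
    then obtain x where x: "\<And>n. x n \<in> mesh_lattice (h (s n))"
      "\<And>n. tight_step L (\<tau> (s n)) (c (s n)) (u (s n)) (x n) (y n)" by metis
    define V where "V n = (y n - x n) /\<^sub>R \<tau> (s n)" for n
    have V: "norm (V n) \<le> R" for n unfolding V_def by (rule R(2)[OF x(1) y(2) x(2)])
    have yx: "y n - x n = \<tau> (s n) *\<^sub>R V n" for n using \<tau>(1)[of "s n"] by (simp add: V_def)
    have yx0: "(\<lambda>n. y n - x n) \<longlonglongrightarrow> 0"
    proof (rule Lim_null_comparison[OF always_eventually])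
      show "\<forall>n. norm (y n - x n) \<le> \<tau> (s n) * R"
        using V \<tau>(1) by (simp add: yx less_imp_le)
      show "(\<lambda>n. \<tau> (s n) * R) \<longlonglongrightarrow> 0" by (rule tendsto_mult_left_zero[OF \<tau>s])
    qed
    from tendsto_diff[OF y(1) this] have xl: "x \<longlonglongrightarrow> x0" by simp
    have "\<forall>n. \<exists>z. (\<phi> (y n) + (-1) * (norm (y n - x0))\<^sup>2) - (\<phi> (x n) + (-1) * (norm (x n - x0))\<^sup>2)
      = (g z + (2 * (-1)) *\<^sub>R (z - x0)) \<bullet> (y n - x n) \<and> norm (z - x n) \<le> norm (y n - x n)"
      by (intro allI MVT \<phi>)
    from choice[OF this] obtain \<xi> where \<xi>: "\<And>n. (\<phi> (y n) + (-1) * (norm (y n - x0))\<^sup>2) - (\<phi> (x n) + (-1) * (norm (x n - x0))\<^sup>2)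
      = (g (\<xi> n) + (2 * (-1)) *\<^sub>R (\<xi> n - x0)) \<bullet> (y n - x n)"
      "\<And>n. norm (\<xi> n - x n) \<le> norm (y n - x n)" by (elim exE) simp
    have "\<xi> \<longlonglongrightarrow> x0"
    proof -
      from Lim_null_comparison[OF always_eventually tendsto_norm_zero[OF yx0], of "\<lambda>n. \<xi> n - x n"] \<xi>(2)
      have "(\<lambda>n. \<xi> n - x n) \<longlonglongrightarrow> 0" by simp
      from tendsto_add[OF this xl] show ?thesis by simp
    qed
    \<comment> \<open>These momenta converge even though the velocities V n may not; the test values
      differ over a tight step by \<tau> times G n . V n.\<close>
    define G where "G n = g (\<xi> n) + (2 * (-1)) *\<^sub>R (\<xi> n - x0)" for n
    have "G \<longlonglongrightarrow> g x0 + (2 * (-1)) *\<^sub>R (x0 - x0)"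
      unfolding G_def [abs_def]
      by (intro tendsto_intros \<open>\<xi> \<longlonglongrightarrow> x0\<close> continuous_on_tendsto_compose[OF cont(1)]) auto
    then have G: "G \<longlonglongrightarrow> g x0" by simp
    show "c0 \<le> H x0 (g x0)"
    proof (rule tendsto_le[OF sequentially_bot tendsto_H[OF xl G] cs])
      have "\<forall>\<^sub>F n in sequentially. x n \<in> cball x0 r"
        using tendstoD[OF xl r(1)] by eventually_elim (simp add: dist_commute)
      then show "\<forall>\<^sub>F n in sequentially. c (s n) \<le> H (x n) (G n)"
      proof eventually_elim
        case (elim n)
        have "\<tau> (s n) * (L (x n) (V n) + c (s n)) = u (s n) (y n) - u (s n) (x n)"
          using x(2)[of n] by (simp add: tight_step_def V_def)
        also have "\<dots> \<le> (\<phi> (y n) + (-1) * (norm (y n - x0))\<^sup>2) - (\<phi> (x n) + (-1) * (norm (x n - x0))\<^sup>2)"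
          using y(3)[OF x(1) elim] by simp
        also have "\<dots> = \<tau> (s n) * (G n \<bullet> V n)" unfolding \<xi>(1) by (simp add: G_def yx)
        finally have "L (x n) (V n) + c (s n) \<le> G n \<bullet> V n" using \<tau>(1)[of "s n"] by simp
        then show ?case using fenchel[of "G n" "V n" "x n"] by simp
      qed
    qed
  qed
  show ?thesis
    unfolding viscosity_solution_def viscosity_subsolution_def viscosity_supersolution_def
    using perU contU sub super by (intro conjI allI impI) (elim conjE; assumption | blast)+
qed

end

section \<open>Limits of calibrated chains\<close>

lemma cconv_compose:
  fixes F :: "nat \<Rightarrow> 'b::topological_space \<Rightarrow> 'c::topological_space" and G :: "nat \<Rightarrow> 'a::topological_space \<Rightarrow> 'b"
  assumes "cconv F f" "cconv G g" shows "cconv (\<lambda>n t. F n (G n t)) (\<lambda>t. f (g t))"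
  unfolding cconv_def
proof
  fix t :: 'a
  have "filterlim (\<lambda>z. (fst z, G (fst z) (snd z))) (sequentially \<times>\<^sub>F nhds (g t)) (sequentially \<times>\<^sub>F nhds t)"
    using assms(2) unfolding cconv_def by (intro filterlim_Pair filterlim_fst) auto
  from filterlim_compose[OF assms(1)[unfolded cconv_def, rule_format, of "g t"] this]
  show "((\<lambda>z. F (fst z) (G (fst z) (snd z))) \<longlongrightarrow> f (g t)) (sequentially \<times>\<^sub>F nhds t)" by simp
qed

lemma lipschitz_imp_absolutely_continuous_curve_on:
  fixes \<gamma> :: "real \<Rightarrow> 'b::real_normed_vector"
  assumes lip: "\<And>s t. norm (\<gamma> t - \<gamma> s) \<le> K * \<bar>t - s\<bar>"
  shows "absolutely_continuous_curve_on a b \<gamma>"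
  unfolding absolutely_continuous_curve_on_def
proof (intro allI impI)
  fix \<epsilon> :: real assume "\<epsilon> > 0"
  define M where "M = \<bar>K\<bar> + 1"
  have M: "M > 0" "K \<le> M" by (auto simp: M_def)
  have "(\<Sum>i<n. norm (\<gamma> (t i) - \<gamma> (s i))) < \<epsilon>"
    if st: "\<forall>i<n. a \<le> s i \<and> s i \<le> t i \<and> t i \<le> b" and small: "(\<Sum>i<n. t i - s i) < \<epsilon> / M"
    for n :: nat and s t
  proof -
    have "(\<Sum>i<n. norm (\<gamma> (t i) - \<gamma> (s i))) \<le> (\<Sum>i<n. M * (t i - s i))"
    proof (rule sum_mono)
      fix i assume "i \<in> {..<n}"
      then have "s i \<le> t i" using st by simp
      then show "norm (\<gamma> (t i) - \<gamma> (s i)) \<le> M * (t i - s i)"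
        using lip[of "t i" "s i"] mult_right_mono[OF M(2), of "t i - s i"] by simp
    qed
    also have "\<dots> = M * (\<Sum>i<n. t i - s i)" by (simp add: sum_distrib_left)
    also have "\<dots> < \<epsilon>" using small M by (simp add: field_simps)
    finally show ?thesis .
  qed
  then show "\<exists>\<delta>>0. \<forall>(n::nat) s t. (\<forall>i<n. a \<le> s i \<and> s i \<le> t i \<and> t i \<le> b) \<and>
        disjoint_family_on (\<lambda>i. {s i<..<t i}) {..<n} \<and> (\<Sum>i<n. t i - s i) < \<delta> \<longrightarrow>
        (\<Sum>i<n. norm (\<gamma> (t i) - \<gamma> (s i))) < \<epsilon>"
    using \<open>\<epsilon> > 0\<close> M(1) by (intro exI[of _ "\<epsilon> / M"]) auto
qed

text \<open>Allows the normalization u 0 = 0, which supplies the boundedness that compactness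
  requires.\<close>

lemma discrete_weak_KAM_add_const:
  "discrete_weak_KAM L h \<tau> c u \<Longrightarrow> discrete_weak_KAM L h \<tau> c (\<lambda>x. u x - b)"
  unfolding discrete_weak_KAM_def periodic_def by (auto simp: algebra_simps)

context tonelli
begin

text \<open>A pointwise derivative of u along the curve replaces a limit of discrete actions;
  calibration on every interval is then the fundamental theorem of calculus.\<close>

lemma calibratedI:
  assumes \<gamma>: "\<And>t. (\<gamma> has_vector_derivative V t) (at t)" and V: "continuous_on UNIV V"
    and lip: "\<And>s t. norm (\<gamma> t - \<gamma> s) \<le> K * \<bar>t - s\<bar>"
    and u: "\<And>t. ((\<lambda>t. u (\<gamma> t)) has_vector_derivative L (\<gamma> t) (V t) + c) (at t)"
  shows "calibrated u L c \<gamma>"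
  unfolding calibrated_def
proof (intro allI impI conjI)
  fix a b :: real assume "a \<le> b"
  have vd: "vector_derivative \<gamma> (at s) = V s" for s by (rule vector_derivative_at[OF \<gamma>])
  have c\<gamma>: "continuous_on UNIV \<gamma>"
    using \<gamma> has_vector_derivative_continuous continuous_at_imp_continuous_on by blast
  have cL: "continuous_on {a..b} (\<lambda>s. L (\<gamma> s) (V s))"
    unfolding continuous_on_def using c\<gamma> V
    by (auto simp: continuous_on_def intro!: tendsto_L intro: tendsto_within_subset)
  show "absolutely_continuous_curve_on a b \<gamma>"
    by (rule lipschitz_imp_absolutely_continuous_curve_on[OF lip])
  show "(\<lambda>s. L (\<gamma> s) (vector_derivative \<gamma> (at s))) absolutely_integrable_on {a..b}"
    unfolding vd by (rule absolutely_integrable_continuous_real[OF cL])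
  have "((\<lambda>s. L (\<gamma> s) (V s) + c) has_integral (u (\<gamma> b) - u (\<gamma> a))) {a..b}"
    by (rule fundamental_theorem_of_calculus[OF \<open>a \<le> b\<close>])
      (rule has_vector_derivative_at_within[OF u])
  moreover have "((\<lambda>s. L (\<gamma> s) (V s) + c) has_integral
      (integral {a..b} (\<lambda>s. L (\<gamma> s) (V s)) + c * (b - a))) {a..b}"
    using has_integral_add[OF integrable_integral[OF integrable_continuous_real[OF cL]]
        has_integral_const_real[of c a b]] \<open>a \<le> b\<close> by (simp add: mult.commute)
  ultimately show "u (\<gamma> b) - u (\<gamma> a) =
      integral {a..b} (\<lambda>s. L (\<gamma> s) (vector_derivative \<gamma> (at s))) + c * (b - a)"
    unfolding vd by (rule has_integral_unique)
qed

text \<open>The velocities are equi-Lipschitz by the discrete Euler--Lagrange inequality, so they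
  converge together with the positions: the limit velocity is the velocity of the limit curve.\<close>

lemma limit_of_tight_paths:
  assumes h: "\<And>n. mesh_size (h n)" and \<tau>: "\<And>n. 0 < \<tau> n" "\<tau> \<longlonglongrightarrow> 0"
    and hC: "\<And>n. h n \<le> C * (\<tau> n)\<^sup>2" and C: "C > 0"
    and path: "\<And>n u c. discrete_weak_KAM L (h n) (\<tau> n) c u \<Longrightarrow> \<exists>X :: int \<Rightarrow> real^'d.
      X 0 = x n \<and> (X 1 - X 0) /\<^sub>R \<tau> n = v n \<and> (\<forall>k. X k \<in> mesh_lattice (h n)) \<and>
      (\<forall>k. tight_step L (\<tau> n) c u (X k) (X (k + 1)))"
    and x: "x \<longlonglongrightarrow> x0" and v: "v \<longlonglongrightarrow> v0"
    and small: "\<And>n. \<tau> n \<le> 1"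
    and B: "B > 0" "\<And>n c u x y z. discrete_weak_KAM L (h n) (\<tau> n) c u \<Longrightarrow>
      x \<in> mesh_lattice (h n) \<Longrightarrow> y \<in> mesh_lattice (h n) \<Longrightarrow> z \<in> mesh_lattice (h n) \<Longrightarrow>
      tight_step L (\<tau> n) c u x y \<Longrightarrow> tight_step L (\<tau> n) c u y z \<Longrightarrow>
      norm ((z - y) /\<^sub>R \<tau> n - (y - x) /\<^sub>R \<tau> n) \<le> B * \<tau> n"
  shows "(x0, v0) \<in> mane_set H"
proof -
  let ?d = "real CARD('d)"
  have hp: "h n > 0" "h n \<le> 1" for n using h[of n] by (auto simp: mesh_size_def)
  have h0: "h \<longlonglongrightarrow> 0" by (rule mesh_sizes_tendsto_0[OF h \<tau>(2) hC])
  \<comment> \<open>Solutions are chosen before the paths: \<open>path\<close> is available for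
    every discrete weak KAM solution, so the u n along which the chains are tight are also the ones
    that converge to U.\<close>
  have "\<forall>n. \<exists>p. discrete_weak_KAM L (h n) (\<tau> n) (snd p) (fst p) \<and> fst p 0 = 0"
  proof
    fix n
    obtain u c where "discrete_weak_KAM L (h n) (\<tau> n) c u" by (rule discrete_weak_KAM_exists[OF h \<tau>(1)])
    from discrete_weak_KAM_add_const[OF this, of "u 0"]
    show "\<exists>p. discrete_weak_KAM L (h n) (\<tau> n) (snd p) (fst p) \<and> fst p 0 = 0"
      by (intro exI[of _ "(\<lambda>x. u x - u 0, c)"]) simp
  qed
  from choice[OF this] obtain p where p: "\<And>n. discrete_weak_KAM L (h n) (\<tau> n) (snd (p n)) (fst (p n))"
    "\<And>n. fst (p n) 0 = 0" by blast
  define u where "u n = fst (p n)" for n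
  define c where "c n = snd (p n)" for n
  have u: "discrete_weak_KAM L (h n) (\<tau> n) (c n) (u n)" "u n 0 = 0" for n
    using p by (auto simp: u_def c_def)
  have "\<forall>n. \<exists>X :: int \<Rightarrow> real^'d. X 0 = x n \<and> (X 1 - X 0) /\<^sub>R \<tau> n = v n \<and>
      (\<forall>k. X k \<in> mesh_lattice (h n)) \<and> (\<forall>k. tight_step L (\<tau> n) (c n) (u n) (X k) (X (k + 1)))"
    by (intro allI path u(1))
  from choice[OF this] obtain X where X: "\<And>n. X n 0 = x n"
    "\<And>n. (X n 1 - X n 0) /\<^sub>R \<tau> n = v n" "\<And>n k. X n k \<in> mesh_lattice (h n)"
    "\<And>n k::int. tight_step L (\<tau> n) (c n) (u n) (X n k) (X n (k + 1))" by blast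
  define V where "V n k = (X n (k + 1) - X n k) /\<^sub>R \<tau> n" for n k
  have stepX: "X n (k + 1) = X n k + \<tau> n *\<^sub>R V n k" for n k
    using \<tau>(1)[of n] by (simp add: V_def)
  obtain R where R: "R > 0"
    "\<And>h \<tau> c u x y. mesh_size h \<Longrightarrow> 0 < \<tau> \<Longrightarrow> \<tau> \<le> 1 \<Longrightarrow> h \<le> C * \<tau>\<^sup>2 \<Longrightarrow> discrete_weak_KAM L h \<tau> c u \<Longrightarrow>
      x \<in> mesh_lattice h \<Longrightarrow> y \<in> mesh_lattice h \<Longrightarrow> tight_step L \<tau> c u x y \<Longrightarrow> norm ((y - x) /\<^sub>R \<tau>) \<le> R"
    using tight_velocity_bounded[OF less_imp_le[OF C]] by blast
  obtain K where K: "K \<ge> 0"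
    "\<And>h \<tau> c u x y. mesh_size h \<Longrightarrow> 0 < \<tau> \<Longrightarrow> \<tau> \<le> 1 \<Longrightarrow> h \<le> C * \<tau>\<^sup>2 \<Longrightarrow> discrete_weak_KAM L h \<tau> c u \<Longrightarrow>
      x \<in> mesh_lattice h \<Longrightarrow> y \<in> mesh_lattice h \<Longrightarrow> u y - u x \<le> K * (norm (y - x) + \<tau>)"
    using discrete_weak_KAM_approx_lipschitz[OF less_imp_le[OF C]] by blast
  obtain Bc where Bc: "Bc \<ge> 0"
    "\<And>h \<tau> c u. mesh_size h \<Longrightarrow> \<tau> > 0 \<Longrightarrow> discrete_weak_KAM L h \<tau> c u \<Longrightarrow> \<bar>c\<bar> \<le> Bc"
    using discrete_critical_value_bounded by blast
  have VR: "norm (V n k) \<le> R" for n k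
    unfolding V_def by (rule R(2)[OF h \<tau>(1) small hC u(1) X(3) X(3) X(4)])
  \<comment> \<open>Velocities and positions as step functions of continuous time, and u n extended
    in space by rounding.\<close>
  define F1 where "F1 n t = V n \<lfloor>t / \<tau> n\<rfloor>" for n t
  define F2 where "F2 n y = u n (round_mesh (h n) y)" for n y
  define F3 where "F3 n t = X n \<lfloor>t / \<tau> n\<rfloor>" for n t
  have F1: "norm (F1 n t - F1 n s) \<le> B * norm (t - s) + B * \<tau> n" for n t s
  proof -
    have "norm (V n (k + 1) - V n k) \<le> B * \<tau> n" for k
      unfolding V_def using B(2)[OF u(1) X(3) X(3) X(3) X(4) X(4)] by simp
    from int_path_lipschitz[of "V n", OF this]
    have "norm (F1 n t - F1 n s) \<le> B * (\<tau> n * \<bar>real_of_int (\<lfloor>t / \<tau> n\<rfloor> - \<lfloor>s / \<tau> n\<rfloor>)\<bar>)"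
      by (simp add: F1_def mult.assoc)
    also have "\<dots> \<le> B * (\<bar>t - s\<bar> + \<tau> n)"
      using floor_time_diff[OF \<tau>(1)] B(1) by (intro mult_left_mono) auto
    finally show ?thesis by (simp add: distrib_left)
  qed
  have F3: "norm (F3 n t - F3 n s) \<le> R * norm (t - s) + R * \<tau> n" for n t s
  proof -
    have "norm (X n (k + 1) - X n k) \<le> R * \<tau> n" for k
      using VR[of n k] \<tau>(1)[of n] by (simp add: stepX mult.commute)
    from int_path_lipschitz[of "X n", OF this]
    have "norm (F3 n t - F3 n s) \<le> R * (\<tau> n * \<bar>real_of_int (\<lfloor>t / \<tau> n\<rfloor> - \<lfloor>s / \<tau> n\<rfloor>)\<bar>)"
      by (simp add: F3_def mult.assoc)
    also have "\<dots> \<le> R * (\<bar>t - s\<bar> + \<tau> n)"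
      using floor_time_diff[OF \<tau>(1)] R(1) by (intro mult_left_mono) auto
    finally show ?thesis by (simp add: distrib_left)
  qed
  have F2: "norm (F2 n y - F2 n z) \<le> K * norm (y - z) + K * (2 * ?d * h n + \<tau> n)" for n y z
  proof -
    have *: "F2 n y - F2 n z \<le> K * norm (y - z) + K * (2 * ?d * h n + \<tau> n)" for y z
    proof -
      let ?y = "round_mesh (h n) y" let ?z = "round_mesh (h n) z"
      have "?y - ?z = (?y - y) + (y - z) - (?z - z)" by simp
      also have "norm \<dots> \<le> norm (?y - y) + norm (y - z) + norm (?z - z)"
        by (intro order_trans[OF norm_triangle_ineq4] add_right_mono norm_triangle_ineq)
      also have "\<dots> \<le> ?d * h n + norm (y - z) + ?d * h n"
        by (intro add_mono norm_round_mesh hp order_refl)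
      finally have "norm (?y - ?z) + \<tau> n \<le> norm (y - z) + 2 * ?d * h n + \<tau> n"
        by (simp add: algebra_simps)
      from mult_left_mono[OF this K(1)]
      have "K * (norm (?y - ?z) + \<tau> n) \<le> K * (norm (y - z) + 2 * ?d * h n + \<tau> n)" .
      then show ?thesis
        using K(2)[OF h \<tau>(1) small hC u(1) round_mesh_in round_mesh_in, of n y z]
        by (simp add: F2_def distrib_left)
    qed
    show ?thesis using *[of y z] *[of z y] by (simp add: norm_minus_commute abs_le_iff)
  qed
  have e1: "(\<lambda>n. B * \<tau> n) \<longlonglongrightarrow> 0" by (rule tendsto_mult_right_zero[OF \<tau>(2)])
  have bd1: "\<exists>M. \<forall>n. norm (F1 n t) \<le> M" for t using VR by (auto simp: F1_def)
  obtain r1 where "\<exists>f1. strict_mono r1 \<and> cconv (\<lambda>n. F1 (r1 n)) f1 \<and> (\<forall>s t. norm (f1 s - f1 t) \<le> B * norm (s - t))"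
    using approx_lipschitz_compactness[OF e1 F1 bd1] ..
  then obtain f1 where "strict_mono r1 \<and> cconv (\<lambda>n. F1 (r1 n)) f1 \<and> (\<forall>s t. norm (f1 s - f1 t) \<le> B * norm (s - t))" ..
  then have r1: "strict_mono r1" "cconv (\<lambda>n. F1 (r1 n)) f1" by auto
  have e2: "(\<lambda>n. K * (2 * ?d * h (r1 n) + \<tau> (r1 n))) \<longlonglongrightarrow> 0"
  proof -
    have "(\<lambda>n. h (r1 n)) \<longlonglongrightarrow> 0" "(\<lambda>n. \<tau> (r1 n)) \<longlonglongrightarrow> 0"
      using LIMSEQ_subseq_LIMSEQ[OF _ r1(1)] h0 \<tau>(2) by (auto simp: o_def)
    then have "(\<lambda>n. K * (2 * ?d * h (r1 n) + \<tau> (r1 n))) \<longlonglongrightarrow> K * (2 * ?d * 0 + 0)"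
      by (intro tendsto_intros)
    then show ?thesis by simp
  qed
  have bd2: "\<exists>M. \<forall>n. norm (F2 (r1 n) y) \<le> M" for y
  proof (intro exI allI)
    fix n
    have "round_mesh (h n) (0 :: real^'d) = 0" for n
      using round_mesh_id[OF hp(1)] zero_in_grid[OF h] grid_subset_mesh_lattice by blast
    then have "F2 n 0 = 0" for n using u(2) by (simp add: F2_def)
    then have "norm (F2 (r1 n) y) \<le> K * norm y + K * (2 * ?d * h (r1 n) + \<tau> (r1 n))"
      using F2[of "r1 n" y 0] by simp
    also have "\<dots> \<le> K * norm y + K * (2 * ?d * 1 + 1)"
      using K(1) hp(2) small by (intro add_mono mult_left_mono) auto
    finally show "norm (F2 (r1 n) y) \<le> K * norm y + K * (2 * ?d * 1 + 1)" .
  qed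
  obtain r2 where "\<exists>U. strict_mono r2 \<and> cconv (\<lambda>n. F2 (r1 (r2 n))) U \<and> (\<forall>s t. norm (U s - U t) \<le> K * norm (s - t))"
    using approx_lipschitz_compactness[OF e2 F2 bd2] ..
  then obtain U where "strict_mono r2 \<and> cconv (\<lambda>n. F2 (r1 (r2 n))) U \<and> (\<forall>s t. norm (U s - U t) \<le> K * norm (s - t))" ..
  then have r2: "strict_mono r2" "cconv (\<lambda>n. F2 (r1 (r2 n))) U" by auto
  define q where "q n = r1 (r2 n)" for n
  have q: "strict_mono q" using r1(1) r2(1) by (simp add: q_def strict_mono_def)
  have e3: "(\<lambda>n. R * \<tau> (q n)) \<longlonglongrightarrow> 0"
    using tendsto_mult_right_zero[OF LIMSEQ_subseq_LIMSEQ[OF \<tau>(2) q]] by (simp add: o_def)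
  have bd3: "\<exists>M. \<forall>n. norm (F3 (q n) t) \<le> M" for t
  proof -
    have "Bseq x" using x convergent_imp_Bseq convergentI by blast
    then obtain M where M: "\<And>n. norm (x n) \<le> M" using BseqE by metis
    have "norm (F3 n t) \<le> M + (R * norm t + R)" for n
    proof -
      have "norm (F3 n t) \<le> norm (F3 n 0) + norm (F3 n t - F3 n 0)" by (rule norm_triangle_sub)
      also have "\<dots> \<le> M + (R * norm t + R * \<tau> n)"
        using F3[of n t 0] M[of n] by (simp add: F3_def X(1))
      also have "\<dots> \<le> M + (R * norm t + R)"
        using small[of n] R(1) by simp
      finally show ?thesis .
    qed
    then show ?thesis by blast
  qed
  obtain r3 where "\<exists>\<gamma>. strict_mono r3 \<and> cconv (\<lambda>n. F3 (q (r3 n))) \<gamma> \<and> (\<forall>s t. norm (\<gamma> s - \<gamma> t) \<le> R * norm (s - t))"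
    using approx_lipschitz_compactness[OF e3 F3 bd3] ..
  then obtain \<gamma> where "strict_mono r3 \<and> cconv (\<lambda>n. F3 (q (r3 n))) \<gamma> \<and> (\<forall>s t. norm (\<gamma> s - \<gamma> t) \<le> R * norm (s - t))" ..
  then have r3: "strict_mono r3" "cconv (\<lambda>n. F3 (q (r3 n))) \<gamma>" and lip: "\<And>s t. norm (\<gamma> s - \<gamma> t) \<le> R * norm (s - t)"
    by auto
  have mem: "\<forall>n. c (q (r3 n)) \<in> {- Bc..Bc}"
    using Bc(2)[OF h \<tau>(1) u(1)] by (auto simp: abs_le_iff minus_le_iff)
  obtain c0 r4 where r4: "strict_mono r4" "((\<lambda>n. c (q (r3 n))) \<circ> r4) \<longlonglongrightarrow> c0"
    by (rule seq_compactE[OF compact_imp_seq_compact[OF compact_Icc] mem])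
  define r where "r n = q (r3 (r4 n))" for n
  have r: "strict_mono r" using q r3(1) r4(1) by (simp add: r_def strict_mono_def)
  have conv1: "cconv (\<lambda>n. F1 (r n)) f1"
    using cconv_subseq[OF r1(2), of "\<lambda>n. r2 (r3 (r4 n))"] r2(1) r3(1) r4(1)
    by (simp add: r_def q_def strict_mono_def)
  have conv2: "cconv (\<lambda>n. F2 (r n)) U"
    using cconv_subseq[OF r2(2), of "\<lambda>n. r3 (r4 n)"] r3(1) r4(1)
    by (simp add: r_def q_def strict_mono_def)
  have conv3: "cconv (\<lambda>n. F3 (r n)) \<gamma>" using cconv_subseq[OF r3(2) r4(1)] by (simp add: r_def)
  have conv4: "(\<lambda>n. c (r n)) \<longlonglongrightarrow> c0" using r4(2) by (simp add: o_def r_def)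
  have \<tau>r: "(\<lambda>n. \<tau> (r n)) \<longlonglongrightarrow> 0" using LIMSEQ_subseq_LIMSEQ[OF \<tau>(2) r] by (simp add: o_def)
  have sol: "viscosity_solution H c0 U"
    using discrete_limit_is_viscosity_solution[of "\<lambda>n. h (r n)" "\<lambda>n. \<tau> (r n)" C "\<lambda>n. c (r n)" "\<lambda>n. u (r n)" c0 U,
        OF h \<tau>(1) small \<tau>r hC C u(1) conv4] conv2 by (simp add: F2_def [abs_def])
  have d\<gamma>: "(\<gamma> has_vector_derivative f1 t) (at t)" for t
    using discrete_derivative[of "\<lambda>n. \<tau> (r n)" "\<lambda>n. X (r n)" "\<lambda>n. V (r n)", OF \<tau>(1) \<tau>r stepX] conv3 conv1
    by (simp add: F1_def [abs_def] F3_def [abs_def])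
  \<comment> \<open>Along a tight path the increments of u n are exactly \<tau> (L + c n), so the
    lemma that differentiates the limit curve also differentiates U along it.\<close>
  have dU: "((\<lambda>t. U (\<gamma> t)) has_vector_derivative L (\<gamma> t) (f1 t) + c0) (at t)" for t
  proof (rule discrete_derivative[of "\<lambda>n. \<tau> (r n)" "\<lambda>n k. u (r n) (X (r n) k)"
        "\<lambda>n k. L (X (r n) k) (V (r n) k) + c (r n)", OF \<tau>(1) \<tau>r])
    show "u (r n) (X (r n) (k + 1)) = u (r n) (X (r n) k) + \<tau> (r n) *\<^sub>R (L (X (r n) k) (V (r n) k) + c (r n))" for n k
      using X(4)[of "r n" k] by (simp add: tight_step_def V_def)
    have "F2 (r n) (F3 (r n) t) = u (r n) (X (r n) \<lfloor>t / \<tau> (r n)\<rfloor>)" for n t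
      by (simp add: F2_def F3_def round_mesh_id[OF hp(1) X(3)])
    then show "cconv (\<lambda>n t. u (r n) (X (r n) \<lfloor>t / \<tau> (r n)\<rfloor>)) (\<lambda>t. U (\<gamma> t))"
      using cconv_compose[OF conv2 conv3] by simp
    have "cconv (\<lambda>n t. L (F3 (r n) t) (F1 (r n) t) + c (r n)) (\<lambda>t. L (\<gamma> t) (f1 t) + c0)"
      using conv1 conv3 unfolding cconv_def
      by (intro allI tendsto_add tendsto_L filterlim_compose[OF conv4 filterlim_fst]) auto
    then show "cconv (\<lambda>n t. L (X (r n) \<lfloor>t / \<tau> (r n)\<rfloor>) (V (r n) \<lfloor>t / \<tau> (r n)\<rfloor>) + c (r n)) (\<lambda>t. L (\<gamma> t) (f1 t) + c0)"
      by (simp add: F1_def F3_def)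
  qed
  have cal: "calibrated U L c0 \<gamma>"
    by (rule calibratedI[OF d\<gamma> cconv_continuous_on[OF conv1] _ dU, of R]) (use lip in simp)
  have crit: "critical_value H = c0" by (rule critical_value_eq[OF sol])
  have "\<gamma> 0 = x0"
  proof (rule LIMSEQ_unique)
    show "(\<lambda>n. x (r n)) \<longlonglongrightarrow> \<gamma> 0" using cconvD[OF conv3 tendsto_const[of 0]] by (simp add: F3_def X(1))
    show "(\<lambda>n. x (r n)) \<longlonglongrightarrow> x0" using LIMSEQ_subseq_LIMSEQ[OF x r] by (simp add: o_def)
  qed
  moreover have "f1 0 = v0"
  proof (rule LIMSEQ_unique)
    show "(\<lambda>n. v (r n)) \<longlonglongrightarrow> f1 0"
      using cconvD[OF conv1 tendsto_const[of 0]] by (simp add: F1_def V_def X(2))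
    show "(\<lambda>n. v (r n)) \<longlonglongrightarrow> v0" using LIMSEQ_subseq_LIMSEQ[OF v r] by (simp add: o_def)
  qed
  ultimately have "(x0, v0) \<in> calibrated_set H U"
    unfolding calibrated_set_def crit using cal d\<gamma>[of 0] by blast
  moreover have "U \<in> weak_KAM_solutions H" using sol by (simp add: weak_KAM_solutions_def crit)
  ultimately show ?thesis unfolding mane_set_def by blast
qed

end

section \<open>From points of the Kuratowski limit to tight chains\<close>

theorem proposition5p2:
  fixes H :: "real ^ 'd::finite \<Rightarrow> real ^ 'd \<Rightarrow> real"
    and h \<tau> :: "nat \<Rightarrow> real" and C :: real
  assumes "tonelli_hamiltonian H"
    and "\<And>n. mesh_size (h n)"
    and "\<And>n. \<tau> n > 0"
    and "\<tau> \<longlonglongrightarrow> 0"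
    and "C > 0"
    and "\<And>n. h n \<le> C * (\<tau> n)\<^sup>2"
  shows "kuratowski_limsup (\<lambda>n. discrete_mather_set (lagrangian H) (h n) (\<tau> n)) \<subseteq> mane_set H"
proof
  fix z assume "z \<in> kuratowski_limsup (\<lambda>n. discrete_mather_set (lagrangian H) (h n) (\<tau> n))"
  then obtain k \<zeta> where k: "filterlim k at_top sequentially" and \<zeta>: "\<zeta> \<longlonglongrightarrow> z"
    and mem: "\<And>j. \<zeta> j \<in> discrete_mather_set (lagrangian H) (h (k j)) (\<tau> (k j))"
    unfolding kuratowski_limsup_def by blast
  obtain DH D2H where "tonelli H DH D2H" by (rule tonelli_hamiltonian_imp_tonelli[OF assms(1)])
  then interpret tonelli H DH D2H .
  obtain B \<tau>0 where B: "B > 0" "\<tau>0 > 0"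
    "\<And>h \<tau> c u x y z. mesh_size h \<Longrightarrow> 0 < \<tau> \<Longrightarrow> \<tau> \<le> \<tau>0 \<Longrightarrow> h \<le> C * \<tau>\<^sup>2 \<Longrightarrow> discrete_weak_KAM L h \<tau> c u \<Longrightarrow>
      x \<in> mesh_lattice h \<Longrightarrow> y \<in> mesh_lattice h \<Longrightarrow> z \<in> mesh_lattice h \<Longrightarrow>
      tight_step L \<tau> c u x y \<Longrightarrow> tight_step L \<tau> c u y z \<Longrightarrow>
      norm ((z - y) /\<^sub>R \<tau> - (y - x) /\<^sub>R \<tau>) \<le> B * \<tau>"
    using tight_velocity_lipschitz[OF assms(5)] by blast
  have \<tau>k: "(\<lambda>j. \<tau> (k j)) \<longlonglongrightarrow> 0" by (rule filterlim_compose[OF assms(4) k])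
  have "\<forall>\<^sub>F j in sequentially. \<tau> (k j) < min 1 \<tau>0"
    using order_tendstoD(2)[OF \<tau>k, of "min 1 \<tau>0"] B(2) by simp
  \<comment> \<open>The smallness of \<tau> holds only eventually, whereas
    \<open>limit_of_tight_paths\<close> asks for it at every index; hence the shift by J.\<close>
  then obtain J where J: "\<forall>j\<ge>J. \<tau> (k j) < min 1 \<tau>0" unfolding eventually_sequentially by blast
  define m where "m j = k (j + J)" for j
  have small: "\<tau> (m j) \<le> 1" "\<tau> (m j) \<le> \<tau>0" for j using J[rule_format, of "j + J"] by (auto simp: m_def)
  let ?P = "\<lambda>j. periodize (\<Union>\<mu>\<in>{\<mu>. discrete_mather_measure L (h (m j)) (\<tau> (m j)) \<mu>}.
       {(x, grid_velocity (\<tau> (m j)) x y l) | x y l. x \<in> grid (h (m j)) \<and> y \<in> grid (h (m j)) \<and> \<mu> x y l > 0})"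
  \<comment> \<open>A point of the closed Mather set need not belong to an edge of positive mass; it
    is replaced by a nearby support point, from which a chain starts.\<close>
  have "\<forall>j. \<exists>w. w \<in> ?P j \<and> dist w (\<zeta> (j + J)) < inverse (real (Suc j))"
  proof
    fix j
    have "\<zeta> (j + J) \<in> closure (?P j)" using mem[of "j + J"] by (simp add: discrete_mather_set_def m_def)
    then show "\<exists>w. w \<in> ?P j \<and> dist w (\<zeta> (j + J)) < inverse (real (Suc j))"
      unfolding closure_approachable by (meson inverse_positive_iff_positive of_nat_0_less_iff zero_less_Suc)
  qed
  from choice[OF this] obtain w where w: "\<And>j. w j \<in> ?P j"
    "\<And>j. dist (w j) (\<zeta> (j + J)) < inverse (real (Suc j))" by blast
  have "w \<longlonglongrightarrow> z"
  proof -
    have "(\<lambda>j. w j - \<zeta> (j + J)) \<longlonglongrightarrow> 0"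
      by (rule Lim_null_comparison[OF always_eventually LIMSEQ_inverse_real_of_nat])
        (use w(2) in \<open>auto simp: dist_norm less_imp_le\<close>)
    from tendsto_add[OF this LIMSEQ_ignore_initial_segment[OF \<zeta>, of J]] show ?thesis by simp
  qed
  have path: "\<exists>X :: int \<Rightarrow> real^'d. X 0 = fst (w j) \<and> (X 1 - X 0) /\<^sub>R \<tau> (m j) = snd (w j) \<and>
      (\<forall>k. X k \<in> mesh_lattice (h (m j))) \<and> (\<forall>k. tight_step L (\<tau> (m j)) c u (X k) (X (k + 1)))"
    if u: "discrete_weak_KAM L (h (m j)) (\<tau> (m j)) c u" for j u c
  proof -
    have "(fst (w j), snd (w j)) \<in> ?P j" using w(1)[of j] by simp
    from discrete_mather_path[OF assms(2,3) u this] show ?thesis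
      unfolding tight_step_def by metis
  qed
  have "(fst z, snd z) \<in> mane_set H"
  proof (rule limit_of_tight_paths[of "\<lambda>j. h (m j)" "\<lambda>j. \<tau> (m j)" C "\<lambda>j. fst (w j)" "\<lambda>j. snd (w j)"
        "fst z" "snd z" B, OF assms(2,3) _ assms(6,5) path])
    show "(\<lambda>j. \<tau> (m j)) \<longlonglongrightarrow> 0"
      using LIMSEQ_ignore_initial_segment[OF \<tau>k, of J] by (simp add: m_def)
    show "(\<lambda>j. fst (w j)) \<longlonglongrightarrow> fst z" "(\<lambda>j. snd (w j)) \<longlonglongrightarrow> snd z"
      using \<open>w \<longlonglongrightarrow> z\<close> by (auto intro: tendsto_fst tendsto_snd)
    show "norm ((z' - y) /\<^sub>R \<tau> (m j) - (y - x) /\<^sub>R \<tau> (m j)) \<le> B * \<tau> (m j)"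
      if "discrete_weak_KAM L (h (m j)) (\<tau> (m j)) c u" "x \<in> mesh_lattice (h (m j))"
        "y \<in> mesh_lattice (h (m j))" "z' \<in> mesh_lattice (h (m j))"
        "tight_step L (\<tau> (m j)) c u x y" "tight_step L (\<tau> (m j)) c u y z'" for j c u x y z'
      by (rule B(3)[OF assms(2,3) small(2) assms(6) that])
  qed (use small B(1) in auto)
  then show "z \<in> mane_set H" by simp
qed

end
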